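(* Let $\Xi_F=(S,\mathrm{wt})$ be a full passport with $|S|=N\ge2$. The combing map restricts to a bijection $\mathrm{Comb}:\mathbf{PT}(\Xi_F)\to\mathbf{TM}(\Xi_F)$.
   Context: Full passport: finite set $S$ with $\mathrm{wt}:S\to\mathbb{R}\setminus\{0\}$, $\sum_{s\in S}\mathrm{wt}(s)=0$. A permutation is a sequence $P=(s_1,\dots,s_N)$ listing each element of $S$ once; $H_0=0$, $H_i=\sum_{j\le i}\mathrm{wt}(s_j)$. $P$ is a tree permutation if (1) $H_i\ne0$ for $1\le i\le N-1$; (2) whenever $1\le k<l\le N$ and $H_{k-1}=H_l>0$, $\min\{H_k,\dots,H_{l-1}\}<H_{k-1}$; (3) whenever $1\le k<l\le N$ and $H_{k-1}=H_l<0$, $\max\{H_k,\dots,H_{l-1}\}>H_{k-1}$. $\mathbf{PT}(\Xi_F)$: set of tree permutations. LWBP-trees: a labeled weighted bicolored plane tree of passport $\Xi_F$ is a tree embedded in $\mathbb{R}^2$ whose vertices are bijectively labeled by $S$, with a positive real weight on each edge, each edge joining a black vertex ($\mathrm{wt}>0$) to a white vertex ($\mathrm{wt}<0$), such that for every vertex $s$ the sum of weights of incident edges is $|\mathrm{wt}(s)|$. Trees are taken up to orientation-preserving homeomorphisms of the plane preserving edges, weights and labels; equivalently, up to label- and weight-preserving graph isomorphisms preserving the anticlockwise cyclic order of edges at each vertex. $\mathrm{Tree}(\Xi_F)$ is the set of isomorphism classes; forests are defined likewise. $\mathbf{TM}(\Xi_F)=\{(T;a,b): T\in\mathrm{Tree}(\Xi_F),\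 a\ne b\in S\}$ (twice-marked trees). Combing map: set $\mathrm{Rec}_i=[i,i+1]\times[\min\{0,H_i\},\max\{0,H_i\}]$ and $R(P)=\bigcup_{i=1}^N\mathrm{Rec}_i$. The $i$-th vertical line is $\{i\}\times[\min(H_{i-1},H_i),\max(H_{i-1},H_i)]$, associated to vertex $i$ labeled $s_i$ (black if $\mathrm{wt}(s_i)>0$, else white). Extend each segment $[i,i+1]\times\{H_i\}$ in both directions until it reaches a boundary vertical line of $R(P)$; these maximal segments and $[1,N]\times\{0\}$ cut $R(P)$ into horizontal rectangles. A rectangle bounded on the left by the $k$-th and on the right by the $l$-th vertical line gives an edge between vertices $k,l$ of weight equal to its height. At vertex $i$, with $e_1,\dots,e_r$ the rectangles attached to the right of the $i$-th vertical line listed bottom to top and $e_{r+1},\dots,e_{r+t}$ those attached to its left listed top to bottom, the anticlockwise cyclic order at $i$ is $e_1\to\cdots\to e_{r+t}\to e_1$. This gives the labeled weighted bicolored forest $G(P)$, and $\mathrm{Comb}(P)=(G(P);s_1,s_N)$. *)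

theory Defs
  imports Complex_Main "HOL-Combinatorics.Combinatorics"
begin

section \<open>Full passports and tree permutations\<close>

definition full_passport :: "'s set \<Rightarrow> ('s \<Rightarrow> real) \<Rightarrow> bool" where
  "full_passport S wt \<longleftrightarrow> finite S \<and> (\<forall>s\<in>S. wt s \<noteq> 0) \<and> (\<Sum>s\<in>S. wt s) = 0"

text \<open>A permutation is a duplicate-free list; its \<open>i\<close>-th entry (counting from 1) is \<open>P ! (i - 1)\<close>.\<close>

definition height :: "('s \<Rightarrow> real) \<Rightarrow> 's list \<Rightarrow> nat \<Rightarrow> real" where
  "height wt P i = (\<Sum>j = 1..i. wt (P ! (j - 1)))"

definition tree_permutations :: "'s set \<Rightarrow> ('s \<Rightarrow> real) \<Rightarrow> 's list set" where
  "tree_permutations S wt = {P \<in> permutations_of_set S.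
     (\<forall>i. 1 \<le> i \<and> i \<le> card S - 1 \<longrightarrow> height wt P i \<noteq> 0) \<and>
     (\<forall>k l. 1 \<le> k \<and> k < l \<and> l \<le> card S \<and>
        height wt P (k - 1) = height wt P l \<and> height wt P l > 0 \<longrightarrow>
        Min (height wt P ` {k..l - 1}) < height wt P (k - 1)) \<and>
     (\<forall>k l. 1 \<le> k \<and> k < l \<and> l \<le> card S \<and>
        height wt P (k - 1) = height wt P l \<and> height wt P l < 0 \<longrightarrow>
        Max (height wt P ` {k..l - 1}) > height wt P (k - 1))}"


section \<open>Labeled weighted bicolored plane trees\<close>

text \<open>
  A plane graph is given by its rotation system: \<open>nxt T v e\<close> is the edge that follows \<open>e\<close>
  in the anticlockwise order around \<open>v\<close>. The value only matters when \<open>e\<close> is an edge incident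
  to \<open>v\<close>. The colour of a vertex is not stored, since it is the sign of the weight of its label.
\<close>

record ('v, 'e, 's) lw_plane_graph =
  verts :: "'v set"
  lab :: "'v \<Rightarrow> 's"
  edges :: "'e set"
  ends :: "'e \<Rightarrow> 'v set"
  edge_wt :: "'e \<Rightarrow> real"
  nxt :: "'v \<Rightarrow> 'e \<Rightarrow> 'e"

definition incident :: "('v, 'e, 's) lw_plane_graph \<Rightarrow> 'v \<Rightarrow> 'e set" where
  "incident T v = {e \<in> edges T. v \<in> ends T e}"

definition connected_graph :: "('v, 'e, 's) lw_plane_graph \<Rightarrow> bool" where
  "connected_graph T \<longleftrightarrow> verts T \<noteq> {} \<and>
     (\<forall>u\<in>verts T. \<forall>v\<in>verts T. (u, v) \<in> {(x, y). \<exists>e\<in>edges T. ends T e = {x, y}}\<^sup>*)"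

text \<open>
  A cycle runs through the distinct vertices \<open>vs\<close> along the distinct edges \<open>es\<close>. Loops and
  pairs of parallel edges count as cycles (of length 1 and 2).
\<close>

definition graph_cycle :: "('v, 'e, 's) lw_plane_graph \<Rightarrow> 'v list \<Rightarrow> 'e list \<Rightarrow> bool" where
  "graph_cycle T vs es \<longleftrightarrow>
     es \<noteq> [] \<and> length vs = length es \<and> distinct vs \<and> distinct es \<and> set es \<subseteq> edges T \<and>
     (\<forall>i<length es. ends T (es ! i) = {vs ! i, vs ! (Suc i mod length vs)})"

definition lwbp_tree :: "'s set \<Rightarrow> ('s \<Rightarrow> real) \<Rightarrow> ('v, 'e, 's) lw_plane_graph \<Rightarrow> bool" where
  "lwbp_tree S wt T \<longleftrightarrow>
     bij_betw (lab T) (verts T) S \<and>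
     finite (edges T) \<and>
     (\<forall>e\<in>edges T. \<exists>b\<in>verts T. \<exists>w\<in>verts T.
        ends T e = {b, w} \<and> wt (lab T b) > 0 \<and> wt (lab T w) < 0) \<and>
     connected_graph T \<and> (\<nexists>vs es. graph_cycle T vs es) \<and>
     (\<forall>e\<in>edges T. edge_wt T e > 0) \<and>
     (\<forall>v\<in>verts T. (\<Sum>e\<in>incident T v. edge_wt T e) = \<bar>wt (lab T v)\<bar>) \<and>
     (\<forall>v\<in>verts T. cyclic_on (nxt T v) (incident T v))"

definition plane_iso ::
  "('v, 'e, 's) lw_plane_graph \<Rightarrow> ('w, 'f, 's) lw_plane_graph \<Rightarrow> bool" where
  "plane_iso T T' \<longleftrightarrow> (\<exists>g f.
     bij_betw g (verts T) (verts T') \<and>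
     bij_betw f (edges T) (edges T') \<and>
     (\<forall>v\<in>verts T. lab T' (g v) = lab T v) \<and>
     (\<forall>e\<in>edges T. ends T' (f e) = g ` ends T e) \<and>
     (\<forall>e\<in>edges T. edge_wt T' (f e) = edge_wt T e) \<and>
     (\<forall>v\<in>verts T. \<forall>e\<in>incident T v. nxt T' (g v) (f e) = f (nxt T v e)))"


section \<open>The combing map\<close>

text \<open>\<open>Rect k l a b\<close> stands for the rectangle \<open>[k, l] \<times> [a, b]\<close> in the plane.\<close>

datatype rect = Rect (rect_left: nat) (rect_right: nat) (rect_bot: real) (rect_top: real)

definition rec_block :: "('s \<Rightarrow> real) \<Rightarrow> 's list \<Rightarrow> nat \<Rightarrow> (real \<times> real) set" where
  "rec_block wt P i =
     {real i..real (i + 1)} \<times> {min 0 (height wt P i)..max 0 (height wt P i)}"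

definition region :: "('s \<Rightarrow> real) \<Rightarrow> 's list \<Rightarrow> (real \<times> real) set" where
  "region wt P = (\<Union>i\<in>{1..length P}. rec_block wt P i)"

definition vline :: "('s \<Rightarrow> real) \<Rightarrow> 's list \<Rightarrow> nat \<Rightarrow> (real \<times> real) set" where
  "vline wt P i =
     {real i} \<times> {min (height wt P (i - 1)) (height wt P i)..max (height wt P (i - 1)) (height wt P i)}"

text \<open>
  A horizontal segment that is extended inside the region leaves the region exactly when it
  crosses a boundary vertical line. So the extension of \<open>[i, i + 1] \<times> {H\<^sub>i}\<close> is the largest
  horizontal segment around it that is contained in the region.
\<close>

definition maximal_segment :: "('s \<Rightarrow> real) \<Rightarrow> 's list \<Rightarrow> nat \<Rightarrow> (real \<times> real) set" where
  "maximal_segment wt P i =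
     \<Union> {{x..y} \<times> {height wt P i} | x y.
          x \<le> real i \<and> real (i + 1) \<le> y \<and> {x..y} \<times> {height wt P i} \<subseteq> region wt P}"

definition cuts :: "('s \<Rightarrow> real) \<Rightarrow> 's list \<Rightarrow> (real \<times> real) set" where
  "cuts wt P =
     {1..real (length P)} \<times> {0} \<union> (\<Union>i\<in>{1..length P}. maximal_segment wt P i)"

text \<open>
  The pieces into which the cuts divide the region: horizontal sides on cuts, vertical sides
  on vertical lines, and no cut through the interior.
\<close>

definition rects :: "('s \<Rightarrow> real) \<Rightarrow> 's list \<Rightarrow> rect set" where
  "rects wt P = {Rect k l a b | k l a b.
     1 \<le> k \<and> k < l \<and> l \<le> length P \<and> a < b \<and>
     {real k..real l} \<times> {a..b} \<subseteq> region wt P \<and>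
     {real k} \<times> {a..b} \<subseteq> vline wt P k \<and>
     {real l} \<times> {a..b} \<subseteq> vline wt P l \<and>
     {real k..real l} \<times> {a, b} \<subseteq> cuts wt P \<and>
     ({real k<..<real l} \<times> {a<..<b}) \<inter> cuts wt P = {}}"

definition rects_around :: "('s \<Rightarrow> real) \<Rightarrow> 's list \<Rightarrow> nat \<Rightarrow> rect list" where
  "rects_around wt P i =
     sorted_key_list_of_set rect_bot {r \<in> rects wt P. rect_left r = i} @
     rev (sorted_key_list_of_set rect_bot {r \<in> rects wt P. rect_right r = i})"

text \<open>\<open>cycle_of_list\<close> sends each list entry to the next one, and the last entry to the first.\<close>

definition comb_graph :: "('s \<Rightarrow> real) \<Rightarrow> 's list \<Rightarrow> (nat, rect, 's) lw_plane_graph" where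
  "comb_graph wt P =
     \<lparr>verts = {1..length P},
      lab = (\<lambda>i. P ! (i - 1)),
      edges = rects wt P,
      ends = (\<lambda>r. {rect_left r, rect_right r}),
      edge_wt = (\<lambda>r. rect_top r - rect_bot r),
      nxt = (\<lambda>i. cycle_of_list (rects_around wt P i))\<rparr>"

text \<open>
  Isomorphism classes need fixed types of vertices and edges. We take those of
  \<open>comb_graph\<close>; the lemma \<open>lwbp_tree_representative\<close> below shows that no tree is lost.
\<close>

definition iso_rel ::
  "((nat, rect, 's) lw_plane_graph \<times> (nat, rect, 's) lw_plane_graph) set" where
  "iso_rel = {(T, T'). plane_iso T T'}"

type_synonym 's iso_class = "(nat, rect, 's) lw_plane_graph set"

definition Tree :: "'s set \<Rightarrow> ('s \<Rightarrow> real) \<Rightarrow> 's iso_class set" where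
  "Tree S wt = {T. lwbp_tree S wt T} // iso_rel"

definition twice_marked_trees ::
  "'s set \<Rightarrow> ('s \<Rightarrow> real) \<Rightarrow> ('s iso_class \<times> 's \<times> 's) set" where
  "twice_marked_trees S wt = {(X, a, b). X \<in> Tree S wt \<and> a \<in> S \<and> b \<in> S \<and> a \<noteq> b}"

definition Comb :: "('s \<Rightarrow> real) \<Rightarrow> 's list \<Rightarrow> 's iso_class \<times> 's \<times> 's" where
  "Comb wt P = (iso_rel `` {comb_graph wt P}, hd P, last P)"

lemma infinite_rect: "infinite (UNIV :: rect set)"
proof
  assume "finite (UNIV :: rect set)"
  then have "finite (range (\<lambda>n. Rect n 0 0 0))"
    by (rule finite_subset[rotated]) simp
  moreover have "inj (\<lambda>n. Rect n 0 0 0)"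
    by (simp add: inj_def)
  ultimately show False
    using finite_imageD by blast
qed

lemma lwbp_tree_representative:
  fixes T :: "('v, 'e, 's) lw_plane_graph"
  assumes "full_passport S wt" and tree: "lwbp_tree S wt T"
  shows "\<exists>T' :: (nat, rect, 's) lw_plane_graph. plane_iso T T'"
proof -
  have "finite (verts T)"
    using assms by (auto simp: full_passport_def lwbp_tree_def bij_betw_finite)
  then obtain g :: "'v \<Rightarrow> nat" where g: "inj_on g (verts T)"
    using finite_imp_inj_to_nat_seg by metis
  have "finite (edges T)"
    using tree by (simp add: lwbp_tree_def)
  moreover obtain R :: "rect set" where "finite R" "card R = card (edges T)"
    using infinite_arbitrarily_large[OF infinite_rect] by metis
  ultimately obtain f where "bij_betw f (edges T) R"
    using finite_same_card_bij by metis
  then have f: "inj_on f (edges T)"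
    by (rule bij_betw_imp_inj_on)
  define T' :: "(nat, rect, 's) lw_plane_graph" where
    "T' = \<lparr>verts = g ` verts T, lab = (\<lambda>v. lab T (inv_into (verts T) g v)),
           edges = f ` edges T, ends = (\<lambda>e. g ` ends T (inv_into (edges T) f e)),
           edge_wt = (\<lambda>e. edge_wt T (inv_into (edges T) f e)),
           nxt = (\<lambda>v e. f (nxt T (inv_into (verts T) g v) (inv_into (edges T) f e)))\<rparr>"
  have "plane_iso T T'"
    unfolding plane_iso_def
    by (rule exI[of _ g], rule exI[of _ f])
      (use f g in \<open>auto simp: T'_def bij_betw_def incident_def\<close>)
  then show ?thesis ..
qed

end

theory Submission
  imports Defs "HOL-Library.Transitive_Closure_Table"
begin

text \<open>
  Draw the edges of a combed tree as arcs over the line of vertices \<open>1, \<dots>, N\<close>, above the line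
  where the height is positive and below it where it is negative. Then arcs on the same side do not
  cross, arcs on different sides do not overlap, and the rotation at every vertex is the one in
  which the arcs are attached. Conversely, given a tree with a vertex order of this kind, \<open>H\<^sub>i\<close> is the
  signed weight of the arcs over the gap between \<open>i\<close> and \<open>i + 1\<close>. This makes the order a tree
  permutation, and every arc is one of its rectangles; there are no further rectangles, since the
  total edge weight is determined by the passport.

  It remains to show that a plane tree with marks \<open>a \<noteq> b\<close> has exactly one such order that starts
  with \<open>a\<close> and ends with \<open>b\<close>. The first edge \<open>(a, p)\<close> of the path from \<open>a\<close> to \<open>b\<close> is the only arc over
  some gap, so the two components left by its removal occupy the positions before and after that
  gap. The vertices \<open>x\<close> and \<open>y\<close> next to the gap can be read off the rotations at \<open>a\<close> and \<open>p\<close>, and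
  induction applies to the components with the marks \<open>(a, x)\<close> and \<open>(y, b)\<close>.
\<close>

section \<open>Cyclic orders\<close>

text \<open>A rotation is cyclic and a vertex order is linear, so the two are compared through
  integer keys at each vertex, of which only the ternary relation \<open>cyc3\<close> matters. With
  the sign of the keys reversed at white vertices, the required order (right neighbours from far to
  near, then left ones from far to near) is the same for both colours; colours then only decide the
  side of an arc. The geometry is a discrete Jordan curve argument: a path that starts under an arc
  gets beyond it only through an end of the arc (\<open>no_escape\<close>). As \<open>a\<close> is
  first and \<open>b\<close> last, \<open>(a, p)\<close> is the longest arc at \<open>a\<close>, and
  the neighbour following \<open>p\<close> is the second farthest. At \<open>p\<close> the vertex
  \<open>a\<close> is the farthest left neighbour; what follows it is the next left neighbour or, if
  there is none, the farthest right one, and the position of \<open>b\<close> in the tree decides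
  which. On the side of permutations each gap is the lowest gap under exactly one rectangle. This
  gives connectedness and bounds the number of edges, hence acyclicity. Rectangles below the axis
  are always handled by negating the heights.\<close>

definition cyc3 :: "'a::linorder \<Rightarrow> 'a \<Rightarrow> 'a \<Rightarrow> bool" where
  "cyc3 a b c \<longleftrightarrow> a < b \<and> b < c \<or> b < c \<and> c < a \<or> c < a \<and> a < b"

text \<open>\<open>f\<close> goes to the next element of \<open>X\<close> in the cyclic order of the
  keys: no \<open>z\<close> lies between \<open>x\<close> and \<open>f x\<close>. If
  \<open>X\<close> has one element, the last clause is vacuous and \<open>f\<close> fixes
  it.\<close>

definition cyc_next :: "('a \<Rightarrow> 'a) \<Rightarrow> 'a set \<Rightarrow> ('a \<Rightarrow> int) \<Rightarrow> bool" where
  "cyc_next f X k \<longleftrightarrow> inj_on k X \<and> (\<forall>x\<in>X. f x \<in> X) \<and>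
     (\<forall>x\<in>X. \<forall>z\<in>X. z \<noteq> x \<longrightarrow> f x \<noteq> x \<and> (z \<noteq> f x \<longrightarrow> cyc3 (k x) (k (f x)) (k z)))"

lemma cyc_next_cyc3:
  "\<lbrakk>cyc_next f X k; x \<in> X; z \<in> X; z \<noteq> x; z \<noteq> f x\<rbrakk> \<Longrightarrow> cyc3 (k x) (k (f x)) (k z)"
  unfolding cyc_next_def by blast

lemma cyc_next_transfer:
  assumes "cyc_next f X k" "inj_on k' X"
    "\<And>x y z. \<lbrakk>x \<in> X; y \<in> X; z \<in> X\<rbrakk> \<Longrightarrow> cyc3 (k x) (k y) (k z) \<longleftrightarrow> cyc3 (k' x) (k' y) (k' z)"
  shows "cyc_next f X k'"
  using assms unfolding cyc_next_def by blast

text \<open>Neither \<open>a\<close> nor \<open>d\<close> lies on the arc from \<open>b\<close> to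
  \<open>c\<close>, so on the way from \<open>a\<close> to \<open>d\<close> either both ends of this
  arc are met or none.\<close>

lemma cyc3_exchange:
  assumes "cyc3 b c a" "cyc3 b c d"
  shows "cyc3 a c d \<longleftrightarrow> cyc3 a b d"
  using assms unfolding cyc3_def by (elim disjE conjE) auto

text \<open>Seen from \<open>m\<close>, passing from \<open>x\<close> to its successor removes only
  this successor from what is still to come. This is the induction step of
  \<open>cyc_next_agree\<close>.\<close>

lemma cyc3_step:
  assumes "cyc_next f X k" "m \<in> X" "x \<in> X" "y \<in> X" "x \<noteq> m" "f x \<noteq> m"
  shows "cyc3 (k m) (k (f x)) (k y) \<longleftrightarrow> y \<noteq> f x \<and> y \<noteq> x \<and> cyc3 (k m) (k x) (k y)"
proof -
  have m: "cyc3 (k x) (k (f x)) (k m)"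
    using cyc_next_cyc3[OF assms(1), of x m] assms by auto
  show ?thesis
  proof (cases "y = x \<or> y = f x")
    case True
    then show ?thesis using m by (auto simp: cyc3_def)
  next
    case False
    then have "cyc3 (k x) (k (f x)) (k y)"
      using cyc_next_cyc3[OF assms(1), of x y] assms by auto
    then show ?thesis
      using cyc3_exchange[OF m] False by simp
  qed
qed

text \<open>The successor map determines the cyclic order: the iterates of \<open>f\<close> from
  \<open>m\<close> run through \<open>X\<close> in this order, whatever the keys are.\<close>

lemma cyc_next_agree:
  assumes cyc: "cyclic_on f X" and k: "cyc_next f X k" and k': "cyc_next f X k'"
    and X: "m \<in> X" "x \<in> X" "y \<in> X"
  shows "cyc3 (k m) (k x) (k y) \<longleftrightarrow> cyc3 (k' m) (k' x) (k' y)"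
proof -
  \<comment> \<open>The step away from \<open>m\<close> is separate, since \<open>cyc3_step\<close>
    requires \<open>x\<close> to differ from \<open>m\<close>.\<close>
  have base: "cyc3 (h m) (h (f m)) (h y) \<longleftrightarrow> y \<noteq> m \<and> f m \<noteq> m \<and> y \<noteq> f m"
    if h: "cyc_next f X h" and y: "y \<in> X" for h :: "'a \<Rightarrow> int" and y
    using cyc_next_cyc3[OF h X(1) y] h X(1) y unfolding cyc_next_def cyc3_def by auto
  have "\<forall>y\<in>X. cyc3 (k m) (k ((f ^^ n) m)) (k y) \<longleftrightarrow> cyc3 (k' m) (k' ((f ^^ n) m)) (k' y)" for n
  proof (induction n)
    case 0
    then show ?case by (auto simp: cyc3_def)
  next
    case (Suc n)
    let ?x = "(f ^^ n) m"
    have xX: "?x \<in> X" using cyc X(1) by (rule cyclic_on_funpow_in)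
    consider "?x = m" | "f ?x = m" | "?x \<noteq> m" "f ?x \<noteq> m" by blast
    then show ?case
    proof cases
      case 1
      then show ?thesis using base[OF k] base[OF k'] by simp
    next
      case 2
      then show ?thesis by (auto simp: cyc3_def)
    next
      case 3
      then show ?thesis
        using Suc.IH cyc3_step[OF k X(1) xX _ 3] cyc3_step[OF k' X(1) xX _ 3] by simp
    qed
  qed
  moreover have "x \<in> orbit f m"
    using cyc X by (auto simp: cyclic_on_alldef)
  then obtain n where "x = (f ^^ n) m"
    by (auto simp: orbit_altdef)
  ultimately show ?thesis using X by blast
qed

lemma cyc_next_exists:
  assumes cyc: "cyclic_on f X"
  obtains k where "cyc_next f X k"
proof -
  obtain s where s: "s \<in> X" "X = orbit f s"
    using cyc by (auto simp: cyclic_on_def)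
  then have so: "s \<in> orbit f s" by simp
  define n where "n = funpow_dist1 f s s"
  have X: "X = (\<lambda>i. (f ^^ i) s) ` {0..<n}"
    using s orbit_conv_funpow_dist1[OF so] n_def by simp
  have inj: "inj_on (\<lambda>i. (f ^^ i) s) {0..<n}"
    using inj_on_funpow_dist1[OF so] n_def by simp
  have n: "(f ^^ n) s = s" "0 < n"
    using funpow_dist1_prop[OF so] by (auto simp: n_def)
  \<comment> \<open>The key of an element is its distance from \<open>s\<close> along the
    orbit.\<close>
  define k where "k x = int (the_inv_into {0..<n} (\<lambda>i. (f ^^ i) s) x)" for x
  have k: "k ((f ^^ i) s) = int i" if "i < n" for i
    unfolding k_def using the_inv_into_f_f[OF inj, of i] that by simp
  have step: "f ((f ^^ i) s) = (f ^^ (if Suc i = n then 0 else Suc i)) s" for i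
    using n by auto
  have "cyc_next f X k"
    unfolding cyc_next_def
  proof (intro conjI ballI impI)
    show "inj_on k X"
      unfolding X by (rule inj_onI) (auto simp: k)
    show "f x \<in> X" if "x \<in> X" for x
      using cyc that by (rule cyclic_on_inI)
  next
    fix x z assume xz: "x \<in> X" "z \<in> X" "z \<noteq> x"
    then obtain i j where ij: "x = (f ^^ i) s" "i < n" "z = (f ^^ j) s" "j < n" "i \<noteq> j"
      unfolding X by (metis (no_types, lifting) atLeastLessThan_iff imageE)
    define i' where "i' = (if Suc i = n then 0 else Suc i)"
    have i': "i' < n" "i' \<noteq> i" "f x = (f ^^ i') s"
      using step[of i] ij by (auto simp: i'_def)
    have "k (f x) = int i'" "k x = int i"
      using k[OF i'(1)] k[OF ij(2)] i'(3) ij(1) by simp_all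
    then show "f x \<noteq> x"
      using i'(2) by force
    assume "z \<noteq> f x"
    then have "j \<noteq> i'" using ij i' by auto
    then show "cyc3 (k x) (k (f x)) (k z)"
      using ij i' k[of i] k[of i'] k[of j] by (auto simp: cyc3_def i'_def split: if_splits)
  qed
  then show thesis by (rule that)
qed

lemma cyc3_rotate: "cyc3 a b c \<longleftrightarrow> cyc3 b c a"
  unfolding cyc3_def by blast

lemma cyc3_distinct: "cyc3 a b c \<Longrightarrow> a \<noteq> b \<and> b \<noteq> c \<and> c \<noteq> a"
  unfolding cyc3_def by auto

lemma cyc3_successor:
  assumes "cyc3 m n x" "cyc3 m n y"
  shows "cyc3 m x y \<longleftrightarrow> cyc3 n x y"
  using assms unfolding cyc3_def by (elim disjE conjE) auto

text \<open>A new element \<open>m\<close> is placed in a cyclic order by naming its successor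
  \<open>n\<close>. In this way the rotation at an end of the splitting edge is rebuilt from the
  rotation inside its component.\<close>

lemma cyc3_agree_insert:
  fixes h :: "'a \<Rightarrow> 'b::linorder" and k :: "'a \<Rightarrow> 'c::linorder"
  assumes agree: "\<And>x y z. \<lbrakk>x \<in> X; y \<in> X; z \<in> X\<rbrakk> \<Longrightarrow> cyc3 (h x) (h y) (h z) \<longleftrightarrow> cyc3 (k x) (k y) (k z)"
    and n: "X \<noteq> {} \<Longrightarrow> n \<in> X"
    and h: "\<And>z. \<lbrakk>z \<in> X; z \<noteq> n\<rbrakk> \<Longrightarrow> cyc3 (h m) (h n) (h z)"
    and k: "\<And>z. \<lbrakk>z \<in> X; z \<noteq> n\<rbrakk> \<Longrightarrow> cyc3 (k m) (k n) (k z)"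
    and xyz: "x \<in> insert m X" "y \<in> insert m X" "z \<in> insert m X"
  shows "cyc3 (h x) (h y) (h z) \<longleftrightarrow> cyc3 (k x) (k y) (k z)"
proof -
  have core: "cyc3 (h m) (h x) (h y) \<longleftrightarrow> cyc3 (k m) (k x) (k y)" if xy: "x \<in> X" "y \<in> X" for x y
  proof -
    consider "x = y" | "x \<noteq> y" "x = n" | "x \<noteq> y" "y = n" | "x \<noteq> n" "y \<noteq> n" by blast
    then show ?thesis
    proof cases
      case 1
      then show ?thesis by (auto dest: cyc3_distinct)
    next
      case 2
      then show ?thesis using h k xy by auto
    next
      case 3
      then have "cyc3 (h m) (h y) (h x)" "cyc3 (k m) (k y) (k x)"
        using h k xy by auto
      then show ?thesis unfolding cyc3_def by auto
    next
      case 4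
      then show ?thesis
        using cyc3_successor[OF h h, of x y] cyc3_successor[OF k k, of x y] agree[of n x y] n xy by auto
    qed
  qed
  consider "x \<in> X" "y \<in> X" "z \<in> X" | "x = m" "y \<in> X" "z \<in> X" | "y = m" "x \<in> X" "z \<in> X"
    | "z = m" "x \<in> X" "y \<in> X" | "x = y" | "y = z" | "x = z"
    using xyz by blast
  then show ?thesis
  proof cases
    case 1
    then show ?thesis by (rule agree)
  next
    case 2
    then show ?thesis using core by simp
  next
    case 3
    then show ?thesis using core[of z x] cyc3_rotate[of "h x" "h m" "h z"] cyc3_rotate[of "k x" "k m" "k z"] by simp
  next
    case 4
    then show ?thesis using core[of x y] cyc3_rotate[of "h m" "h x" "h y"] cyc3_rotate[of "k m" "k x" "k y"]
      by (metis cyc3_rotate)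
  qed (auto dest: cyc3_distinct)
qed

lemma cyc3_successor_exists:
  fixes h :: "'a \<Rightarrow> int"
  assumes "finite X" "X \<noteq> {}" "inj_on h (insert m X)" "m \<notin> X"
  shows "\<exists>n\<in>X. \<forall>z\<in>X. z \<noteq> n \<longrightarrow> cyc3 (h m) (h n) (h z)"
  using assms
proof (induction X rule: finite_ne_induct)
  case (singleton x)
  then show ?case by auto
next
  case (insert x F)
  then have "inj_on h (insert m F)"
    by (auto simp: inj_on_def)
  then obtain n where n: "n \<in> F" "\<forall>z\<in>F. z \<noteq> n \<longrightarrow> cyc3 (h m) (h n) (h z)"
    using insert by blast
  have ne: "h m \<noteq> h n" "h x \<noteq> h n" "h m \<noteq> h x"
    using insert.prems insert.hyps n(1) by (auto simp: inj_on_def)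
  show ?case
  proof (cases "cyc3 (h m) (h n) (h x)")
    case True
    then show ?thesis using n by auto
  next
    case False
    then have x: "cyc3 (h m) (h x) (h n)"
      using ne unfolding cyc3_def by linarith
    have "cyc3 (h m) (h x) (h z)" if "z \<in> F" for z
      using x n that ne by (cases "z = n") (auto simp: cyc3_def)
    then show ?thesis by auto
  qed
qed

lemma cyc_next_list:
  assumes "distinct cs" and sorted: "sorted_wrt (\<lambda>x y. k x < k y) cs"
  shows "cyc_next (cycle_of_list cs) (set cs) k"
  unfolding cyc_next_def
proof (intro conjI ballI impI)
  have mono: "k (cs ! i) < k (cs ! j)" if "i < j" "j < length cs" for i j
    using sorted that by (simp add: sorted_wrt_iff_nth_less)
  show "inj_on k (set cs)"
    by (rule inj_onI) (metis in_set_conv_nth linorder_neq_iff mono)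
  have nx: "cycle_of_list cs (cs ! i) = cs ! (Suc i mod length cs)" if "i < length cs" for i
  proof -
    have "map (cycle_of_list cs) cs ! i = rotate1 cs ! i"
      using cyclic_rotation[OF assms(1), of 1] by simp
    then show ?thesis using that by (simp add: nth_rotate1)
  qed
  fix x assume "x \<in> set cs"
  then obtain i where i: "i < length cs" "x = cs ! i"
    by (auto simp: in_set_conv_nth)
  then have pos: "Suc i mod length cs < length cs" by (intro mod_less_divisor) auto
  then show "cycle_of_list cs x \<in> set cs"
    using nx[OF i(1)] i(2) by simp
  fix z assume "z \<in> set cs" "z \<noteq> x"
  then obtain j where j: "j < length cs" "z = cs ! j" "j \<noteq> i"
    using i by (auto simp: in_set_conv_nth)
  define i' where "i' = Suc i mod length cs"
  have i'_eq: "i' = (if Suc i = length cs then 0 else Suc i)"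
    using i(1) by (auto simp: i'_def)
  have i'i: "i' \<noteq> i" using i j by (auto simp: i'_eq)
  then show "cycle_of_list cs x \<noteq> x"
    using nx[OF i(1)] i pos assms(1) by (simp add: i'_def nth_eq_iff_index_eq)
  assume "z \<noteq> cycle_of_list cs x"
  then have "j \<noteq> i'" using nx[OF i(1)] i j by (auto simp: i'_def)
  then have "cyc3 (k (cs ! i)) (k (cs ! i')) (k (cs ! j))"
  proof (cases "i < j")
    case True
    then show ?thesis
      using mono[of i i'] mono[of i' j] j \<open>j \<noteq> i'\<close> by (auto simp: cyc3_def i'_eq)
  next
    case False
    then have "j < i" using j by simp
    then show ?thesis
      using mono[of i i'] mono[of i' j] mono[of j i] i(1) \<open>j \<noteq> i'\<close>
      by (auto simp: cyc3_def i'_eq split: if_splits)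
  qed
  then show "cyc3 (k x) (k (cycle_of_list cs x)) (k z)"
    using nx[OF i(1)] i j by (simp add: i'_def)
qed

text \<open>At a white vertex only a rotation of the list of rectangles is sorted by the keys;
  \<open>cycle_of_list\<close> does not distinguish the two.\<close>

lemma cyc_next_rotate:
  assumes "distinct (xs @ ys)" "sorted_wrt (\<lambda>x y. k x < k y) (ys @ xs)"
  shows "cyc_next (cycle_of_list (xs @ ys)) (set (xs @ ys)) k"
proof -
  have "cycle_of_list (xs @ ys) = cycle_of_list (rotate (length xs) (xs @ ys))"
    using assms(1) by (rule cycle_of_list_rotate_independent)
  also have "rotate (length xs) (xs @ ys) = ys @ xs"
    by (rule rotate_append)
  finally show ?thesis
    using cyc_next_list[OF _ assms(2)] assms(1) by (auto simp: Un_commute Int_commute)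
qed

lemma cyclic_on_cycle_of_list:
  assumes "distinct cs" "cs \<noteq> []"
  shows "cyclic_on (cycle_of_list cs) (set cs)"
proof (rule cyclic_on_singleI)
  have iter: "(cycle_of_list cs ^^ i) (hd cs) = cs ! i" if "i < length cs" for i
  proof -
    have "map (cycle_of_list cs ^^ i) cs ! 0 = rotate i cs ! 0"
      using cyclic_rotation[OF assms(1), of i] by simp
    then show ?thesis using that assms(2) by (simp add: nth_rotate hd_conv_nth)
  qed
  show "hd cs \<in> set cs" using assms(2) by simp
  have perm: "cycle_of_list cs permutes set cs" by (rule cycle_permutes)
  have self: "hd cs \<in> orbit (cycle_of_list cs) (hd cs)"
    by (intro permutation_self_in_orbit permutation_of_cycle)
  show "set cs = orbit (cycle_of_list cs) (hd cs)"
  proof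
    show "set cs \<subseteq> orbit (cycle_of_list cs) (hd cs)"
      using iter self by (auto simp: in_set_conv_nth) (metis funpow_in_orbit)
    show "orbit (cycle_of_list cs) (hd cs) \<subseteq> set cs"
      using perm \<open>hd cs \<in> set cs\<close> by (meson permutes_orbit_subset)
  qed
qed

section \<open>Trees and their branches\<close>

text \<open>Edges are pairs in both directions. Acyclicity is expressed by saying that every edge is
  a bridge, which is what makes its two branches disjoint.\<close>

definition tree_on :: "'v set \<Rightarrow> ('v \<times> 'v) set \<Rightarrow> bool" where
  "tree_on V A \<longleftrightarrow> finite V \<and> A \<subseteq> V \<times> V \<and> sym A \<and> (\<forall>u\<in>V. \<forall>v\<in>V. (u, v) \<in> A\<^sup>*) \<and>
     (\<forall>u v. (u, v) \<in> A \<longrightarrow> (u, v) \<notin> (A - {(u, v), (v, u)})\<^sup>*)"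

definition branch :: "('v \<times> 'v) set \<Rightarrow> 'v \<Rightarrow> 'v \<Rightarrow> 'v set" where
  "branch A u v = {w. (u, w) \<in> (A - {(u, v), (v, u)})\<^sup>*}"

text \<open>A discrete intermediate value argument. The path to \<open>c\<close> is kept in the
  conclusion because it tells in which branch the leaving edge lies.\<close>

lemma rtrancl_exit:
  assumes "(m, n) \<in> B\<^sup>*" "m \<in> Q" "n \<notin> Q"
  shows "\<exists>c d. (m, c) \<in> B\<^sup>* \<and> (c, d) \<in> B \<and> c \<in> Q \<and> d \<notin> Q"
proof -
  have "n \<notin> Q \<longrightarrow> (\<exists>c d. (m, c) \<in> B\<^sup>* \<and> (c, d) \<in> B \<and> c \<in> Q \<and> d \<notin> Q)"
    using assms(1)
  proof (induction rule: rtrancl_induct)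
    case base
    then show ?case using assms(2) by blast
  next
    case (step y z)
    then show ?case by blast
  qed
  then show ?thesis using assms(3) by simp
qed

lemma sym_rtranclD: "sym B \<Longrightarrow> (x, y) \<in> B\<^sup>* \<Longrightarrow> (y, x) \<in> B\<^sup>*"
  by (meson sym_rtrancl symD)

lemma branch_self: "u \<in> branch A u v"
  by (simp add: branch_def)

lemma branch_into:
  assumes "u \<in> branch A a p" "(u, v) \<in> A" "(u, v) \<notin> {(a, p), (p, a)}"
  shows "v \<in> branch A a p"
  using assms unfolding branch_def by (auto intro: rtrancl_into_rtrancl)

text \<open>The edge wanted is the one used when the path leaves \<open>a\<close> for the last time:
  whenever the path is at \<open>a\<close>, the choice of \<open>p\<close> starts afresh.\<close>

lemma first_edge_towards:
  assumes "(a, b) \<in> A\<^sup>*" "a \<noteq> b"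
  obtains p where "(a, p) \<in> A" "b \<in> branch A p a"
proof -
  have "a \<noteq> b \<longrightarrow> (\<exists>p. (a, p) \<in> A \<and> b \<in> branch A p a)"
    using assms(1)
  proof (induction rule: rtrancl_induct)
    case base
    then show ?case by simp
  next
    case (step c d)
    show ?case
    proof (cases "c = a")
      case True
      then show ?thesis using step(2) by (intro impI exI[of _ d] conjI branch_self) simp
    next
      case False
      then obtain p where p: "(a, p) \<in> A" "c \<in> branch A p a"
        using step by blast
      show ?thesis
      proof (cases "d = a")
        case False
        then have "d \<in> branch A p a"
          using branch_into[OF p(2) step(2)] \<open>c \<noteq> a\<close> by blast
        then show ?thesis using p(1) by blast
      qed simp
    qed
  qed
  then show thesis using assms(2) that by blast
qed

context
  fixes V :: "'v set" and A :: "('v \<times> 'v) set"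
  assumes tree: "tree_on V A"
begin

lemma tree_sym: "(u, v) \<in> A \<Longrightarrow> (v, u) \<in> A"
  using tree by (auto simp: tree_on_def dest: symD)

lemma tree_vertex: "(u, v) \<in> A \<Longrightarrow> u \<in> V" "(u, v) \<in> A \<Longrightarrow> v \<in> V"
  using tree by (auto simp: tree_on_def)

lemma tree_finite: "finite V"
  using tree by (simp add: tree_on_def)

lemma tree_finite_neighbours: "finite {z. (v, z) \<in> A}"
  using tree_finite by (rule rev_finite_subset) (auto dest: tree_vertex)

lemma tree_connected: "u \<in> V \<Longrightarrow> v \<in> V \<Longrightarrow> (u, v) \<in> A\<^sup>*"
  using tree by (simp add: tree_on_def)

lemma tree_irrefl: "(u, v) \<in> A \<Longrightarrow> u \<noteq> v"
  using tree unfolding tree_on_def by blast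

lemma sym_cut: "sym (A - {(u, v), (v, u)})"
  using tree_sym unfolding sym_def by blast

lemma mem_branch_iff: "w \<in> branch A u v \<longleftrightarrow> (w, u) \<in> (A - {(u, v), (v, u)})\<^sup>*"
  unfolding branch_def using sym_cut[of u v] by (blast dest: sym_rtranclD)

lemma branch_disjoint:
  assumes "(a, p) \<in> A" shows "branch A a p \<inter> branch A p a = {}"
proof (rule ccontr)
  assume "branch A a p \<inter> branch A p a \<noteq> {}"
  then obtain w where "(a, w) \<in> (A - {(a, p), (p, a)})\<^sup>*" "(p, w) \<in> (A - {(a, p), (p, a)})\<^sup>*"
    by (auto simp: branch_def insert_commute)
  then have "(a, p) \<in> (A - {(a, p), (p, a)})\<^sup>*"
    using sym_cut by (meson rtrancl_trans sym_rtranclD)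
  then show False using assms tree by (simp add: tree_on_def)
qed

lemma branch_step:
  assumes "u \<in> branch A a p" "(u, v) \<in> A"
  shows "v \<in> branch A a p \<or> (u = a \<and> v = p) \<or> (u = p \<and> v = a)"
  using branch_into[OF assms] by blast

lemma branch_leave:
  assumes "(a, p) \<in> A" "u \<in> branch A a p" "(u, v) \<in> A" "v \<notin> branch A a p"
  shows "u = a" "v = p"
proof -
  have "p \<notin> branch A a p"
    using branch_disjoint[OF assms(1)] branch_self[of p A a] by blast
  then show "u = a" "v = p"
    using branch_step[OF assms(2,3)] assms(2,4) by blast+
qed

lemma branch_Un:
  assumes "(a, p) \<in> A" shows "branch A a p \<union> branch A p a = V"
proof
  have "w \<in> V" if "(u, w) \<in> (A - S)\<^sup>*" "u \<in> V" for u w S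
    using that by (induction rule: rtrancl_induct) (auto dest: tree_vertex)
  then show "branch A a p \<union> branch A p a \<subseteq> V"
    using tree_vertex[OF assms] unfolding branch_def by blast
  show "V \<subseteq> branch A a p \<union> branch A p a"
  proof (rule ccontr)
    assume "\<not> ?thesis"
    then obtain w where w: "w \<in> V" "w \<notin> branch A a p \<union> branch A p a" by blast
    then have "(a, w) \<in> A\<^sup>*" using tree_vertex[OF assms] tree_connected by blast
    then obtain c d where "(c, d) \<in> A" "c \<in> branch A a p \<union> branch A p a" "d \<notin> branch A a p \<union> branch A p a"
      using rtrancl_exit[OF _ _ w(2)] branch_self[of a A p] by (metis UnI1)
    then show False
      using branch_leave[OF assms, of c d] branch_leave[OF tree_sym[OF assms], of c d]
        branch_self[of a A p] branch_self[of p A a] by blast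
  qed
qed

lemma branch_subset: "(a, p) \<in> A \<Longrightarrow> branch A a p \<subseteq> V"
  using branch_Un by blast

lemma branch_rtrancl:
  assumes "w \<in> branch A a p"
  shows "(a, w) \<in> (A \<inter> (branch A a p \<times> branch A a p))\<^sup>*"
proof -
  have "(a, w) \<in> (A - {(a, p), (p, a)})\<^sup>*" using assms by (simp add: branch_def)
  then show ?thesis
  proof (induction rule: rtrancl_induct)
    case base
    then show ?case by simp
  next
    case (step y z)
    then have y: "y \<in> branch A a p" by (simp add: branch_def)
    then have "z \<in> branch A a p"
      using step(2) by (auto intro: branch_into)
    with y have "(y, z) \<in> A \<inter> (branch A a p \<times> branch A a p)"
      using step(2) by blast
    with step.IH show ?case by (rule rtrancl_into_rtrancl)
  qed
qed

lemma tree_on_branch: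
  assumes "(a, p) \<in> A"
  shows "tree_on (branch A a p) (A \<inter> (branch A a p \<times> branch A a p))" (is "tree_on ?P ?B")
  unfolding tree_on_def
proof (intro conjI ballI allI impI)
  show "finite ?P" using tree_finite branch_subset[OF assms] by (rule rev_finite_subset)
  show "sym ?B" using tree_sym unfolding sym_def by blast
  then show "(u, v) \<in> ?B\<^sup>*" if "u \<in> ?P" "v \<in> ?P" for u v
    using branch_rtrancl that by (meson rtrancl_trans sym_rtranclD)
  fix u v assume "(u, v) \<in> ?B"
  then have "(u, v) \<notin> (A - {(u, v), (v, u)})\<^sup>*"
    using tree by (simp add: tree_on_def)
  moreover have "(?B - {(u, v), (v, u)})\<^sup>* \<subseteq> (A - {(u, v), (v, u)})\<^sup>*"
    by (intro rtrancl_mono) blast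
  ultimately show "(u, v) \<notin> (?B - {(u, v), (v, u)})\<^sup>*" by blast
qed blast

lemma branch_neighbour:
  assumes "(a, p) \<in> A" "branch A a p \<noteq> {a}"
  obtains z where "(a, z) \<in> A" "z \<noteq> p"
proof -
  obtain w where "w \<in> branch A a p" "w \<noteq> a"
    using assms(2) branch_self[of a A p] by blast
  then have "(a, w) \<in> (A - {(a, p), (p, a)})\<^sup>*" by (simp add: branch_def)
  then obtain z where "(a, z) \<in> A - {(a, p), (p, a)}"
    using \<open>w \<noteq> a\<close> by (metis converse_rtranclE)
  then show thesis using that by blast
qed

lemma neighbour_in_branch:
  assumes "(a, p) \<in> A" "(a, z) \<in> A" "z \<noteq> p" shows "z \<in> branch A a p"
  using branch_step[OF branch_self[of a A p] assms(2)] assms tree_irrefl by blast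

end

section \<open>Compatible vertex orders\<close>

text \<open>
  Key of the neighbour \<open>u\<close> of \<open>v\<close>: around a black vertex the edges occur, anticlockwise, as the
  right edges from far to near followed by the left edges from far to near. Around a white vertex
  the same list occurs clockwise.
\<close>

definition vkey :: "('v \<Rightarrow> nat) \<Rightarrow> 'v \<Rightarrow> 'v \<Rightarrow> int" where
  "vkey pos v u = (if pos v < pos u then - int (pos u) else int (pos u))"

text \<open>
  Edges are drawn as arcs over the line of vertices: above it if the left end has colour \<open>True\<close>,
  below it otherwise. Arcs on the same side do not cross, arcs on different sides do not overlap.
\<close>

definition arcs_compat :: "('v \<times> 'v) set \<Rightarrow> ('v \<Rightarrow> bool) \<Rightarrow> ('v \<Rightarrow> nat) \<Rightarrow> bool" where
  "arcs_compat A col pos \<longleftrightarrow> (\<forall>x y u v. (x, y) \<in> A \<longrightarrow> (u, v) \<in> A \<longrightarrow> pos x < pos y \<longrightarrow> pos u < pos v \<longrightarrow>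
     (if col x = col u then \<not> (pos x < pos u \<and> pos u < pos y \<and> pos y < pos v)
      else pos y \<le> pos u \<or> pos v \<le> pos x))"

definition rotation_compat :: "('v \<times> 'v) set \<Rightarrow> ('v \<Rightarrow> 'v \<Rightarrow> int) \<Rightarrow> ('v \<Rightarrow> nat) \<Rightarrow> bool" where
  "rotation_compat A h pos \<longleftrightarrow> (\<forall>v x y z. (v, x) \<in> A \<longrightarrow> (v, y) \<in> A \<longrightarrow> (v, z) \<in> A \<longrightarrow>
     (cyc3 (h v x) (h v y) (h v z) \<longleftrightarrow> cyc3 (vkey pos v x) (vkey pos v y) (vkey pos v z)))"

definition order_compat ::
  "'v set \<Rightarrow> ('v \<times> 'v) set \<Rightarrow> ('v \<Rightarrow> bool) \<Rightarrow> ('v \<Rightarrow> 'v \<Rightarrow> int) \<Rightarrow> ('v \<Rightarrow> nat) \<Rightarrow> bool" where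
  "order_compat V A col h pos \<longleftrightarrow> inj_on pos V \<and> arcs_compat A col pos \<and> rotation_compat A h pos"

definition between_ends :: "'v set \<Rightarrow> 'v \<Rightarrow> 'v \<Rightarrow> ('v \<Rightarrow> nat) \<Rightarrow> bool" where
  "between_ends V a b pos \<longleftrightarrow> (\<forall>v\<in>V. pos a \<le> pos v \<and> pos v \<le> pos b)"

definition proper_colouring :: "('v \<times> 'v) set \<Rightarrow> ('v \<Rightarrow> bool) \<Rightarrow> bool" where
  "proper_colouring A col \<longleftrightarrow> (\<forall>x y. (x, y) \<in> A \<longrightarrow> col x \<noteq> col y)"

lemma order_compat_subset:
  assumes "order_compat V A col h pos" "W \<subseteq> V" "B \<subseteq> A"
  shows "order_compat W B col h pos"
proof -
  have "inj_on pos W"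
    using assms by (auto simp: order_compat_def intro: inj_on_subset)
  moreover have "arcs_compat B col pos"
    using assms unfolding order_compat_def arcs_compat_def by (meson subsetD)
  moreover have "rotation_compat B h pos"
    using assms unfolding order_compat_def rotation_compat_def by (meson subsetD)
  ultimately show ?thesis by (simp add: order_compat_def)
qed

lemma vkey_less:
  "vkey pos v x < vkey pos v y \<longleftrightarrow>
     (if pos v < pos x then pos v < pos y \<longrightarrow> pos y < pos x else \<not> pos v < pos y \<and> pos x < pos y)"
  by (auto simp: vkey_def)

text \<open>The keys contain the positions themselves, but their order depends only on comparisons
  of positions. So a component may be shifted along the line without changing its rotations.\<close>

lemma cyc3_vkey_cong:
  assumes "\<And>u w. \<lbrakk>u \<in> {v, x, y, z}; w \<in> {v, x, y, z}\<rbrakk> \<Longrightarrow> pos u < pos w \<longleftrightarrow> pos' u < pos' w"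
  shows "cyc3 (vkey pos v x) (vkey pos v y) (vkey pos v z) \<longleftrightarrow>
         cyc3 (vkey pos' v x) (vkey pos' v y) (vkey pos' v z)"
  unfolding cyc3_def vkey_less by (simp add: assms)

text \<open>
  The first edge \<open>(a, p)\<close> of the path from \<open>a\<close> to \<open>b\<close> separates the vertices into those before and
  those after some gap. Then \<open>x\<close> is the last vertex before the gap and \<open>y\<close> the first one after it.
\<close>

definition split_at ::
  "('v \<times> 'v) set \<Rightarrow> ('v \<Rightarrow> 'v \<Rightarrow> int) \<Rightarrow> 'v \<Rightarrow> 'v \<Rightarrow> 'v \<Rightarrow> 'v \<Rightarrow> 'v \<Rightarrow> bool" where
  "split_at A h a b p x y \<longleftrightarrow> (a, p) \<in> A \<and> b \<in> branch A p a \<and>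
     (if branch A a p = {a} then x = a
      else (a, x) \<in> A \<and> x \<noteq> p \<and>
        (\<forall>z. (a, z) \<in> A \<and> z \<noteq> p \<and> z \<noteq> x \<longrightarrow> cyc3 (h a p) (h a x) (h a z))) \<and>
     (if branch A p a = {p} then y = p
      else \<exists>q. (p, q) \<in> A \<and> q \<noteq> a \<and>
        (\<forall>z. (p, z) \<in> A \<and> z \<noteq> a \<and> z \<noteq> q \<longrightarrow> cyc3 (h p a) (h p q) (h p z)) \<and>
        y = (if b \<in> branch (A \<inter> (branch A p a \<times> branch A p a)) q p then p else q))"

lemma split_at_exists:
  assumes tree: "tree_on V A" and inj: "\<And>v. inj_on (h v) {z. (v, z) \<in> A}"
    and ab: "a \<in> V" "b \<in> V" "a \<noteq> b"
  shows "\<exists>p x y. split_at A h a b p x y"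
proof -
  have next_neighbour: "\<exists>n. (v, n) \<in> A \<and> n \<noteq> m \<and>
      (\<forall>z. (v, z) \<in> A \<and> z \<noteq> m \<and> z \<noteq> n \<longrightarrow> cyc3 (h v m) (h v n) (h v z))"
    if "(v, m) \<in> A" "branch A v m \<noteq> {v}" for v m
  proof -
    let ?X = "{z. (v, z) \<in> A} - {m}"
    have "?X \<noteq> {}"
      using branch_neighbour[OF tree that] by blast
    moreover have "insert m ?X = {z. (v, z) \<in> A}"
      using that(1) by blast
    ultimately show ?thesis
      using cyc3_successor_exists[of ?X "h v" m] tree_finite_neighbours[OF tree, of v] inj[of v]
      by auto
  qed
  obtain p where p: "(a, p) \<in> A" "b \<in> branch A p a"
    using first_edge_towards[OF tree_connected[OF tree ab(1,2)] ab(3)] by blast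
  have "\<exists>x. if branch A a p = {a} then x = a
      else (a, x) \<in> A \<and> x \<noteq> p \<and>
        (\<forall>z. (a, z) \<in> A \<and> z \<noteq> p \<and> z \<noteq> x \<longrightarrow> cyc3 (h a p) (h a x) (h a z))"
    using next_neighbour[OF p(1)] by (cases "branch A a p = {a}") auto
  moreover have "\<exists>y. if branch A p a = {p} then y = p
      else \<exists>q. (p, q) \<in> A \<and> q \<noteq> a \<and>
        (\<forall>z. (p, z) \<in> A \<and> z \<noteq> a \<and> z \<noteq> q \<longrightarrow> cyc3 (h p a) (h p q) (h p z)) \<and>
        y = (if b \<in> branch (A \<inter> (branch A p a \<times> branch A p a)) q p then p else q)"
    using next_neighbour[OF tree_sym[OF tree p(1)]] by (cases "branch A p a = {p}") auto
  ultimately show ?thesis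
    unfolding split_at_def using p by blast
qed

section \<open>Arcs as barriers\<close>

locale ordered_tree =
  fixes V :: "'v set" and A :: "('v \<times> 'v) set" and col h and pos :: "'v \<Rightarrow> nat" and a b :: 'v
  assumes tree: "tree_on V A" and proper: "proper_colouring A col"
    and compat: "order_compat V A col h pos" and ends: "between_ends V a b pos"
    and a: "a \<in> V" and b: "b \<in> V"
begin

lemma pos_inj: "\<lbrakk>u \<in> V; v \<in> V; pos u = pos v\<rbrakk> \<Longrightarrow> u = v"
  using compat by (auto simp: order_compat_def inj_on_def)

lemma pos_first: "v \<in> V \<Longrightarrow> v \<noteq> a \<Longrightarrow> pos a < pos v"
  using ends a pos_inj unfolding between_ends_def by (metis nat_less_le)

lemma pos_last: "v \<in> V \<Longrightarrow> v \<noteq> b \<Longrightarrow> pos v < pos b"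
  using ends b pos_inj unfolding between_ends_def by (metis nat_less_le)

lemma same_side:
  assumes "(x, y) \<in> A" "(u, v) \<in> A" "pos x < pos y" "pos u < pos v" "pos u < pos y" "pos x < pos v"
  shows "col x = col u"
  using compat assms unfolding order_compat_def arcs_compat_def by (meson not_le)

text \<open>Overlapping arcs must be on the same side, and there crossing is forbidden; so the sides
  need not be mentioned.\<close>

lemma no_cross:
  assumes st: "(s, t) \<in> A" and cd: "(c, d) \<in> A" and c: "pos s < pos c" "pos c < pos t"
    and d: "pos d < pos s \<or> pos t < pos d"
  shows False
proof -
  have arcs: "\<not> (pos x < pos u \<and> pos u < pos y \<and> pos y < pos v)"
    if "(x, y) \<in> A" "(u, v) \<in> A" for x y u v
  proof
    assume *: "pos x < pos u \<and> pos u < pos y \<and> pos y < pos v"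
    then have "pos x < pos y" "pos u < pos v" by auto
    with * that show False
      using compat same_side[of x y u v] unfolding order_compat_def arcs_compat_def
      by (meson less_trans)
  qed
  show False
    using d arcs[OF tree_sym[OF tree cd] st] arcs[OF st cd] c by blast
qed

text \<open>The discrete Jordan curve argument: the step by which the path leaves the interval
  between \<open>s\<close> and \<open>t\<close> would end in \<open>s\<close> or \<open>t\<close> or
  cross the arc \<open>(s, t)\<close>.\<close>

lemma no_escape:
  assumes st: "(s, t) \<in> A" and path: "(m, n) \<in> B\<^sup>*" and B: "B \<subseteq> A"
    and m: "pos s < pos m" "pos m < pos t" and n: "pos n < pos s \<or> pos t < pos n"
    and avoid: "(m, s) \<notin> B\<^sup>*" "(m, t) \<notin> B\<^sup>*"
  shows False
proof -
  have "\<exists>c d. (m, c) \<in> B\<^sup>* \<and> (c, d) \<in> B \<and> c \<in> {v. pos s < pos v \<and> pos v < pos t} \<and>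
      d \<notin> {v. pos s < pos v \<and> pos v < pos t}"
    using m n by (intro rtrancl_exit[OF path]) auto
  then obtain c d where cd: "(m, c) \<in> B\<^sup>*" "(c, d) \<in> B" "pos s < pos c" "pos c < pos t"
    "\<not> (pos s < pos d \<and> pos d < pos t)"
    by blast
  have "(c, d) \<in> A" using cd(2) B by blast
  have "(m, d) \<in> B\<^sup>*" using cd(1,2) by (rule rtrancl_into_rtrancl)
  then have "d \<noteq> s" "d \<noteq> t" using avoid by auto
  then have "pos d \<noteq> pos s" "pos d \<noteq> pos t"
    using pos_inj tree_vertex[OF tree] \<open>(c, d) \<in> A\<close> st by metis+
  then have "pos d < pos s \<or> pos t < pos d" using cd(5) by linarith
  then show False using no_cross[OF st \<open>(c, d) \<in> A\<close> cd(3,4)] by blast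
qed

end

locale ordered_tree_edge = ordered_tree V A col h pos a b
  for V :: "'v set" and A col h pos a b +
  fixes p :: 'v
  assumes edge: "(a, p) \<in> A" and b_branch: "b \<in> branch A p a"
begin

abbreviation rest :: "('v \<times> 'v) set" where "rest \<equiv> A - {(a, p), (p, a)}"

lemma edge': "(p, a) \<in> A"
  using tree_sym[OF tree edge] .

lemma p: "p \<in> V"
  using tree_vertex[OF tree edge] by simp

lemma ap: "a \<noteq> p"
  using tree_irrefl[OF tree edge] .

lemma disjoint: "v \<in> branch A a p \<Longrightarrow> v \<notin> branch A p a"
  using branch_disjoint[OF tree edge] by blast

lemma branch_p_path: "w \<in> branch A p a \<longleftrightarrow> (w, p) \<in> rest\<^sup>*" "w \<in> branch A p a \<longleftrightarrow> (p, w) \<in> rest\<^sup>*"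
  using mem_branch_iff[OF tree, of w p a] by (simp_all add: branch_def insert_commute)

lemma branch_a_path: "w \<in> branch A a p \<longleftrightarrow> (a, w) \<in> rest\<^sup>*"
  by (simp add: branch_def)

lemma pos_ap: "pos a < pos p"
  using pos_first p ap by simp

text \<open>Otherwise \<open>p\<close> lies under the arc \<open>(a, z)\<close> and
  \<open>b\<close>, being last, beyond it, while the path from \<open>p\<close> to \<open>b\<close>
  meets neither \<open>a\<close> nor \<open>z\<close>.\<close>

lemma neighbour_pos:
  assumes z: "(a, z) \<in> A" "z \<noteq> p"
  shows "pos z < pos p"
proof (rule ccontr)
  assume "\<not> pos z < pos p"
  then have pz: "pos p < pos z"
    using pos_inj[OF p tree_vertex(2)[OF tree z(1)]] z(2) by force
  have zb: "z \<in> branch A a p"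
    using neighbour_in_branch[OF tree edge z] .
  then have "z \<noteq> b" using disjoint b_branch by blast
  then have "pos z < pos b" using pos_last tree_vertex(2)[OF tree z(1)] by blast
  moreover have "(p, b) \<in> rest\<^sup>*" using b_branch branch_p_path by blast
  moreover have "(p, a) \<notin> rest\<^sup>*" "(p, z) \<notin> rest\<^sup>*"
    using branch_p_path(2) disjoint zb branch_self[of a A p] by blast+
  ultimately show False
    using no_escape[OF z(1), of p b rest] pos_ap pz by blast
qed

text \<open>A step out of the positions before \<open>p\<close> is an edge at \<open>a\<close>,
  which \<open>neighbour_pos\<close> excludes, or an arc that crosses \<open>(a, p)\<close>.\<close>

lemma branch_pos:
  assumes u: "u \<in> branch A a p" shows "pos u < pos p"
proof (rule ccontr)
  assume nless: "\<not> pos u < pos p"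
  have "(a, u) \<in> rest\<^sup>*" using u by (simp add: branch_def)
  then have "\<exists>c d. (a, c) \<in> rest\<^sup>* \<and> (c, d) \<in> rest \<and> c \<in> {v. pos v < pos p} \<and> d \<notin> {v. pos v < pos p}"
    using pos_ap nless by (intro rtrancl_exit) auto
  then obtain c d where cd: "(a, c) \<in> rest\<^sup>*" "(c, d) \<in> rest" "pos c < pos p" "\<not> pos d < pos p"
    by blast
  have cA: "(c, d) \<in> A" using cd(2) by blast
  have "d \<in> branch A a p"
    unfolding branch_a_path using cd(1,2) by (rule rtrancl_into_rtrancl)
  then have "d \<noteq> p" using disjoint branch_self[of p A a] by blast
  then have "pos p < pos d"
    using pos_inj[OF p tree_vertex(2)[OF tree cA]] cd(4) by force
  moreover have "c \<noteq> a" using neighbour_pos cA cd(4) \<open>d \<noteq> p\<close> by blast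
  then have "pos a < pos c" using pos_first tree_vertex(1)[OF tree cA] by blast
  ultimately show False using no_cross[OF edge cA _ cd(3)] by blast
qed

text \<open>All neighbours of \<open>a\<close> are to its right and \<open>p\<close> is the
  farthest, so its successor \<open>x\<close> is the second farthest. The component of
  \<open>a\<close> does not pass \<open>x\<close>: an arc from below \<open>(a, x)\<close> would
  cross it, and an arc starting at \<open>x\<close> has the wrong colour to lie under
  \<open>(a, p)\<close>. The other component does not get below \<open>(a, x)\<close>, since its
  paths to \<open>p\<close> avoid both ends of this arc.\<close>

lemma branch_order:
  assumes x: "(a, x) \<in> A" "x \<noteq> p"
    and next_x: "\<And>z. \<lbrakk>(a, z) \<in> A; z \<noteq> p; z \<noteq> x\<rbrakk> \<Longrightarrow> cyc3 (h a p) (h a x) (h a z)"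
  shows "u \<in> branch A a p \<Longrightarrow> pos u \<le> pos x" "w \<in> branch A p a \<Longrightarrow> pos x < pos w"
proof -
  have ax: "pos a < pos x"
    using pos_first x(1) tree_vertex[OF tree] tree_irrefl[OF tree] by metis
  have xp: "pos x < pos p" using neighbour_pos x by blast
  have xb: "x \<in> branch A a p" using neighbour_in_branch[OF tree edge x] .
  have far: "pos z \<le> pos x" if z: "(a, z) \<in> A" "z \<noteq> p" for z
  proof (cases "z = x")
    case False
    have "cyc3 (h a p) (h a x) (h a z)" using next_x z False by blast
    then have "cyc3 (vkey pos a p) (vkey pos a x) (vkey pos a z)"
      using compat edge x z unfolding order_compat_def rotation_compat_def by blast
    moreover have "pos a < pos z"
      using pos_first z(1) tree_vertex[OF tree] tree_irrefl[OF tree] by metis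
    ultimately show ?thesis
      using ax xp pos_ap neighbour_pos[OF z] by (auto simp: cyc3_def vkey_def)
  qed simp
  show "pos u \<le> pos x" if u: "u \<in> branch A a p"
  proof (rule ccontr)
    assume nle: "\<not> pos u \<le> pos x"
    have "(a, u) \<in> rest\<^sup>*" using u by (simp add: branch_def)
    then have "\<exists>c d. (a, c) \<in> rest\<^sup>* \<and> (c, d) \<in> rest \<and> c \<in> {v. pos v \<le> pos x} \<and> d \<notin> {v. pos v \<le> pos x}"
      using ax nle by (intro rtrancl_exit) auto
    then obtain c d where cd: "(a, c) \<in> rest\<^sup>*" "(c, d) \<in> rest" "pos c \<le> pos x" "\<not> pos d \<le> pos x"
      by blast
    have cA: "(c, d) \<in> A" using cd(2) by blast
    have "d \<in> branch A a p"
      unfolding branch_a_path using cd(1,2) by (rule rtrancl_into_rtrancl)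
    then have dp: "pos d < pos p" by (rule branch_pos)
    then have "d \<noteq> p" by blast
    have "c \<noteq> a" using far cA \<open>d \<noteq> p\<close> cd(4) by blast
    then have ac: "pos a < pos c" using pos_first tree_vertex(1)[OF tree cA] by blast
    show False
    proof (cases "c = x")
      case True
      then have "col a = col x"
        using same_side[OF edge cA] cd(4) pos_ap xp ax dp by auto
      then show False using proper x(1) by (auto simp: proper_colouring_def)
    next
      case False
      then have "pos c < pos x"
        using cd(3) pos_inj tree_vertex[OF tree] cA x(1) by (metis nat_less_le)
      then show False using no_cross[OF x(1) cA ac] cd(4) by auto
    qed
  qed
  show "pos x < pos w" if w: "w \<in> branch A p a"
  proof (rule ccontr)
    assume "\<not> pos x < pos w"
    moreover have wV: "w \<in> V" using branch_subset[OF tree edge'] w by blast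
    moreover have "w \<noteq> x" "w \<noteq> a" using disjoint w xb branch_self[of a A p] by blast+
    ultimately have "pos w < pos x" "pos a < pos w"
      using pos_inj tree_vertex(2)[OF tree x(1)] pos_first by (force, blast)
    moreover have "(w, a) \<notin> rest\<^sup>*" "(w, x) \<notin> rest\<^sup>*"
      using w disjoint xb branch_self[of a A p] branch_p_path(2) rtrancl_trans[of p w rest] by metis+
    ultimately show False
      using no_escape[OF x(1), of w p rest] w branch_p_path xp by blast
  qed
qed

end

section \<open>Uniqueness of the compatible order\<close>

context ordered_tree_edge
begin

abbreviation B :: "('v \<times> 'v) set" where "B \<equiv> A \<inter> (branch A p a \<times> branch A p a)"

lemma tree_B: "tree_on (branch A p a) B"
  using tree_on_branch[OF tree edge'] .

lemma B_neighbour: "(p, z) \<in> A \<Longrightarrow> z \<noteq> a \<Longrightarrow> (p, z) \<in> B"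
  using neighbour_in_branch[OF tree edge', of z] branch_self[of p A a] by blast

lemma pos_branch_p: "w \<in> branch A p a \<Longrightarrow> pos a < pos w"
  using pos_first disjoint branch_self[of a A p] branch_subset[OF tree edge'] by blast

text \<open>Of the left neighbours of \<open>p\<close> the farthest is \<open>a\<close>. Hence
  \<open>q\<close> is the next farthest left neighbour or, if there is none, the farthest right one.
  In the first case the component begins with \<open>q\<close>, in the second with \<open>p\<close>,
  and the branch containing \<open>b\<close> tells the cases apart.\<close>

lemma branch_p_first:
  assumes q: "(p, q) \<in> A" "q \<noteq> a"
    and next_q: "\<And>z. \<lbrakk>(p, z) \<in> A; z \<noteq> a; z \<noteq> q\<rbrakk> \<Longrightarrow> cyc3 (h p a) (h p q) (h p z)"
    and w: "w \<in> branch A p a"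
  shows "pos (if b \<in> branch B q p then p else q) \<le> pos w"
proof -
  have qB: "(p, q) \<in> B" and qV: "q \<in> V" and wV: "w \<in> V" and bV: "b \<in> V"
    using B_neighbour[OF q] tree_vertex(2)[OF tree q(1)] w branch_subset[OF tree edge'] b by blast+
  have rot: "cyc3 (vkey pos p a) (vkey pos p q) (vkey pos p z)" if z: "(p, z) \<in> A" "z \<noteq> a" "z \<noteq> q" for z
    using compat edge' q z next_q[OF z] unfolding order_compat_def rotation_compat_def by blast
  have aq: "pos a < pos q" using pos_first qV q(2) by blast
  have path: "(w, p) \<in> B\<^sup>*"
    using tree_connected[OF tree_B w branch_self] .
  have right: "pos p < pos z" if pq: "pos p < pos q" and z: "(p, z) \<in> A" "z \<noteq> a" for z
  proof (cases "z = q")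
    case False
    have zV: "z \<in> V" "z \<noteq> p" using tree_vertex(2)[OF tree z(1)] tree_irrefl[OF tree z(1)] by blast+
    have "pos a < pos z" using pos_first zV z(2) by blast
    moreover have "pos z \<noteq> pos p" using pos_inj zV p by blast
    ultimately show ?thesis
      using rot[OF z False] pq pos_ap by (auto simp: cyc3_def vkey_def split: if_splits)
  qed (use pq in simp)
  have left: "\<not> pos w < pos p" if "pos p < pos q"
  proof
    assume wp: "pos w < pos p"
    have "\<exists>c d. (w, c) \<in> B\<^sup>* \<and> (c, d) \<in> B \<and> c \<in> {v. pos v < pos p} \<and> d \<notin> {v. pos v < pos p}"
      using wp by (intro rtrancl_exit[OF path]) auto
    then obtain c d where cd: "(c, d) \<in> B" "pos c < pos p" "\<not> pos d < pos p" by blast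
    then have cA: "(c, d) \<in> A" and ac: "pos a < pos c" "c \<noteq> a" and dV: "d \<in> V"
      using pos_branch_p tree_vertex(2)[OF tree] by blast+
    have "d \<noteq> p"
    proof
      assume "d = p"
      then have "(p, c) \<in> A" using tree_sym[OF tree cA] by simp
      then show False using right[OF that _ ac(2)] cd(2) by force
    qed
    then have "pos p < pos d" using cd(3) pos_inj[OF dV p] by force
    then show False using no_cross[OF edge cA ac(1) cd(2)] by blast
  qed
  show ?thesis
  proof (cases "b \<in> branch B q p")
    case True
    have bp: "(q, b) \<in> (B - {(q, p), (p, q)})\<^sup>*"
      using True by (simp add: branch_def)
    have notp: "p \<notin> branch B q p"
      using branch_disjoint[OF tree_B tree_sym[OF tree_B qB]] branch_self[of p B q] by blast
    then have "b \<noteq> p" using True by blast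
    then have pb: "pos p < pos b" using pos_last p by blast
    \<comment> \<open>From below the arc \<open>(a, p)\<close> the branch of \<open>q\<close> could
      not reach \<open>b\<close>, which lies beyond \<open>p\<close>.\<close>
    have "\<not> pos q < pos p"
    proof
      assume qp: "pos q < pos p"
      have "(q, a) \<notin> (B - {(q, p), (p, q)})\<^sup>*"
      proof
        assume "(q, a) \<in> (B - {(q, p), (p, q)})\<^sup>*"
        then have "a \<in> branch B q p" by (simp add: branch_def)
        then have "a \<in> branch A p a"
          using branch_subset[OF tree_B tree_sym[OF tree_B qB]] by blast
        then show False using disjoint branch_self[of a A p] by blast
      qed
      moreover have "(q, p) \<notin> (B - {(q, p), (p, q)})\<^sup>*"
        using notp by (simp add: branch_def)
      ultimately show False
        using no_escape[OF edge bp _ aq qp] pb by blast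
    qed
    then have "pos p < pos q"
      using pos_inj[OF p qV] tree_irrefl[OF tree q(1)] by force
    then show ?thesis using True left by simp
  next
    case False
    then have b_br: "b \<in> branch B p q"
      using branch_Un[OF tree_B qB] b_branch by blast
    \<comment> \<open>On the right, \<open>q\<close> would be the farthest neighbour. The branch
      with \<open>b\<close> would then begin at some \<open>r\<close> under the arc
      \<open>(p, q)\<close> and could not reach \<open>b\<close> beyond \<open>q\<close>.\<close>
    have "\<not> pos p < pos q"
    proof
      assume pq: "pos p < pos q"
      have "b \<noteq> p" using pq pos_last[OF qV] by force
      then obtain r where r: "(p, r) \<in> B" "b \<in> branch B r p"
        using first_edge_towards[OF tree_connected[OF tree_B branch_self b_branch]] by metis
      have rq: "r \<noteq> q" using False r(2) by blast
      have rA: "(p, r) \<in> A" "r \<noteq> a"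
        using r(1) disjoint branch_self[of a A p] by blast+
      have pr: "pos p < pos r" using right[OF pq rA] .
      have "cyc3 (vkey pos p a) (vkey pos p q) (vkey pos p r)" using rot[OF rA rq] .
      then have "pos r < pos q"
        using pq pr pos_ap by (auto simp: cyc3_def vkey_def)
      have path_r: "(r, b) \<in> (B - {(r, p), (p, r)})\<^sup>*"
        using r(2) by (simp add: branch_def)
      have notp: "p \<notin> branch B r p"
        using branch_disjoint[OF tree_B tree_sym[OF tree_B r(1)]] branch_self[of p B r] by blast
      have notq: "q \<notin> branch B r p"
      proof
        assume "q \<in> branch B r p"
        then have "p \<in> branch B r p"
          using branch_into[of q B r p p] tree_sym[OF tree_B qB] rq tree_irrefl[OF tree_B qB] by blast
        then show False using notp by blast
      qed
      then have "b \<noteq> q" using r(2) by blast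
      then have "pos q < pos b" using pos_last qV by blast
      then show False
        using no_escape[OF q(1) path_r _ pr \<open>pos r < pos q\<close>] notp notq by (auto simp: branch_def)
    qed
    then have qp: "pos q < pos p"
      using pos_inj[OF p qV] tree_irrefl[OF tree q(1)] by force
    have far: "pos q < pos z" if z: "(p, z) \<in> A" "z \<noteq> a" "z \<noteq> q" "pos z < pos p" for z
      using rot[OF z(1-3)] qp z(4) pos_ap aq
        pos_first[OF tree_vertex(2)[OF tree z(1)] z(2)] by (auto simp: cyc3_def vkey_def)
    have "\<not> pos w < pos q"
    proof
      assume wq: "pos w < pos q"
      have "\<exists>c d. (w, c) \<in> B\<^sup>* \<and> (c, d) \<in> B \<and> c \<in> {v. pos v < pos q} \<and> d \<notin> {v. pos v < pos q}"
        using wq qp by (intro rtrancl_exit[OF path]) auto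
      then obtain c d where cd: "(c, d) \<in> B" "pos c < pos q" "\<not> pos d < pos q" by blast
      then have cA: "(c, d) \<in> A" and dA: "(d, c) \<in> A" and ac: "pos a < pos c" "c \<noteq> a" and dV: "d \<in> V"
        using pos_branch_p tree_vertex(2)[OF tree] tree_sym[OF tree] by blast+
      \<comment> \<open>The cases contradict, in turn, the choice of \<open>q\<close>, the colours
        (an arc from \<open>c\<close> to \<open>q\<close> would lie under \<open>(a, p)\<close>, but
        \<open>q\<close> has the colour of \<open>a\<close>), the arc \<open>(q, p)\<close> and the
        arc \<open>(a, p)\<close>.\<close>
      consider "d = p" | "d = q" | "pos q < pos d" "pos d < pos p" | "pos p < pos d"
        using cd(3) pos_inj[OF dV qV] pos_inj[OF dV p] by force
      then show False
      proof cases
        case 1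
        then have "(p, c) \<in> A" using dA by simp
        then show False using far[of c] ac(2) cd(2) qp by force
      next
        case 2
        then have "col c = col a"
          using same_side[OF cA edge] cd(2) pos_ap ac(1) qp by auto
        moreover have "col c \<noteq> col d" "col p \<noteq> col q" "col a \<noteq> col p"
          using proper cA q(1) edge unfolding proper_colouring_def by blast+
        ultimately show False using 2 by auto
      next
        case 3
        then show False
          using no_cross[OF tree_sym[OF tree q(1)] dA] cd(2) by blast
      next
        case 4
        then show False
          using no_cross[OF edge cA ac(1)] cd(2) qp by force
      qed
    qed
    then show ?thesis using False by simp
  qed
qed

lemma split_order:
  assumes split: "split_at A h a b p x y"
  shows "u \<in> branch A a p \<Longrightarrow> pos u \<le> pos x" "w \<in> branch A p a \<Longrightarrow> pos y \<le> pos w"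
    "u \<in> branch A a p \<Longrightarrow> w \<in> branch A p a \<Longrightarrow> pos u < pos w"
proof -
  have "(u \<in> branch A a p \<longrightarrow> pos u \<le> pos x) \<and> (w \<in> branch A p a \<longrightarrow> pos x < pos w)" for u w
  proof (cases "branch A a p = {a}")
    case True
    then show ?thesis using split pos_branch_p by (auto simp: split_at_def)
  next
    case False
    then have "(a, x) \<in> A" "x \<noteq> p"
      "\<And>z. \<lbrakk>(a, z) \<in> A; z \<noteq> p; z \<noteq> x\<rbrakk> \<Longrightarrow> cyc3 (h a p) (h a x) (h a z)"
      using split by (auto simp: split_at_def)
    from branch_order[OF this] show ?thesis by blast
  qed
  then show "u \<in> branch A a p \<Longrightarrow> pos u \<le> pos x"
    "u \<in> branch A a p \<Longrightarrow> w \<in> branch A p a \<Longrightarrow> pos u < pos w"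
    by (auto intro: le_less_trans)
  show "pos y \<le> pos w" if w: "w \<in> branch A p a"
  proof (cases "branch A p a = {p}")
    case True
    then show ?thesis using split w by (auto simp: split_at_def)
  next
    case False
    then obtain q where "(p, q) \<in> A" "q \<noteq> a"
      "\<And>z. \<lbrakk>(p, z) \<in> A; z \<noteq> a; z \<noteq> q\<rbrakk> \<Longrightarrow> cyc3 (h p a) (h p q) (h p z)"
      and y: "y = (if b \<in> branch B q p then p else q)"
      using split by (auto simp: split_at_def)
    from branch_p_first[OF this(1-3) w] show ?thesis unfolding y .
  qed
qed

end

text \<open>The marks handed to the recursion coincide only in a component with one vertex, which is
  the base case of both inductions below.\<close>

lemma split_at_marks:
  assumes tree: "tree_on V A" and split: "split_at A h a b p x y"
  shows "x \<in> branch A a p" "a = x \<longrightarrow> branch A a p = {a}"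
    "y \<in> branch A p a" "b \<in> branch A p a" "y = b \<longrightarrow> branch A p a = {y}"
proof -
  have edge: "(a, p) \<in> A" "(p, a) \<in> A" and bb: "b \<in> branch A p a"
    using split tree_sym[OF tree] by (auto simp: split_at_def)
  show "b \<in> branch A p a" by (rule bb)
  have "x \<in> branch A a p \<and> (a = x \<longrightarrow> branch A a p = {a})"
  proof (cases "branch A a p = {a}")
    case True
    then show ?thesis using split by (simp add: split_at_def)
  next
    case False
    then have "(a, x) \<in> A" "x \<noteq> p" using split by (simp_all add: split_at_def)
    then show ?thesis using neighbour_in_branch[OF tree edge(1)] tree_irrefl[OF tree] by metis
  qed
  then show "x \<in> branch A a p" "a = x \<longrightarrow> branch A a p = {a}" by blast+
  let ?B = "A \<inter> (branch A p a \<times> branch A p a)"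
  have "y \<in> branch A p a \<and> (y = b \<longrightarrow> branch A p a = {y})"
  proof (cases "branch A p a = {p}")
    case True
    then show ?thesis using split by (auto simp: split_at_def)
  next
    case False
    then obtain q where q: "(p, q) \<in> A" "q \<noteq> a" and y: "y = (if b \<in> branch ?B q p then p else q)"
      using split by (auto simp: split_at_def)
    have tB: "tree_on (branch A p a) ?B" using tree_on_branch[OF tree edge(2)] .
    have "q \<in> branch A p a" using neighbour_in_branch[OF tree edge(2) q] .
    then have pq: "(p, q) \<in> ?B" using q branch_self[of p A a] by blast
    have "branch ?B q p \<inter> branch ?B p q = {}"
      using branch_disjoint[OF tB tree_sym[OF tB pq]] .
    then have "b \<noteq> y"
      using y branch_self[of p ?B q] branch_self[of q ?B p] by auto
    then show ?thesis using y \<open>q \<in> branch A p a\<close> branch_self[of p A a] by auto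
  qed
  then show "y \<in> branch A p a" "y = b \<longrightarrow> branch A p a = {y}" by blast+
qed

theorem order_compat_unique:
  assumes "tree_on V A" "proper_colouring A col" "\<And>v. inj_on (h v) {z. (v, z) \<in> A}"
    and "a \<in> V" "b \<in> V" "a = b \<longrightarrow> V = {a}"
    and "order_compat V A col h pos" "between_ends V a b pos"
    and "order_compat V A col h pos'" "between_ends V a b pos'"
    and "u \<in> V" "v \<in> V"
  shows "pos u < pos v \<longleftrightarrow> pos' u < pos' v"
  using assms
proof (induction "card V" arbitrary: V A a b u v rule: less_induct)
  case (less V A a b u v)
  note tree = less.prems(1) and proper = less.prems(2) and inj = less.prems(3)
    and compat = less.prems(7) and ends = less.prems(8)
    and compat' = less.prems(9) and ends' = less.prems(10)
  show ?case
  proof (cases "a = b")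
    case True
    then show ?thesis using less.prems by auto
  next
    case False
    then obtain p x y where split: "split_at A h a b p x y"
      using split_at_exists[OF tree inj less.prems(4,5)] by blast
    then have edge: "(a, p) \<in> A" "b \<in> branch A p a" by (auto simp: split_at_def)
    interpret ot: ordered_tree_edge V A col h pos a b p
      using less.prems edge by unfold_locales
    interpret ot': ordered_tree_edge V A col h pos' a b p
      using less.prems edge by unfold_locales
    note ord = ot.split_order[OF split] and ord' = ot'.split_order[OF split]
    note marks = split_at_marks[OF tree split]
    have Un: "branch A a p \<union> branch A p a = V" and dis: "branch A a p \<inter> branch A p a = {}"
      using branch_Un[OF tree edge(1)] branch_disjoint[OF tree edge(1)] by auto
    have part: "pos u < pos v \<longleftrightarrow> pos' u < pos' v"
      if W: "tree_on W (A \<inter> (W \<times> W))" "card W < card V" "W \<subseteq> V"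
        and c: "c \<in> W" "d \<in> W" "c = d \<longrightarrow> W = {c}"
        and e: "between_ends W c d pos" "between_ends W c d pos'" and uv: "u \<in> W" "v \<in> W"
      for W c d u v
    proof (rule less.hyps[OF W(2) W(1) _ _ c _ e(1) _ e(2) uv])
      show "proper_colouring (A \<inter> W \<times> W) col"
        using proper by (auto simp: proper_colouring_def)
      show "inj_on (h v) {z. (v, z) \<in> A \<inter> W \<times> W}" for v
        using inj[of v] by (rule inj_on_subset) auto
      show "order_compat W (A \<inter> W \<times> W) col h pos" "order_compat W (A \<inter> W \<times> W) col h pos'"
        using order_compat_subset[OF compat W(3)] order_compat_subset[OF compat' W(3)] by auto
    qed
    have card: "card (branch A a p) < card V" "card (branch A p a) < card V"
      using Un dis branch_self[of a A p] branch_self[of p A a] tree_finite[OF tree]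
      by (auto intro!: psubset_card_mono)
    have sub: "branch A a p \<subseteq> V" "branch A p a \<subseteq> V" using Un by auto
    have inPa: ?thesis if "u \<in> branch A a p" "v \<in> branch A a p"
    proof (rule part[OF tree_on_branch[OF tree edge(1)] card(1) sub(1) branch_self marks(1,2) _ _ that])
      show "between_ends (branch A a p) a x pos" "between_ends (branch A a p) a x pos'"
        using ord(1) ord'(1) ends ends' sub(1) unfolding between_ends_def by blast+
    qed
    have inPp: ?thesis if "u \<in> branch A p a" "v \<in> branch A p a"
    proof (rule part[OF tree_on_branch[OF tree tree_sym[OF tree edge(1)]] card(2) sub(2) marks(3,4,5) _ _ that])
      show "between_ends (branch A p a) y b pos" "between_ends (branch A p a) y b pos'"
        using ord(2) ord'(2) ends ends' sub(2) unfolding between_ends_def by blast+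
    qed
    consider "u \<in> branch A a p" "v \<in> branch A a p" | "u \<in> branch A p a" "v \<in> branch A p a"
      | "u \<in> branch A a p" "v \<in> branch A p a" | "u \<in> branch A p a" "v \<in> branch A a p"
      using Un less.prems(11,12) by blast
    then show ?thesis
    proof cases
      case 3
      then show ?thesis using ord(3) ord'(3) by blast
    next
      case 4
      then show ?thesis using ord(3)[of v u] ord'(3)[of v u] by (meson less_asym)
    qed (use inPa inPp in blast)+
  qed
qed

section \<open>Existence of the compatible order\<close>

locale glued_order =
  fixes V :: "'v set" and A :: "('v \<times> 'v) set" and col h a b p x y
    and pos1 pos2 :: "'v \<Rightarrow> nat"
  assumes tree: "tree_on V A" and proper: "proper_colouring A col" and split: "split_at A h a b p x y"
    and compat1: "order_compat (branch A a p) (A \<inter> (branch A a p \<times> branch A a p)) col h pos1"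
    and ends1: "between_ends (branch A a p) a x pos1"
    and bij1: "bij_betw pos1 (branch A a p) {1..card (branch A a p)}"
    and compat2: "order_compat (branch A p a) (A \<inter> (branch A p a \<times> branch A p a)) col h pos2"
    and ends2: "between_ends (branch A p a) y b pos2"
    and bij2: "bij_betw pos2 (branch A p a) {1..card (branch A p a)}"
begin

definition pos :: "'v \<Rightarrow> nat" where
  "pos v = (if v \<in> branch A a p then pos1 v else pos2 v + card (branch A a p))"

abbreviation "Aa \<equiv> A \<inter> (branch A a p \<times> branch A a p)"
abbreviation "Ap \<equiv> A \<inter> (branch A p a \<times> branch A p a)"

lemma edge: "(a, p) \<in> A" "(p, a) \<in> A" and b_branch: "b \<in> branch A p a"
  using split tree_sym[OF tree] by (auto simp: split_at_def)

lemmas marks = split_at_marks[OF tree split]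

lemma dis: "v \<in> branch A p a \<Longrightarrow> v \<notin> branch A a p"
  using branch_disjoint[OF tree edge(1)] by blast

lemma Un: "branch A a p \<union> branch A p a = V"
  by (rule branch_Un[OF tree edge(1)])

sublocale left: ordered_tree "branch A a p" Aa col h pos1 a x
  using tree_on_branch[OF tree edge(1)] proper compat1 ends1 branch_self marks
  by unfold_locales (auto simp: proper_colouring_def)

sublocale right: ordered_tree "branch A p a" Ap col h pos2 y b
  using tree_on_branch[OF tree edge(2)] proper compat2 ends2 branch_self marks
  by unfold_locales (auto simp: proper_colouring_def)

lemma pos_left: "v \<in> branch A a p \<Longrightarrow> pos v = pos1 v"
  by (simp add: pos_def)

lemma pos_right: "v \<in> branch A p a \<Longrightarrow> pos v = pos2 v + card (branch A a p)"
  using dis by (simp add: pos_def)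

lemma pos_less: "\<lbrakk>u \<in> branch A a p; w \<in> branch A p a\<rbrakk> \<Longrightarrow> pos u < pos w"
  using bij_betwE[OF bij1] bij_betwE[OF bij2] by (fastforce simp: pos_left pos_right)

lemma card_V: "card V = card (branch A a p) + card (branch A p a)"
  unfolding Un[symmetric]
  using branch_disjoint[OF tree edge(1)] left.tree right.tree
  by (intro card_Un_disjoint) (auto simp: tree_on_def)

lemma pos_bij: "bij_betw pos V {1..card V}"
proof -
  let ?n = "card (branch A a p)" and ?m = "card (branch A p a)"
  have "bij_betw pos (branch A a p) {1..?n}"
    using bij1 by (rule bij_betw_cong[THEN iffD1, rotated]) (simp add: pos_left)
  moreover have "bij_betw (\<lambda>i. i + ?n) {1..?m} {1 + ?n..?m + ?n}"
    by (simp add: bij_betw_def inj_on_def image_add_atLeastAtMost')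
  then have "bij_betw ((\<lambda>i. i + ?n) \<circ> pos2) (branch A p a) {1 + ?n..?m + ?n}"
    by (rule bij_betw_trans[OF bij2])
  then have "bij_betw pos (branch A p a) {1 + ?n..?m + ?n}"
    by (rule bij_betw_cong[THEN iffD1, rotated]) (simp add: pos_right)
  ultimately have "bij_betw pos (branch A a p \<union> branch A p a) ({1..?n} \<union> {1 + ?n..?m + ?n})"
    by (rule bij_betw_combine) auto
  moreover have "{1..?n} \<union> {1 + ?n..?m + ?n} = {1..card V}"
    unfolding card_V by auto
  ultimately show ?thesis by (simp add: Un)
qed

lemma pos_ends: "between_ends V a b pos"
  unfolding between_ends_def
proof (intro ballI conjI)
  fix v assume "v \<in> V"
  then consider "v \<in> branch A a p" | "v \<in> branch A p a" using Un by blast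
  then show "pos a \<le> pos v"
  proof cases
    case 1
    then show ?thesis
      using ends1 left.a by (simp add: between_ends_def pos_left)
  qed (use pos_less[OF left.a] in \<open>simp add: less_imp_le\<close>)
  from \<open>v \<in> V\<close> consider "v \<in> branch A a p" | "v \<in> branch A p a" using Un by blast
  then show "pos v \<le> pos b"
  proof cases
    case 2
    then show ?thesis
      using ends2 right.b by (simp add: between_ends_def pos_right)
  qed (use pos_less[OF _ right.b] in \<open>simp add: less_imp_le\<close>)
qed

text \<open>The component of \<open>p\<close> is a single vertex, or begins with \<open>p\<close>
  and reaches \<open>b\<close> through \<open>q\<close>, or begins with \<open>q\<close> and reaches
  \<open>b\<close> from \<open>p\<close> without \<open>q\<close>.\<close>

lemma next_p: obtains "branch A p a = {p}" "y = p"
  | q where "(p, q) \<in> Ap" "q \<noteq> a"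
     "\<And>z. \<lbrakk>(p, z) \<in> A; z \<noteq> a; z \<noteq> q\<rbrakk> \<Longrightarrow> cyc3 (h p a) (h p q) (h p z)"
     "b \<in> branch Ap q p" "y = p"
  | q where "(p, q) \<in> Ap" "q \<noteq> a"
     "\<And>z. \<lbrakk>(p, z) \<in> A; z \<noteq> a; z \<noteq> q\<rbrakk> \<Longrightarrow> cyc3 (h p a) (h p q) (h p z)"
     "b \<in> branch Ap p q" "y = q"
proof (cases "branch A p a = {p}")
  case True
  then show thesis using that(1) split by (simp add: split_at_def)
next
  case False
  then obtain q where q: "(p, q) \<in> A" "q \<noteq> a"
     and cyc: "\<forall>z. (p, z) \<in> A \<and> z \<noteq> a \<and> z \<noteq> q \<longrightarrow> cyc3 (h p a) (h p q) (h p z)"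
     and y: "y = (if b \<in> branch Ap q p then p else q)"
    using split by (auto simp: split_at_def)
  have pq: "(p, q) \<in> Ap"
    using q neighbour_in_branch[OF tree edge(2) q] branch_self[of p A a] by blast
  show thesis
  proof (cases "b \<in> branch Ap q p")
    case True
    then show thesis using that(2)[of q] pq q cyc y by simp
  next
    case False
    then have "b \<in> branch Ap p q"
      using branch_Un[OF right.tree pq] b_branch by blast
    then show thesis using that(3)[of q] pq q cyc y False by simp
  qed
qed

lemma pa: "pos v < pos p" if "v \<in> branch A a p"
  using pos_less[OF that branch_self] .

text \<open>As soon as the component of \<open>a\<close> has an arc, its first and last vertices
  \<open>a\<close> and \<open>x\<close> are adjacent. The arc \<open>(a, x)\<close> spans the
  component and forces all its arcs onto one side, which is also the side of
  \<open>(a, p)\<close>.\<close>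

lemma left_edge:
  assumes st: "(s, t) \<in> Aa" "pos s < pos t"
  shows "col s = col a"
proof -
  have "a \<noteq> x" using marks(2) st tree_irrefl[OF left.tree st(1)] by auto
  then have x: "(a, x) \<in> Aa"
    using split marks(1) branch_self[of a A p] marks(2)
    by (auto simp: split_at_def split: if_splits)
  have sV: "s \<in> branch A a p" "t \<in> branch A a p" using st by blast+
  have less: "pos1 s < pos1 t" using st(2) sV by (simp add: pos_left)
  have "pos1 a \<le> pos1 s" "pos1 t \<le> pos1 x"
    using ends1 sV by (simp_all add: between_ends_def)
  then show ?thesis
    using left.same_side[OF st(1) x less] less by simp
qed

text \<open>An arc starting before \<open>p\<close> occurs only if the component begins with
  \<open>q\<close>. It is then spanned by the arc \<open>(q, p)\<close>, whose left end has the
  colour of \<open>a\<close>.\<close>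

lemma right_edge:
  assumes st: "(s, t) \<in> Ap" "pos s < pos t"
  shows "pos p \<le> pos s \<or> (col s = col a \<and> pos t \<le> pos p)"
proof (rule disjCI)
  assume nle: "\<not> (col s = col a \<and> pos t \<le> pos p)"
  have sV: "s \<in> branch A p a" "t \<in> branch A p a" using st by blast+
  note pV = branch_self[of p A a]
  have less: "pos2 s < pos2 t" using st(2) sV by (simp add: pos_right)
  show "pos p \<le> pos s"
  proof (rule ccontr)
    assume "\<not> pos p \<le> pos s"
    then have sp: "pos2 s < pos2 p" using sV pV by (simp add: pos_right)
    have ys: "pos2 y \<le> pos2 s" using ends2 sV by (simp add: between_ends_def)
    then have "y \<noteq> p" using sp by auto
    obtain q where q: "(p, q) \<in> Ap" "q \<noteq> a" "b \<in> branch Ap p q" "y = q"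
      using \<open>y \<noteq> p\<close> by - (rule next_p; blast)
    have qp: "(q, p) \<in> Ap" using tree_sym[OF right.tree q(1)] .
    \<comment> \<open>Within the component of \<open>p\<close>, the first mark is \<open>q\<close>
      and the edge towards \<open>b\<close> is \<open>(q, p)\<close>, so the facts about the first
      edge apply to it.\<close>
    interpret e: ordered_tree_edge "branch A p a" Ap col h pos2 q b p
      using right.ordered_tree_axioms qp q(3,4) by unfold_locales (simp_all add: ordered_tree_def)
    have "col s = col q"
      using right.same_side[OF st(1) qp less] ys q(4) sp less e.pos_ap by simp
    moreover have "col q = col a"
      using proper qp edge(1) unfolding proper_colouring_def by blast
    moreover have "pos2 t \<le> pos2 p"
    proof (rule ccontr)
      assume nle: "\<not> pos2 t \<le> pos2 p"
      have "s \<noteq> q"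
        using e.neighbour_pos[of t] st(1) nle by auto
      then have "pos2 q < pos2 s" using e.pos_first sV by blast
      then show False using right.no_cross[OF qp st(1) _ sp] nle by auto
    qed
    ultimately show False using nle sV pV by (simp add: pos_right)
  qed
qed

lemma edge_cases:
  assumes "(s, t) \<in> A" "pos s < pos t"
  obtains "(s, t) \<in> Aa" | "(s, t) \<in> Ap" | "s = a" "t = p"
proof -
  have sV: "s \<in> V" "t \<in> V" using tree_vertex[OF tree assms(1)] by auto
  then consider "s \<in> branch A a p" "t \<in> branch A a p" | "s \<in> branch A p a" "t \<in> branch A p a"
    | "s \<in> branch A a p" "t \<in> branch A p a" | "s \<in> branch A p a" "t \<in> branch A a p"
    using Un by blast
  then show thesis
  proof cases
    case 3
    then have "s = a" "t = p"
      using branch_leave[OF tree edge(1) _ assms(1)] dis by blast+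
    then show thesis using that by blast
  next
    case 4
    then show thesis using pos_less[of t s] assms(2) by simp
  qed (use that assms(1) in blast)+
qed

text \<open>Arcs of different components are apart. An arc that overlaps \<open>(a, p)\<close> is
  nested in it and, by \<open>left_edge\<close> and \<open>right_edge\<close>, on the same
  side.\<close>

lemma arcs: "arcs_compat A col pos"
  unfolding arcs_compat_def
proof (intro allI impI)
  fix s t u v
  assume st: "(s, t) \<in> A" "pos s < pos t" and uv: "(u, v) \<in> A" "pos u < pos v"
  let ?C = "\<lambda>s t u v. if col s = col u then \<not> (pos s < pos u \<and> pos u < pos t \<and> pos t < pos v)
      else pos t \<le> pos u \<or> pos v \<le> pos s"
  have apart: "?C s t u v" if "pos t \<le> pos u \<or> pos v \<le> pos s" for s t u v
    using that by auto
  have nested: "?C s t u v" if "col s = col u" "pos u \<le> pos s \<or> pos v \<le> pos t" for s t u v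
    using that by auto
  have ll: "?C s t u v" if st: "(s, t) \<in> Aa" "pos s < pos t" and uv: "(u, v) \<in> Aa" "pos u < pos v"
    for s t u v
  proof -
    have "s \<in> branch A a p" "t \<in> branch A a p" "u \<in> branch A a p" "v \<in> branch A a p"
      using st uv by blast+
    then have "pos s = pos1 s" "pos t = pos1 t" "pos u = pos1 u" "pos v = pos1 v"
      by (simp_all add: pos_left)
    then show ?thesis
      using st uv compat1 unfolding order_compat_def arcs_compat_def by metis
  qed
  have rr: "?C s t u v" if st: "(s, t) \<in> Ap" "pos s < pos t" and uv: "(u, v) \<in> Ap" "pos u < pos v"
    for s t u v
  proof -
    have "s \<in> branch A p a" "t \<in> branch A p a" "u \<in> branch A p a" "v \<in> branch A p a"
      using st uv by blast+
    then have *: "pos s = pos2 s + card (branch A a p)" "pos t = pos2 t + card (branch A a p)"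
      "pos u = pos2 u + card (branch A a p)" "pos v = pos2 v + card (branch A a p)"
      by (simp_all add: pos_right)
    have "if col s = col u then \<not> (pos2 s < pos2 u \<and> pos2 u < pos2 t \<and> pos2 t < pos2 v)
      else pos2 t \<le> pos2 u \<or> pos2 v \<le> pos2 s"
      using st uv compat2 unfolding order_compat_def arcs_compat_def * by (meson add_less_cancel_right)
    then show ?thesis unfolding * by simp
  qed
  have left_bd: "pos a \<le> pos s \<and> pos t < pos p" if "(s, t) \<in> Aa" for s t
    using that pa[of t] pos_ends Un unfolding between_ends_def by blast
  show "?C s t u v"
  proof (rule edge_cases[OF st]; rule edge_cases[OF uv])
    assume *: "(s, t) \<in> Aa" "(u, v) \<in> Ap"
    then have "pos t < pos u" using pos_less by blast
    then show ?thesis by (intro apart) simp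
  next
    assume *: "(s, t) \<in> Ap" "(u, v) \<in> Aa"
    then have "pos v < pos s" using pos_less by blast
    then show ?thesis by (intro apart) simp
  next
    assume *: "(s, t) \<in> Aa" "u = a" "v = p"
    then show ?thesis
      using left_edge[OF *(1) st(2)] left_bd[OF *(1)] by (intro nested) simp_all
  next
    assume *: "s = a" "t = p" "(u, v) \<in> Aa"
    then show ?thesis
      using left_edge[OF *(3) uv(2)] left_bd[OF *(3)] by (intro nested) simp_all
  next
    assume *: "(s, t) \<in> Ap" "u = a" "v = p"
    from right_edge[OF *(1) st(2)] show ?thesis
    proof
      assume "pos p \<le> pos s"
      then show ?thesis using * by (intro apart) simp
    next
      assume "col s = col a \<and> pos t \<le> pos p"
      moreover have "pos a \<le> pos s" using * pos_ends Un unfolding between_ends_def by blast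
      ultimately show ?thesis using * by (intro nested) simp_all
    qed
  next
    assume *: "s = a" "t = p" "(u, v) \<in> Ap"
    from right_edge[OF *(3) uv(2)] show ?thesis
    proof
      assume "pos p \<le> pos u"
      then show ?thesis using * by (intro apart) simp
    next
      assume "col u = col a \<and> pos v \<le> pos p"
      then show ?thesis using * by (intro nested) simp_all
    qed
  qed (use ll rr st uv in auto)
qed

lemma rot_left:
  assumes v: "v \<in> branch A a p" "(v, x') \<in> Aa" "(v, y') \<in> Aa" "(v, z') \<in> Aa"
  shows "cyc3 (h v x') (h v y') (h v z') \<longleftrightarrow> cyc3 (vkey pos v x') (vkey pos v y') (vkey pos v z')"
proof -
  have "cyc3 (h v x') (h v y') (h v z') \<longleftrightarrow> cyc3 (vkey pos1 v x') (vkey pos1 v y') (vkey pos1 v z')"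
    using compat1 v unfolding order_compat_def rotation_compat_def by blast
  also have "\<dots> \<longleftrightarrow> cyc3 (vkey pos v x') (vkey pos v y') (vkey pos v z')"
    using v by (intro cyc3_vkey_cong) (auto simp: pos_left)
  finally show ?thesis .
qed

lemma rot_right:
  assumes v: "v \<in> branch A p a" "(v, x') \<in> Ap" "(v, y') \<in> Ap" "(v, z') \<in> Ap"
  shows "cyc3 (h v x') (h v y') (h v z') \<longleftrightarrow> cyc3 (vkey pos v x') (vkey pos v y') (vkey pos v z')"
proof -
  have "cyc3 (h v x') (h v y') (h v z') \<longleftrightarrow> cyc3 (vkey pos2 v x') (vkey pos2 v y') (vkey pos2 v z')"
    using compat2 v unfolding order_compat_def rotation_compat_def by blast
  also have "\<dots> \<longleftrightarrow> cyc3 (vkey pos v x') (vkey pos v y') (vkey pos v z')"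
    using v by (intro cyc3_vkey_cong) (auto simp: pos_right)
  finally show ?thesis .
qed

text \<open>The added neighbour \<open>p\<close> is the farthest on the right, and \<open>x\<close>,
  being last in the component of \<open>a\<close>, is the second farthest. So \<open>x\<close>
  follows \<open>p\<close> in the keys as well as in \<open>h\<close>.\<close>

lemma rot_a:
  assumes "(a, x') \<in> A" "(a, y') \<in> A" "(a, z') \<in> A"
  shows "cyc3 (h a x') (h a y') (h a z') \<longleftrightarrow> cyc3 (vkey pos a x') (vkey pos a y') (vkey pos a z')"
proof (rule cyc3_agree_insert[where m = p and n = x and X = "{z. (a, z) \<in> Aa}"])
  have nb: "z \<in> insert p {z. (a, z) \<in> Aa}" if "(a, z) \<in> A" for z
    using that neighbour_in_branch[OF tree edge(1)] branch_self[of a A p] by blast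
  then show "x' \<in> insert p {z. (a, z) \<in> Aa}" "y' \<in> insert p {z. (a, z) \<in> Aa}"
    "z' \<in> insert p {z. (a, z) \<in> Aa}"
    using assms by blast+
  have nx: "(a, x) \<in> A \<and> x \<noteq> p \<and>
      (\<forall>z. (a, z) \<in> A \<and> z \<noteq> p \<and> z \<noteq> x \<longrightarrow> cyc3 (h a p) (h a x) (h a z))" if "(a, z) \<in> Aa" for z
  proof -
    have "z \<in> branch A a p" "z \<noteq> a" using that tree_irrefl[OF tree, of a z] by blast+
    then have "branch A a p \<noteq> {a}" by blast
    then show ?thesis using split by (simp add: split_at_def)
  qed
  show "x \<in> {z. (a, z) \<in> Aa}" if "{z. (a, z) \<in> Aa} \<noteq> {}"
    using nx that marks(1) branch_self[of a A p] by blast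
  have zp: "z \<noteq> p" if "(a, z) \<in> Aa" for z
    using that dis[OF branch_self] by blast
  show "cyc3 (h a p) (h a x) (h a z)" if "z \<in> {z. (a, z) \<in> Aa}" "z \<noteq> x" for z
    using nx[of z] that zp by blast
  show "cyc3 (vkey pos a p) (vkey pos a x) (vkey pos a z)" if "z \<in> {z. (a, z) \<in> Aa}" "z \<noteq> x" for z
  proof -
    have z: "z \<in> branch A a p" "z \<noteq> a" using that tree_irrefl[OF tree, of a z] by blast+
    have "x \<noteq> a" using nx[of z] that tree_irrefl[OF tree, of a x] by blast
    have "pos1 z < pos1 x" using left.pos_last[OF z(1)] that(2) .
    moreover have "pos1 a < pos1 z" using left.pos_first z by blast
    ultimately show ?thesis
      using pa[OF marks(1)] z marks(1) branch_self[of a A p]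
      by (simp add: cyc3_def vkey_less pos_left)
  qed
qed (use rot_left[OF branch_self] in auto)

text \<open>The added neighbour \<open>a\<close> is the farthest on the left. It is followed in the
  keys by the next left neighbour or, if there is none, by the farthest right one; in either shape
  of the component this is the \<open>q\<close> that follows \<open>a\<close> in
  \<open>h\<close>.\<close>

lemma rot_p:
  assumes "(p, x') \<in> A" "(p, y') \<in> A" "(p, z') \<in> A"
  shows "cyc3 (h p x') (h p y') (h p z') \<longleftrightarrow> cyc3 (vkey pos p x') (vkey pos p y') (vkey pos p z')"
proof -
  have nb: "z \<in> insert a {z. (p, z) \<in> Ap}" if "(p, z) \<in> A" for z
    using that neighbour_in_branch[OF tree edge(2)] branch_self[of p A a] by blast
  have za: "z \<noteq> a" if "(p, z) \<in> Ap" for z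
    using that dis branch_self[of a A p] by blast
  have pap: "pos a < pos p" using pa[OF branch_self] .
  have "\<exists>q. ({z. (p, z) \<in> Ap} \<noteq> {} \<longrightarrow> q \<in> {z. (p, z) \<in> Ap}) \<and>
      (\<forall>z. z \<in> {z. (p, z) \<in> Ap} \<and> z \<noteq> q \<longrightarrow>
         cyc3 (h p a) (h p q) (h p z) \<and> cyc3 (vkey pos p a) (vkey pos p q) (vkey pos p z))"
  proof (rule next_p)
    assume P: "branch A p a = {p}"
    have "(p, z) \<notin> Ap" for z
      using tree_irrefl[OF tree, of p z] unfolding P by auto
    then have "{z. (p, z) \<in> Ap} = {}" by blast
    then show ?thesis by (metis empty_iff)
  next
    fix q
    assume q: "(p, q) \<in> Ap" "q \<noteq> a" "b \<in> branch Ap q p" "y = p"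
      "\<And>z. \<lbrakk>(p, z) \<in> A; z \<noteq> a; z \<noteq> q\<rbrakk> \<Longrightarrow> cyc3 (h p a) (h p q) (h p z)"
    \<comment> \<open>The component begins with \<open>p\<close>, and \<open>(p, q)\<close> is the
      edge towards \<open>b\<close>; hence \<open>q\<close> is the farthest neighbour of
      \<open>p\<close> in it.\<close>
    interpret e: ordered_tree_edge "branch A p a" Ap col h pos2 p b q
      using right.ordered_tree_axioms q by unfold_locales (simp_all add: ordered_tree_def)
    have "cyc3 (vkey pos p a) (vkey pos p q) (vkey pos p z)" if z: "(p, z) \<in> Ap" "z \<noteq> q" for z
    proof -
      have "pos2 z < pos2 q" using e.neighbour_pos z .
      moreover have "z \<in> branch A p a" "q \<in> branch A p a" "p \<in> branch A p a" using z q by blast+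
      moreover have "pos2 p < pos2 z"
        using e.pos_first z tree_irrefl[OF tree, of p z] by blast
      ultimately show ?thesis using pap by (simp add: cyc3_def vkey_less pos_right)
    qed
    then show ?thesis using q(1,5) za by (intro exI[of _ q]) simp
  next
    fix q
    assume q: "(p, q) \<in> Ap" "q \<noteq> a" "b \<in> branch Ap p q" "y = q"
      "\<And>z. \<lbrakk>(p, z) \<in> A; z \<noteq> a; z \<noteq> q\<rbrakk> \<Longrightarrow> cyc3 (h p a) (h p q) (h p z)"
    have "cyc3 (vkey pos p a) (vkey pos p q) (vkey pos p z)" if z: "(p, z) \<in> Ap" "z \<noteq> q" for z
    proof -
      have V: "z \<in> branch A p a" "q \<in> branch A p a" "p \<in> branch A p a" using z q by blast+
      have "pos2 q < pos2 z" using right.pos_first[OF V(1)] z(2) q(4) by blast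
      moreover have "pos2 q < pos2 p"
        using right.pos_first[OF V(3)] q(1,4) tree_irrefl[OF tree, of p q] by blast
      moreover have "pos a < pos z" "pos a < pos q"
        using pos_less[OF branch_self] V by blast+
      ultimately show ?thesis using pap V by (auto simp: cyc3_def vkey_less pos_right)
    qed
    then show ?thesis using q(1,5) za by (intro exI[of _ q]) simp
  qed
  then obtain q where q: "{z. (p, z) \<in> Ap} \<noteq> {} \<Longrightarrow> q \<in> {z. (p, z) \<in> Ap}"
    "\<And>z. z \<in> {z. (p, z) \<in> Ap} \<Longrightarrow> z \<noteq> q \<Longrightarrow> cyc3 (h p a) (h p q) (h p z)"
    "\<And>z. z \<in> {z. (p, z) \<in> Ap} \<Longrightarrow> z \<noteq> q \<Longrightarrow> cyc3 (vkey pos p a) (vkey pos p q) (vkey pos p z)"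
    by blast
  show ?thesis
    by (rule cyc3_agree_insert[OF _ q nb[OF assms(1)] nb[OF assms(2)] nb[OF assms(3)]])
      (use rot_right[OF branch_self] in auto)
qed

lemma glued_compat: "order_compat V A col h pos"
  unfolding order_compat_def
proof (intro conjI arcs)
  show "inj_on pos V" using pos_bij by (rule bij_betw_imp_inj_on)
  show "rotation_compat A h pos"
    unfolding rotation_compat_def
  proof (intro allI impI)
    fix v x' y' z' assume nb: "(v, x') \<in> A" "(v, y') \<in> A" "(v, z') \<in> A"
    have "v \<in> V" using tree_vertex(1)[OF tree nb(1)] .
    then consider "v = a" | "v = p" | "v \<in> branch A a p" "v \<noteq> a" | "v \<in> branch A p a" "v \<noteq> p"
      using Un by blast
    then show "cyc3 (h v x') (h v y') (h v z') \<longleftrightarrow>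
        cyc3 (vkey pos v x') (vkey pos v y') (vkey pos v z')"
    proof cases
      case 3
      then have "w \<in> branch A a p" if "(v, w) \<in> A" for w
        using branch_leave(1)[OF tree edge(1) _ that] by blast
      then show ?thesis using nb 3 by (intro rot_left) auto
    next
      case 4
      then have "w \<in> branch A p a" if "(v, w) \<in> A" for w
        using branch_leave(1)[OF tree edge(2) _ that] by blast
      then show ?thesis using nb 4 by (intro rot_right) auto
    qed (use rot_a rot_p nb in auto)
  qed
qed

end

theorem order_compat_exists:
  assumes "tree_on V A" "proper_colouring A col" "\<And>v. inj_on (h v) {z. (v, z) \<in> A}"
    and "a \<in> V" "b \<in> V" "a = b \<longrightarrow> V = {a}"
  shows "\<exists>pos. order_compat V A col h pos \<and> between_ends V a b pos \<and> bij_betw pos V {1..card V}"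
  using assms
proof (induction "card V" arbitrary: V A a b rule: less_induct)
  case (less V A a b)
  note tree = less.prems(1) and proper = less.prems(2) and inj = less.prems(3)
  show ?case
  proof (cases "a = b")
    case True
    then have V: "V = {a}" using less.prems by blast
    have "(u, v) \<notin> A" for u v
      using tree_vertex[OF tree, of u v] tree_irrefl[OF tree, of u v] V by auto
    then have "A = {}" by auto
    then have "order_compat V A col h (\<lambda>_. 1)" "between_ends V a b (\<lambda>_. 1)"
      using V by (simp_all add: order_compat_def arcs_compat_def rotation_compat_def between_ends_def)
    moreover have "bij_betw (\<lambda>_. 1) V {1..card V}" using V by (simp add: bij_betw_def)
    ultimately show ?thesis by blast
  next
    case False
    then obtain p x y where split: "split_at A h a b p x y"
      using split_at_exists[OF tree inj less.prems(4,5)] by blast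
    then have edge: "(a, p) \<in> A" by (auto simp: split_at_def)
    note marks = split_at_marks[OF tree split]
    have Un: "branch A a p \<union> branch A p a = V" and dis: "branch A a p \<inter> branch A p a = {}"
      using branch_Un[OF tree edge] branch_disjoint[OF tree edge] by auto
    have card: "card (branch A a p) < card V" "card (branch A p a) < card V"
      using Un dis branch_self[of a A p] branch_self[of p A a] tree_finite[OF tree]
      by (auto intro!: psubset_card_mono)
    have part: "\<exists>pos. order_compat W (A \<inter> (W \<times> W)) col h pos \<and> between_ends W c d pos \<and>
        bij_betw pos W {1..card W}"
      if "tree_on W (A \<inter> (W \<times> W))" "card W < card V" "c \<in> W" "d \<in> W" "c = d \<longrightarrow> W = {c}" for W c d
    proof (rule less.hyps[OF that(2,1) _ _ that(3-5)])
      show "proper_colouring (A \<inter> W \<times> W) col"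
        using proper by (auto simp: proper_colouring_def)
      show "inj_on (h v) {z. (v, z) \<in> A \<inter> W \<times> W}" for v
        using inj[of v] by (rule inj_on_subset) auto
    qed
    obtain pos1 where pos1: "order_compat (branch A a p) (A \<inter> (branch A a p \<times> branch A a p)) col h pos1"
      "between_ends (branch A a p) a x pos1" "bij_betw pos1 (branch A a p) {1..card (branch A a p)}"
      using part[OF tree_on_branch[OF tree edge] card(1) branch_self marks(1,2)] by blast
    obtain pos2 where pos2: "order_compat (branch A p a) (A \<inter> (branch A p a \<times> branch A p a)) col h pos2"
      "between_ends (branch A p a) y b pos2" "bij_betw pos2 (branch A p a) {1..card (branch A p a)}"
      using part[OF tree_on_branch[OF tree tree_sym[OF tree edge]] card(2) marks(3,4,5)] by blast
    interpret glued_order V A col h a b p x y pos1 pos2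
      using tree proper split pos1 pos2 by unfold_locales
    show ?thesis using glued_compat pos_ends pos_bij by blast
  qed
qed

section \<open>Weighted plane trees as abstract trees\<close>

definition adj :: "('v, 'e, 's) lw_plane_graph \<Rightarrow> ('v \<times> 'v) set" where
  "adj T = {(u, v). \<exists>e\<in>edges T. ends T e = {u, v}}"

lemma adj_sym: "(u, v) \<in> adj T \<Longrightarrow> (v, u) \<in> adj T"
  by (auto simp: adj_def insert_commute)

lemma connected_graph_adj:
  "connected_graph T \<longleftrightarrow> verts T \<noteq> {} \<and> (\<forall>u\<in>verts T. \<forall>v\<in>verts T. (u, v) \<in> (adj T)\<^sup>*)"
  by (simp add: connected_graph_def adj_def)

text \<open>Every vertex but the root is charged to the last edge of a shortest path from the root.\<close>

lemma connected_card_le: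
  assumes conn: "connected_graph T" and fin: "finite (edges T)"
  shows "card (verts T) \<le> card (edges T) + 1"
proof -
  obtain r where r: "r \<in> verts T" using conn by (auto simp: connected_graph_def)
  define d where "d v = (LEAST n. (r, v) \<in> adj T ^^ n)" for v
  have "\<exists>e u. e \<in> edges T \<and> ends T e = {u, v} \<and> d u < d v" if v: "v \<in> verts T - {r}" for v
  proof -
    have "(r, v) \<in> (adj T)\<^sup>*" using conn r v by (simp add: connected_graph_adj)
    then obtain n where "(r, v) \<in> adj T ^^ n" by (auto simp: rtrancl_power)
    then have dv: "(r, v) \<in> adj T ^^ d v" unfolding d_def by (rule LeastI)
    then obtain m where m: "d v = Suc m" using v by (cases "d v") auto
    then obtain u where u: "(r, u) \<in> adj T ^^ m" "(u, v) \<in> adj T" using dv by auto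
    have "d u \<le> m" unfolding d_def using u(1) by (rule Least_le)
    then have "d u < d v" using m by simp
    then show ?thesis using u(2) unfolding adj_def by blast
  qed
  then obtain f where f: "f v \<in> edges T \<and> (\<exists>u. ends T (f v) = {u, v} \<and> d u < d v)"
    if "v \<in> verts T - {r}" for v
    by metis
  have "inj_on f (verts T - {r})"
  proof (rule inj_onI)
    fix v w assume vw: "v \<in> verts T - {r}" "w \<in> verts T - {r}" "f v = f w"
    obtain u where u: "ends T (f v) = {u, v}" "d u < d v" using f[OF vw(1)] by blast
    obtain u' where u': "ends T (f w) = {u', w}" "d u' < d w" using f[OF vw(2)] by blast
    from u u' vw(3) show "v = w" by (auto simp: doubleton_eq_iff)
  qed
  moreover have "f ` (verts T - {r}) \<subseteq> edges T" using f by blast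
  ultimately have "card (verts T - {r}) \<le> card (edges T)"
    using fin by (rule card_inj_on_le)
  then show ?thesis using r by (cases "finite (verts T)") auto
qed

text \<open>Removing an edge of a cycle keeps the graph connected but leaves fewer edges than
  \<open>connected_card_le\<close> demands. The combed graph is shown to be acyclic by this
  count.\<close>

lemma connected_acyclic:
  assumes conn: "connected_graph T" and fin: "finite (edges T)"
    and card: "card (edges T) + 1 \<le> card (verts T)"
  shows "\<not> graph_cycle T vs es"
proof
  assume cyc: "graph_cycle T vs es"
  let ?n = "length vs"
  define e where "e = es ! 0"
  define T' where "T' = T\<lparr>edges := edges T - {e}\<rparr>"
  have len: "?n = length es" "0 < ?n" and dist: "distinct es" and sub: "set es \<subseteq> edges T"
    and ends: "\<And>i. i < ?n \<Longrightarrow> ends T (es ! i) = {vs ! i, vs ! (Suc i mod ?n)}"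
    using cyc by (auto simp: graph_cycle_def)
  have eE: "e \<in> edges T" using len sub unfolding e_def by (simp add: subset_iff)
  \<comment> \<open>The rest of the cycle is a detour around \<open>e\<close>. Indices are taken
    modulo the length, so that a loop is covered too.\<close>
  have path: "(vs ! (1 mod ?n), vs ! (Suc k mod ?n)) \<in> (adj T')\<^sup>*" if "k < ?n" for k
    using that
  proof (induction k)
    case 0
    then show ?case by simp
  next
    case (Suc k)
    have "es ! Suc k \<noteq> e"
      using dist len Suc.prems unfolding e_def by (simp add: nth_eq_iff_index_eq)
    moreover have "es ! Suc k \<in> edges T" using sub len Suc.prems by (simp add: subset_iff)
    ultimately have "(vs ! Suc k, vs ! (Suc (Suc k) mod ?n)) \<in> adj T'"
      using ends[OF Suc.prems] unfolding adj_def T'_def by auto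
    then show ?case using Suc by (auto intro: rtrancl_into_rtrancl)
  qed
  have "sym (adj T')" by (auto intro: symI adj_sym)
  then have sym_path: "(x, y) \<in> (adj T')\<^sup>* \<Longrightarrow> (y, x) \<in> (adj T')\<^sup>*" for x y
    by (rule sym_rtranclD)
  have "(vs ! (1 mod ?n), vs ! 0) \<in> (adj T')\<^sup>*"
    using path[of "?n - 1"] len(2) by simp
  then have e_path: "(x, y) \<in> (adj T')\<^sup>*" if "ends T e = {x, y}" for x y
    using ends[OF len(2)] that sym_path unfolding e_def by (auto simp: doubleton_eq_iff)
  have "adj T \<subseteq> (adj T')\<^sup>*"
  proof (clarsimp simp: adj_def[of T])
    fix x y f assume f: "f \<in> edges T" "ends T f = {x, y}"
    show "(x, y) \<in> (adj T')\<^sup>*"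
    proof (cases "f = e")
      case True
      then show ?thesis using e_path f by simp
    next
      case False
      then have "(x, y) \<in> adj T'" using f unfolding adj_def T'_def by auto
      then show ?thesis by (rule r_into_rtrancl)
    qed
  qed
  then have "(adj T)\<^sup>* \<subseteq> (adj T')\<^sup>*" by (rule rtrancl_subset_rtrancl)
  then have "connected_graph T'"
    using conn unfolding connected_graph_adj by (auto simp: T'_def)
  moreover have "finite (edges T')" using fin by (simp add: T'_def)
  ultimately have "card (verts T') \<le> card (edges T') + 1" by (rule connected_card_le)
  moreover have "card (edges T') = card (edges T) - 1" "card (verts T') = card (verts T)"
    using eE by (simp_all add: T'_def card_Diff_singleton)
  moreover have "0 < card (edges T)" using eE fin by (auto simp: card_gt_0_iff)
  ultimately show False using card by linarith
qed

locale lwbp =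
  fixes S :: "'s set" and wt :: "'s \<Rightarrow> real" and T :: "('v, 'e, 's) lw_plane_graph"
  assumes lwbp: "lwbp_tree S wt T" and finite_S: "finite S"
begin

abbreviation "black v \<equiv> wt (lab T v) > 0"

lemma lab_bij: "bij_betw (lab T) (verts T) S"
  and finite_edges: "finite (edges T)"
  and connected: "connected_graph T"
  and acyclic: "\<not> graph_cycle T vs es"
  and edge_wt_pos: "e \<in> edges T \<Longrightarrow> edge_wt T e > 0"
  and vertex_sum: "v \<in> verts T \<Longrightarrow> (\<Sum>e\<in>incident T v. edge_wt T e) = \<bar>wt (lab T v)\<bar>"
  and cyclic: "v \<in> verts T \<Longrightarrow> cyclic_on (nxt T v) (incident T v)"
  using lwbp by (auto simp: lwbp_tree_def)

lemma edgeE: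
  assumes "e \<in> edges T"
  obtains b w where "b \<in> verts T" "w \<in> verts T" "ends T e = {b, w}" "black b" "\<not> black w" "b \<noteq> w"
proof -
  obtain b w where "b \<in> verts T" "w \<in> verts T" "ends T e = {b, w}" "wt (lab T b) > 0" "wt (lab T w) < 0"
    using lwbp assms unfolding lwbp_tree_def by blast
  moreover have "b \<noteq> w" using calculation by auto
  ultimately show thesis using that[of b w] by simp
qed

lemma finite_verts: "finite (verts T)"
  using lab_bij finite_S by (simp add: bij_betw_finite)

lemma adj_black: "(u, v) \<in> adj T \<Longrightarrow> black u \<noteq> black v"
  unfolding adj_def by (auto elim!: edgeE simp: doubleton_eq_iff)

lemma adj_verts: "(u, v) \<in> adj T \<Longrightarrow> u \<in> verts T \<and> v \<in> verts T"
  unfolding adj_def by (auto elim!: edgeE simp: doubleton_eq_iff)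

lemma proper: "proper_colouring (adj T) (\<lambda>v. black v)"
  unfolding proper_colouring_def using adj_black by blast

lemma ends_inj:
  assumes e: "e \<in> edges T" "f \<in> edges T" and eq: "ends T e = ends T f"
  shows "e = f"
proof (rule ccontr)
  assume "e \<noteq> f"
  obtain b w where "ends T e = {b, w}" "b \<noteq> w" using e(1) by (rule edgeE)
  then have "graph_cycle T [b, w] [e, f]"
    using e eq \<open>e \<noteq> f\<close> by (auto simp: graph_cycle_def less_Suc_eq)
  then show False using acyclic by blast
qed

text \<open>A path that joins the ends of an edge without using it can be made simple, and then
  closes up with the edge to a \<open>graph_cycle\<close>.\<close>

lemma tree_on_adj: "tree_on (verts T) (adj T)"
  unfolding tree_on_def
proof (intro conjI ballI allI impI notI)
  show "finite (verts T)" by (rule finite_verts)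
  show "adj T \<subseteq> verts T \<times> verts T" using adj_verts by auto
  show "sym (adj T)" by (auto intro: symI adj_sym)
  show "(u, v) \<in> (adj T)\<^sup>*" if "u \<in> verts T" "v \<in> verts T" for u v
    using connected that by (simp add: connected_graph_adj)
  fix u v assume uv: "(u, v) \<in> adj T" and path: "(u, v) \<in> (adj T - {(u, v), (v, u)})\<^sup>*"
  define r where "r x y \<longleftrightarrow> (x, y) \<in> adj T - {(u, v), (v, u)}" for x y
  have "{(x, y). r x y} = adj T - {(u, v), (v, u)}" by (auto simp: r_def)
  then have "r\<^sup>*\<^sup>* u v" using path unfolding rtranclp_rtrancl_eq by simp
  then obtain xs' where "rtrancl_path r u xs' v" by (auto simp: rtranclp_eq_rtrancl_path)
  then obtain xs where xs: "rtrancl_path r u xs v" and dist: "distinct (u # xs)"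
    by (rule rtrancl_path_distinct)
  have "u \<noteq> v" using adj_black[OF uv] by blast
  then have "xs \<noteq> []" using xs by (auto elim: rtrancl_path.cases)
  then have last: "last xs = v" using xs by (simp add: rtrancl_path_last)
  have step: "r ((u # xs) ! i) (xs ! i)" if "i < length xs" for i
    using xs that by (rule rtrancl_path_nth)
  have "length xs \<noteq> 1"
  proof
    assume "length xs = 1"
    then have "xs = [v]" using last by (cases xs) auto
    then show False using step[of 0] by (simp add: r_def)
  qed
  then have len: "length xs \<ge> 2" using \<open>xs \<noteq> []\<close> by (cases xs) (auto simp: Suc_le_eq)
  define vs where "vs = u # xs"
  let ?n = "length vs"
  have vs_adj: "(vs ! i, vs ! (Suc i mod ?n)) \<in> adj T" if "i < ?n" for i
  proof (cases "Suc i = ?n")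
    case True
    then have "vs ! i = v" "vs ! (Suc i mod ?n) = u"
      using last \<open>xs \<noteq> []\<close> by (auto simp: vs_def last_conv_nth nth_Cons')
    then show ?thesis using adj_sym[OF uv] by simp
  next
    case False
    then have "i < length xs" using that by (simp add: vs_def)
    then show ?thesis using step[of i] by (simp add: r_def vs_def)
  qed
  then have "\<exists>e. e \<in> edges T \<and> ends T e = {vs ! i, vs ! (Suc i mod ?n)}" if "i < ?n" for i
    using that unfolding adj_def by blast
  then obtain f where f: "f i \<in> edges T \<and> ends T (f i) = {vs ! i, vs ! (Suc i mod ?n)}" if "i < ?n" for i
    by metis
  have idx: "vs ! i = vs ! j \<longleftrightarrow> i = j" if "i < ?n" "j < ?n" for i j
    using dist that unfolding vs_def by (rule nth_eq_iff_index_eq)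
  have "inj_on f {0..<?n}"
  proof (rule inj_onI)
    fix i j assume ij: "i \<in> {0..<?n}" "j \<in> {0..<?n}" "f i = f j"
    then have eq: "{vs ! i, vs ! (Suc i mod ?n)} = {vs ! j, vs ! (Suc j mod ?n)}"
      using f[of i] f[of j] by auto
    have mod: "Suc i mod ?n < ?n" "Suc j mod ?n < ?n" using ij by (auto intro: mod_less_divisor)
    show "i = j"
    proof (rule ccontr)
      assume "i \<noteq> j"
      then have "vs ! i = vs ! (Suc j mod ?n)" "vs ! j = vs ! (Suc i mod ?n)"
        using eq idx ij by (auto simp: doubleton_eq_iff)
      then have "i = Suc j mod ?n" "j = Suc i mod ?n"
        using idx ij mod by auto
      \<comment> \<open>On two vertices both steps of the cycle could be the same edge. The path has
        at least two steps because the edge joining its ends was removed.\<close>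
      moreover have "?n \<ge> 3" using len by (simp add: vs_def)
      moreover have "Suc k mod ?n = (if Suc k = ?n then 0 else Suc k)" if "k < ?n" for k
        using that by auto
      ultimately show False using ij by (auto split: if_splits)
    qed
  qed
  then have "distinct (map f [0..<?n])" by (simp add: distinct_map)
  moreover have "distinct vs" "0 < ?n" using dist by (simp_all add: vs_def)
  moreover have "set (map f [0..<?n]) \<subseteq> edges T" using f by auto
  moreover have "ends T (map f [0..<?n] ! i) = {vs ! i, vs ! (Suc i mod ?n)}" if "i < ?n" for i
    using f that by simp
  ultimately have "graph_cycle T vs (map f [0..<?n])"
    unfolding graph_cycle_def by simp
  then show False using acyclic by blast
qed

definition other :: "'v \<Rightarrow> 'e \<Rightarrow> 'v" where
  "other v e = the_elem (ends T e - {v})"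

lemma ends_other:
  assumes "e \<in> incident T v"
  shows "ends T e = {v, other v e}" "(v, other v e) \<in> adj T" "v \<in> verts T" "e \<in> edges T"
proof -
  have e: "e \<in> edges T" "v \<in> ends T e" using assms by (auto simp: incident_def)
  obtain b w where bw: "b \<in> verts T" "w \<in> verts T" "ends T e = {b, w}" "b \<noteq> w" using e(1) by (rule edgeE)
  then have "ends T e - {v} = {if v = b then w else b}" using e(2) by auto
  then have "other v e = (if v = b then w else b)" by (simp add: other_def)
  then show "ends T e = {v, other v e}" using bw e(2) by auto
  then show "(v, other v e) \<in> adj T" using e(1) by (auto simp: adj_def)
  show "v \<in> verts T" "e \<in> edges T" using bw e by auto
qed

lemma other_eqI: "\<lbrakk>e \<in> edges T; ends T e = {v, u}\<rbrakk> \<Longrightarrow> other v e = u"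
  using ends_other[of e v] adj_black[of v u] by (auto simp: incident_def adj_def doubleton_eq_iff)

lemma adj_edgeE:
  assumes "(v, u) \<in> adj T" obtains e where "e \<in> incident T v" "other v e = u"
proof -
  obtain e where e: "e \<in> edges T" "ends T e = {v, u}" using assms by (auto simp: adj_def)
  then show thesis using that[of e] other_eqI by (auto simp: incident_def)
qed

lemma other_inj: "\<lbrakk>e \<in> incident T v; f \<in> incident T v; other v e = other v f\<rbrakk> \<Longrightarrow> e = f"
  using ends_other(1,4) ends_inj by metis

text \<open>The negation turns the clockwise list at a white vertex into the anticlockwise
  one.\<close>

definition edge_key :: "('v \<Rightarrow> nat) \<Rightarrow> 'v \<Rightarrow> 'e \<Rightarrow> int" where
  "edge_key pos v e = (if black v then vkey pos v (other v e) else - vkey pos v (other v e))"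

definition tree_compat :: "('v \<Rightarrow> nat) \<Rightarrow> bool" where
  "tree_compat pos \<longleftrightarrow> inj_on pos (verts T) \<and> arcs_compat (adj T) (\<lambda>v. black v) pos \<and>
     (\<forall>v\<in>verts T. cyc_next (nxt T v) (incident T v) (edge_key pos v))"

lemma vkey_inj: "vkey pos v x = vkey pos v y \<Longrightarrow> pos x = pos y"
  by (auto simp: vkey_def split: if_splits)

lemma edge_key_inj:
  assumes "inj_on pos (verts T)" shows "inj_on (edge_key pos v) (incident T v)"
proof (rule inj_onI)
  fix e f assume ef: "e \<in> incident T v" "f \<in> incident T v" "edge_key pos v e = edge_key pos v f"
  then have "vkey pos v (other v e) = vkey pos v (other v f)"
    by (auto simp: edge_key_def split: if_splits)
  then have "pos (other v e) = pos (other v f)" by (rule vkey_inj)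
  then have "other v e = other v f"
    using assms ends_other(2) ef(1,2) adj_verts by (meson inj_onD)
  then show "e = f" using other_inj ef by blast
qed

lemma cyc3_minus: "cyc3 (- x) (- y) (- z) \<longleftrightarrow> cyc3 z y (x :: int)"
  unfolding cyc3_def by auto

text \<open>The order theorems speak of keys on neighbours, a tree has a successor map on edges. A
  single choice of \<open>h\<close>, taken from the rotation and reversed at white vertices, serves
  for all \<open>pos\<close>, so that two orders can be compared.\<close>

lemma order_compat_iff:
  "\<exists>h :: 'v \<Rightarrow> 'v \<Rightarrow> int. (\<forall>v. inj_on (h v) {z. (v, z) \<in> adj T}) \<and>
     (\<forall>pos. order_compat (verts T) (adj T) (\<lambda>v. black v) h pos \<longleftrightarrow> tree_compat pos)"
proof -
  have "\<exists>k. cyc_next (nxt T v) (incident T v) k" if "v \<in> verts T" for v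
    using cyc_next_exists[OF cyclic[OF that]] by blast
  then obtain k where k: "cyc_next (nxt T v) (incident T v) (k v)" if "v \<in> verts T" for v
    by metis
  have "\<exists>e. (v, u) \<in> adj T \<longrightarrow> e \<in> incident T v \<and> other v e = u" for v u
    using adj_edgeE by metis
  then obtain g where g: "g v u \<in> incident T v" "other v (g v u) = u" if "(v, u) \<in> adj T" for v u
    by metis
  have g_other: "g v (other v e) = e" if "e \<in> incident T v" for v e
    using other_inj[OF _ that] g[OF ends_other(2)[OF that]] by blast
  define h where "h v u = (if black v then k v (g v u) else - k v (g v u))" for v u
  have inj_h: "inj_on (h v) {z. (v, z) \<in> adj T}" for v
  proof (rule inj_onI)
    fix x y assume xy: "x \<in> {z. (v, z) \<in> adj T}" "y \<in> {z. (v, z) \<in> adj T}" "h v x = h v y"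
    then have "k v (g v x) = k v (g v y)" by (auto simp: h_def split: if_splits)
    moreover have "inj_on (k v) (incident T v)"
      using k[of v] xy(1) adj_verts by (auto simp: cyc_next_def)
    ultimately have "g v x = g v y" using xy g(1) by (meson inj_onD mem_Collect_eq)
    then show "x = y" using xy g(2) by (metis mem_Collect_eq)
  qed
  have h_edge: "cyc3 (h v x) (h v y) (h v z) \<longleftrightarrow>
      (if black v then cyc3 (k v (g v x)) (k v (g v y)) (k v (g v z))
       else cyc3 (k v (g v z)) (k v (g v y)) (k v (g v x)))" for v x y z
    by (simp add: h_def cyc3_minus)
  have key_edge: "cyc3 (edge_key pos v e) (edge_key pos v f) (edge_key pos v g) \<longleftrightarrow>
      (if black v then cyc3 (vkey pos v (other v e)) (vkey pos v (other v f)) (vkey pos v (other v g))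
       else cyc3 (vkey pos v (other v g)) (vkey pos v (other v f)) (vkey pos v (other v e)))" for pos v e f g
    by (simp add: edge_key_def cyc3_minus)
  have "rotation_compat (adj T) h pos \<longleftrightarrow>
      (\<forall>v\<in>verts T. cyc_next (nxt T v) (incident T v) (edge_key pos v))" (is "?L \<longleftrightarrow> ?R")
    if inj: "inj_on pos (verts T)" for pos
  proof
    assume L: ?L
    show ?R
    proof
      fix v assume v: "v \<in> verts T"
      have "cyc3 (k v e) (k v f) (k v f') \<longleftrightarrow> cyc3 (edge_key pos v e) (edge_key pos v f) (edge_key pos v f')"
        if e: "e \<in> incident T v" "f \<in> incident T v" "f' \<in> incident T v" for e f f'
      proof -
        have *: "cyc3 (h v (other v e)) (h v (other v f)) (h v (other v f')) \<longleftrightarrow>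
            cyc3 (vkey pos v (other v e)) (vkey pos v (other v f)) (vkey pos v (other v f'))"
          if "e \<in> incident T v" "f \<in> incident T v" "f' \<in> incident T v" for e f f'
          using L ends_other(2) that unfolding rotation_compat_def by blast
        show ?thesis
          using *[OF e] *[OF e(3,2,1)] unfolding h_edge key_edge by (simp add: g_other e split: if_splits)
      qed
      with k[OF v] edge_key_inj[OF inj] show "cyc_next (nxt T v) (incident T v) (edge_key pos v)"
        by (rule cyc_next_transfer)
    qed
  next
    assume R: ?R
    show ?L
      unfolding rotation_compat_def
    proof (intro allI impI)
      fix v x y z assume nb: "(v, x) \<in> adj T" "(v, y) \<in> adj T" "(v, z) \<in> adj T"
      then have v: "v \<in> verts T" using adj_verts by blast
      note agree = cyc_next_agree[OF cyclic[OF v] k[OF v] R[rule_format, OF v]]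
      show "cyc3 (h v x) (h v y) (h v z) \<longleftrightarrow> cyc3 (vkey pos v x) (vkey pos v y) (vkey pos v z)"
        using agree[OF g(1) g(1) g(1), OF nb] agree[OF g(1) g(1) g(1), OF nb(3,2,1)]
        unfolding h_edge key_edge by (simp add: g(2) nb)
    qed
  qed
  then have "order_compat (verts T) (adj T) (\<lambda>v. black v) h pos \<longleftrightarrow> tree_compat pos" for pos
    unfolding order_compat_def tree_compat_def by blast
  then show ?thesis using inj_h by blast
qed

lemma tree_compat_exists:
  assumes "a \<in> verts T" "b \<in> verts T" "a = b \<longrightarrow> verts T = {a}"
  obtains pos where "tree_compat pos" "between_ends (verts T) a b pos"
    "bij_betw pos (verts T) {1..card (verts T)}"
proof -
  obtain h where h: "\<And>v. inj_on (h v) {z. (v, z) \<in> adj T}"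
    "\<And>pos. order_compat (verts T) (adj T) (\<lambda>v. black v) h pos \<longleftrightarrow> tree_compat pos"
    using order_compat_iff by blast
  show thesis
    using order_compat_exists[OF tree_on_adj proper h(1) assms] h(2) that by blast
qed

lemma tree_compat_unique:
  assumes "a \<in> verts T" "b \<in> verts T" "a = b \<longrightarrow> verts T = {a}"
    and "tree_compat pos" "between_ends (verts T) a b pos"
    and "tree_compat pos'" "between_ends (verts T) a b pos'"
    and "u \<in> verts T" "v \<in> verts T"
  shows "pos u < pos v \<longleftrightarrow> pos' u < pos' v"
proof -
  obtain h where h: "\<And>v. inj_on (h v) {z. (v, z) \<in> adj T}"
    "\<And>pos. order_compat (verts T) (adj T) (\<lambda>v. black v) h pos \<longleftrightarrow> tree_compat pos"
    using order_compat_iff by blast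
  show ?thesis
    using order_compat_unique[OF tree_on_adj proper h(1) assms(1-3)] h(2) assms(4-) by blast
qed

end

section \<open>The rectangles of the combing map\<close>

text \<open>
  Bottom and top of the rectangle between the vertical lines \<open>k\<close> and \<open>l\<close> in the upper half plane;
  the rectangle exists if the first number is smaller than the second.
\<close>

definition low :: "(nat \<Rightarrow> real) \<Rightarrow> nat \<Rightarrow> nat \<Rightarrow> real" where
  "low H k l = max 0 (max (H (k - 1)) (H l))"

definition high :: "(nat \<Rightarrow> real) \<Rightarrow> nat \<Rightarrow> nat \<Rightarrow> real" where
  "high H k l = Min (H ` {k..<l})"

definition up_edge :: "(nat \<Rightarrow> real) \<Rightarrow> nat \<Rightarrow> nat \<Rightarrow> nat \<Rightarrow> bool" where
  "up_edge H N k l \<longleftrightarrow> 1 \<le> k \<and> k < l \<and> l \<le> N \<and> low H k l < high H k l"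

lemma high_le: "k \<le> j \<Longrightarrow> j < l \<Longrightarrow> high H k l \<le> H j"
  unfolding high_def by (rule Min_le) auto

lemma high_attained: "k < l \<Longrightarrow> \<exists>j. k \<le> j \<and> j < l \<and> H j = high H k l"
  using Min_in[of "H ` {k..<l}"] unfolding high_def by fastforce

lemma high_greatest: "\<lbrakk>k < l; \<And>j. k \<le> j \<Longrightarrow> j < l \<Longrightarrow> b \<le> H j\<rbrakk> \<Longrightarrow> b \<le> high H k l"
  unfolding high_def by (subst Min_ge_iff) auto

lemma low_ge: "0 \<le> low H k l" "H (k - 1) \<le> low H k l" "H l \<le> low H k l"
  by (auto simp: low_def)

lemma low_cases: "low H k l = 0 \<or> low H k l = H (k - 1) \<or> low H k l = H l"
  by (auto simp: low_def max_def)

lemma up_edge_pos: "up_edge H N k l \<Longrightarrow> k \<le> j \<Longrightarrow> j < l \<Longrightarrow> 0 < H j"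
  using high_le[of k j l H] low_ge(1)[of H k l] unfolding up_edge_def by linarith

section \<open>Region, cuts and rectangles in coordinates\<close>

definition in_region :: "(nat \<Rightarrow> real) \<Rightarrow> nat \<Rightarrow> real \<Rightarrow> real \<Rightarrow> bool" where
  "in_region H N x h \<longleftrightarrow> (\<exists>i\<in>{1..N}. real i \<le> x \<and> x \<le> real (i + 1) \<and> min 0 (H i) \<le> h \<and> h \<le> max 0 (H i))"

definition in_cut :: "(nat \<Rightarrow> real) \<Rightarrow> nat \<Rightarrow> real \<Rightarrow> real \<Rightarrow> bool" where
  "in_cut H N x h \<longleftrightarrow> (h = 0 \<and> 1 \<le> x \<and> x \<le> real N) \<or>
     (\<exists>i\<in>{1..N}. h = H i \<and> (\<exists>s t. s \<le> real i \<and> real (i + 1) \<le> t \<and> s \<le> x \<and> x \<le> t \<and>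
        (\<forall>z. s \<le> z \<longrightarrow> z \<le> t \<longrightarrow> in_region H N z h)))"

text \<open>The height function is arbitrary here, so that rectangles below the axis become
  rectangles above it when \<open>H\<close> is negated.\<close>

definition is_rect :: "(nat \<Rightarrow> real) \<Rightarrow> nat \<Rightarrow> nat \<Rightarrow> nat \<Rightarrow> real \<Rightarrow> real \<Rightarrow> bool" where
  "is_rect H N k l a b \<longleftrightarrow> 1 \<le> k \<and> k < l \<and> l \<le> N \<and> a < b \<and>
     (\<forall>x h. real k \<le> x \<longrightarrow> x \<le> real l \<longrightarrow> a \<le> h \<longrightarrow> h \<le> b \<longrightarrow> in_region H N x h) \<and>
     min (H (k - 1)) (H k) \<le> a \<and> b \<le> max (H (k - 1)) (H k) \<and>
     min (H (l - 1)) (H l) \<le> a \<and> b \<le> max (H (l - 1)) (H l) \<and>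
     (\<forall>x. real k \<le> x \<longrightarrow> x \<le> real l \<longrightarrow> in_cut H N x a \<and> in_cut H N x b) \<and>
     (\<forall>x h. real k < x \<longrightarrow> x < real l \<longrightarrow> a < h \<longrightarrow> h < b \<longrightarrow> \<not> in_cut H N x h)"

lemma region_iff: "(x, h) \<in> region wt P \<longleftrightarrow> in_region (height wt P) (length P) x h"
  by (auto simp: region_def rec_block_def in_region_def)

lemma cuts_iff: "(x, h) \<in> cuts wt P \<longleftrightarrow> in_cut (height wt P) (length P) x h"
proof -
  have sub: "{s..t} \<times> {c} \<subseteq> region wt P \<longleftrightarrow>
      (\<forall>z. s \<le> z \<longrightarrow> z \<le> t \<longrightarrow> in_region (height wt P) (length P) z c)" for s t c
    by (auto simp: region_iff[symmetric])
  have "(x, h) \<in> maximal_segment wt P i \<longleftrightarrow> h = height wt P i \<and>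
      (\<exists>s t. s \<le> real i \<and> real (i + 1) \<le> t \<and> s \<le> x \<and> x \<le> t \<and>
        (\<forall>z. s \<le> z \<longrightarrow> z \<le> t \<longrightarrow> in_region (height wt P) (length P) z h))" for i
  proof -
    have "(x, h) \<in> maximal_segment wt P i \<longleftrightarrow> (\<exists>s t. s \<le> real i \<and> real (i + 1) \<le> t \<and>
        {s..t} \<times> {height wt P i} \<subseteq> region wt P \<and> (x, h) \<in> {s..t} \<times> {height wt P i})"
      unfolding maximal_segment_def by blast
    then show ?thesis unfolding sub by auto
  qed
  then show ?thesis
    unfolding cuts_def in_cut_def by auto
qed

lemma rects_is_rect: "Rect k l a b \<in> rects wt P \<longleftrightarrow> is_rect (height wt P) (length P) k l a b"
proof (cases "1 \<le> k \<and> k < l \<and> l \<le> length P \<and> a < b")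
  case False
  then show ?thesis by (auto simp: rects_def is_rect_def)
next
  case True
  have vline: "{real i} \<times> {a..b} \<subseteq> vline wt P i \<longleftrightarrow>
      min (height wt P (i - 1)) (height wt P i) \<le> a \<and> b \<le> max (height wt P (i - 1)) (height wt P i)" for i
    using True by (simp add: vline_def Sigma_mono times_subset_iff)
  have reg: "{real k..real l} \<times> {a..b} \<subseteq> region wt P \<longleftrightarrow>
     (\<forall>x h. real k \<le> x \<longrightarrow> x \<le> real l \<longrightarrow> a \<le> h \<longrightarrow> h \<le> b \<longrightarrow> in_region (height wt P) (length P) x h)"
    by (auto simp: region_iff[symmetric])
  have cut: "{real k..real l} \<times> {a, b} \<subseteq> cuts wt P \<longleftrightarrow>
     (\<forall>x. real k \<le> x \<longrightarrow> x \<le> real l \<longrightarrow> in_cut (height wt P) (length P) x a \<and> in_cut (height wt P) (length P) x b)"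
    by (auto simp: cuts_iff[symmetric])
  have int: "({real k<..<real l} \<times> {a<..<b}) \<inter> cuts wt P = {} \<longleftrightarrow>
     (\<forall>x h. real k < x \<longrightarrow> x < real l \<longrightarrow> a < h \<longrightarrow> h < b \<longrightarrow> \<not> in_cut (height wt P) (length P) x h)"
    unfolding disjoint_iff by (auto simp: cuts_iff[symmetric])
  show ?thesis
    using True by (simp add: rects_def is_rect_def vline reg cut int)
qed

lemma in_region_minus: "in_region (\<lambda>i. - H i) N x h \<longleftrightarrow> in_region H N x (- h)"
proof -
  have "min 0 (- H i) \<le> h \<and> h \<le> max 0 (- H i) \<longleftrightarrow> min 0 (H i) \<le> - h \<and> - h \<le> max 0 (H i)" for i
    by (auto simp: min_def max_def)
  then show ?thesis by (simp add: in_region_def)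
qed

lemma in_cut_minus: "in_cut (\<lambda>i. - H i) N x h \<longleftrightarrow> in_cut H N x (- h)"
proof -
  have "h = - H i \<longleftrightarrow> - h = H i" for i by auto
  then show ?thesis by (simp add: in_cut_def in_region_minus)
qed

lemma is_rect_minus:
  assumes "is_rect H N k l a b" shows "is_rect (\<lambda>i. - H i) N k l (- b) (- a)"
proof -
  have *: "min (- x) (- y) \<le> - b \<and> - a \<le> max (- x) (- y) \<longleftrightarrow> min x y \<le> a \<and> b \<le> max x y" for x y :: real
    by (auto simp: min_def max_def)
  have h: "a \<le> - h" "- h \<le> b" if "- b \<le> h" "h \<le> - a" for h using that by auto
  have h': "a < - h" "- h < b" if "- b < h" "h < - a" for h using that by auto
  show ?thesis
    using assms *[of "H (k - 1)" "H k"] *[of "H (l - 1)" "H l"] h h'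
    unfolding is_rect_def in_region_minus in_cut_minus by auto
qed

text \<open>The midpoint of a gap lies in one block only, whereas two blocks can meet at an integer
  abscissa. Heights are therefore read off at midpoints.\<close>

lemma in_region_mid:
  "in_region H N (real j + 1/2) h \<longleftrightarrow> 1 \<le> j \<and> j \<le> N \<and> min 0 (H j) \<le> h \<and> h \<le> max 0 (H j)"
proof -
  have "real i \<le> real j + 1/2 \<and> real j + 1/2 \<le> real (i + 1) \<longleftrightarrow> i = j" for i
  proof
    assume "real i \<le> real j + 1/2 \<and> real j + 1/2 \<le> real (i + 1)"
    then have "real i < real (j + 1)" "real j < real (i + 1)" by auto
    then show "i = j" by linarith
  qed simp
  then show ?thesis unfolding in_region_def by (metis atLeastAtMost_iff)
qed

text \<open>A cut above the axis is the extension of the segment at some gap \<open>i\<close>. It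
  stays in the region up to \<open>x\<close>, so the gaps on the way are at least as high.\<close>

lemma in_cutE:
  assumes "in_cut H N x h" "0 < h"
  obtains i where "1 \<le> i" "i \<le> N" "H i = h"
    "\<And>j. \<lbrakk>i \<le> j; real j + 1/2 \<le> x\<rbrakk> \<Longrightarrow> h \<le> H j"
    "\<And>j. \<lbrakk>j \<le> i; x \<le> real j + 1/2\<rbrakk> \<Longrightarrow> h \<le> H j"
proof -
  from assms obtain i s t where i: "1 \<le> i" "i \<le> N" "h = H i" "s \<le> real i" "real (i + 1) \<le> t" "s \<le> x" "x \<le> t"
    and reg: "\<And>z. s \<le> z \<Longrightarrow> z \<le> t \<Longrightarrow> in_region H N z h"
    unfolding in_cut_def by auto
  have "h \<le> H j" if "s \<le> real j + 1/2" "real j + 1/2 \<le> t" for j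
    using reg[OF that] assms(2) unfolding in_region_mid by (auto simp: max_def split: if_splits)
  then show thesis using i by (intro that[of i]) auto
qed

text \<open>Just outside the two vertical lines the heights are at most \<open>a\<close>. Hence the
  cut along the top comes from a gap between the lines, which makes \<open>b\<close> the minimum of
  the heights there. If \<open>a\<close> exceeded \<open>low H k l\<close>, the cut along the bottom
  would come from such a gap too, but there the height is at least \<open>b\<close>.\<close>

lemma is_rect_up:
  assumes r: "is_rect H N k l a b" and b: "0 < b"
  shows "up_edge H N k l" "a = low H k l" "b = high H k l"
proof -
  have kl: "1 \<le> k" "k < l" "l \<le> N" "a < b" using r by (auto simp: is_rect_def)
  have reg: "in_region H N (real j + 1/2) h" if "k \<le> j" "j < l" "a \<le> h" "h \<le> b" for j h
    using r that unfolding is_rect_def by auto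
  have Hj: "b \<le> H j" if "k \<le> j" "j < l" for j
    using reg[OF that, of b] b kl unfolding in_region_mid by (auto simp: max_def split: if_splits)
  have "0 \<le> a"
    using reg[of k a] Hj[of k] b kl unfolding in_region_mid by (auto simp: min_def split: if_splits)
  have "b \<le> H k" "b \<le> H (l - 1)" using Hj kl by auto
  then have out: "H (k - 1) \<le> a" "H l \<le> a"
    using r kl unfolding is_rect_def by (auto simp: min_def max_def split: if_splits)
  have inside: "k \<le> i \<and> i < l" if "H i = h" "a < h"
    "\<And>j. \<lbrakk>i \<le> j; real j + 1/2 \<le> real k + 1/2\<rbrakk> \<Longrightarrow> h \<le> H j"
    "\<And>j. \<lbrakk>j \<le> i; real k + 1/2 \<le> real j + 1/2\<rbrakk> \<Longrightarrow> h \<le> H j" for i h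
  proof -
    have "\<not> i < k"
    proof
      assume "i < k"
      then have "i \<le> k - 1" by simp
      then show False using that(3)[of "k - 1"] out(1) that(2) kl(1) by auto
    qed
    moreover have "\<not> l \<le> i"
      using that(4)[of l] out(2) that(2) kl(2) by auto
    ultimately show ?thesis by simp
  qed
  have "in_cut H N (real k + 1/2) b" "in_cut H N (real k + 1/2) a"
    using r kl unfolding is_rect_def by auto
  then obtain i where i: "H i = b" "k \<le> i" "i < l"
    using in_cutE[OF _ b, of H N "real k + 1/2"] inside[OF _ kl(4)] by metis
  show high: "b = high H k l"
    using high_le[OF i(2,3), of H] i(1) high_greatest[OF kl(2), of b H] Hj by auto
  have "low H k l \<le> a" using out \<open>0 \<le> a\<close> by (simp add: low_def)
  moreover have "\<not> low H k l < a"
  proof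
    assume less: "low H k l < a"
    then have "0 < a" using low_ge(1)[of H k l] by simp
    then obtain i where i: "H i = a"
      "\<And>j. \<lbrakk>i \<le> j; real j + 1/2 \<le> real k + 1/2\<rbrakk> \<Longrightarrow> a \<le> H j"
      "\<And>j. \<lbrakk>j \<le> i; real k + 1/2 \<le> real j + 1/2\<rbrakk> \<Longrightarrow> a \<le> H j"
      using \<open>in_cut H N (real k + 1/2) a\<close> by (metis in_cutE)
    have "\<not> i < k"
    proof
      assume "i < k"
      then have "i \<le> k - 1" by simp
      then show False using i(2)[of "k - 1"] less low_ge(2)[of H k l] kl(1) by auto
    qed
    moreover have "\<not> l \<le> i"
      using i(3)[of l] less low_ge(3)[of H l k] low_ge(3)[of H k l] kl(2) by auto
    ultimately show False using Hj[of i] i(1) kl(4) by auto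
  qed
  ultimately show low: "a = low H k l" by simp
  show "up_edge H N k l" using kl low high by (simp add: up_edge_def)
qed

lemma in_regionI:
  assumes "1 \<le> k" "l \<le> N + 1" "real k \<le> x" "x \<le> real l" "k < l"
    and h: "0 \<le> h" "\<And>j. k \<le> j \<Longrightarrow> j < l \<Longrightarrow> h \<le> H j"
  shows "in_region H N x h"
proof -
  \<comment> \<open>At the right end the floor of \<open>x\<close> would be \<open>l\<close>, a gap
    about whose height nothing is assumed.\<close>
  define i where "i = (if x = real l then l - 1 else nat \<lfloor>x\<rfloor>)"
  have i: "k \<le> i" "i < l" "real i \<le> x" "x \<le> real (i + 1)"
    using assms(3-5) unfolding i_def by (auto simp: le_nat_floor nat_less_iff floor_less_iff) linarith+
  then show ?thesis
    unfolding in_region_def using h(1) h(2)[OF i(1,2)] assms(1,2)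
    by (intro bexI[of _ i]) auto
qed

lemma in_cutI:
  assumes "1 \<le> k" "l \<le> N + 1" "real k \<le> x" "x \<le> real l" "k < l"
    and "0 \<le> H i" "\<And>j. k \<le> j \<Longrightarrow> j < l \<Longrightarrow> H i \<le> H j" "k \<le> i" "i < l"
  shows "in_cut H N x (H i)"
proof -
  have "in_region H N z (H i)" if "real k \<le> z" "z \<le> real l" for z
    using assms that by (intro in_regionI[of k l]) auto
  then have "\<exists>s t. s \<le> real i \<and> real (i + 1) \<le> t \<and> s \<le> x \<and> x \<le> t \<and>
      (\<forall>z. s \<le> z \<longrightarrow> z \<le> t \<longrightarrow> in_region H N z (H i))"
    using assms by - (rule exI[of _ "real k"], rule exI[of _ "real l"], auto)
  moreover have "i \<in> {1..N}" using assms by auto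
  ultimately show ?thesis unfolding in_cut_def by blast
qed

lemma up_is_rect:
  assumes up: "up_edge H N k l" and H0: "H 0 = 0"
  shows "is_rect H N k l (low H k l) (high H k l)"
proof -
  let ?a = "low H k l" and ?b = "high H k l"
  have kl: "1 \<le> k" "k < l" "l \<le> N" and ab: "?a < ?b" using up by (auto simp: up_edge_def)
  note a = low_ge[of H k l] 
  have a_l: "H l \<le> ?a" by (rule low_ge(3))
  note Hj = high_le[of k _ l H]
  obtain i where i: "k \<le> i" "i < l" "H i = ?b" using high_attained[OF kl(2)] by blast
  have top: "in_cut H N x ?b" if "real k \<le> x" "x \<le> real l" for x
    using in_cutI[of k l N x H i] that kl i Hj a(1) ab by auto
  have bottom: "in_cut H N x ?a" if x: "real k \<le> x" "x \<le> real l" for x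
  proof -
    have Ha: "?a \<le> H j" if "k \<le> j" "j < l" for j using Hj[OF that] ab by simp
    \<comment> \<open>The bottom runs along the axis, along the segment of gap \<open>k - 1\<close>
      extended to the right, or along that of gap \<open>l\<close> extended to the left. For
      \<open>k = 1\<close> the second level is \<open>H 0 = 0\<close>.\<close>
    consider "?a = 0" | "?a = H (k - 1)" "k > 1" | "?a = H l"
      using low_cases[of H k l] H0 kl(1) by (cases "k = 1") auto
    then show ?thesis
    proof cases
      case 1
      then show ?thesis using x kl unfolding in_cut_def by auto
    next
      case 2
      have "in_cut H N x (H (k - 1))"
      proof (rule in_cutI[of "k - 1" l])
        show "H (k - 1) \<le> H j" if "k - 1 \<le> j" "j < l" for j
          using that Ha[of j] 2 by (cases "j = k - 1") auto
      qed (use 2 a(1) kl x in auto)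
      then show ?thesis using 2 by simp
    next
      case 3
      have "in_cut H N x (H l)"
      proof (rule in_cutI[of k "Suc l"])
        show "H l \<le> H j" if "k \<le> j" "j < Suc l" for j
          using that Ha[of j] 3 by (cases "j = l") auto
      qed (use 3 a(1) kl x in auto)
      then show ?thesis using 3 by simp
    qed
  qed
  have interior: "\<not> in_cut H N x h" if x: "real k < x" "x < real l" and h: "?a < h" "h < ?b" for x h
  proof
    assume "in_cut H N x h"
    moreover have "0 < h" using a(1) h by simp
    ultimately obtain i where i: "H i = h" "\<And>j. \<lbrakk>i \<le> j; real j + 1/2 \<le> x\<rbrakk> \<Longrightarrow> h \<le> H j"
      "\<And>j. \<lbrakk>j \<le> i; x \<le> real j + 1/2\<rbrakk> \<Longrightarrow> h \<le> H j"
      by (metis in_cutE)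
    have "\<not> i < k"
    proof
      assume "i < k"
      then have "i \<le> k - 1" by simp
      then show False using i(2)[of "k - 1"] a(2) h(1) kl(1) x(1) by auto
    qed
    moreover have "\<not> l \<le> i"
      using i(3)[of l] a_l h(1) x(2) by auto
    ultimately show False using Hj[of i] i(1) h(2) by auto
  qed
  have region: "in_region H N x h" if "real k \<le> x" "x \<le> real l" "?a \<le> h" "h \<le> ?b" for x h
    using that kl a(1) Hj by (intro in_regionI[of k l]) (auto intro: order_trans)
  have "?b \<le> H k" "?b \<le> H (l - 1)" using Hj kl by auto
  then show ?thesis
    unfolding is_rect_def using kl ab a a_l top bottom interior region by auto
qed

definition up_rect :: "(nat \<Rightarrow> real) \<Rightarrow> nat \<Rightarrow> nat \<Rightarrow> rect" where
  "up_rect H k l = Rect k l (low H k l) (high H k l)"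

definition down_rect :: "(nat \<Rightarrow> real) \<Rightarrow> nat \<Rightarrow> nat \<Rightarrow> rect" where
  "down_rect H k l = Rect k l (- high (\<lambda>i. - H i) k l) (- low (\<lambda>i. - H i) k l)"

text \<open>A rectangle has a positive top or a negative bottom, and negating the heights turns the
  second case into the first.\<close>

theorem rects_eq:
  fixes wt :: "'s \<Rightarrow> real" and P :: "'s list"
  defines "H \<equiv> height wt P" and "N \<equiv> length P"
  shows "rects wt P = {up_rect H k l |k l. up_edge H N k l} \<union>
     {down_rect H k l |k l. up_edge (\<lambda>i. - H i) N k l}"
proof (intro set_eqI iffI)
  fix r assume r: "r \<in> rects wt P"
  obtain k l a b where rkl: "r = Rect k l a b" by (cases r)
  then have ir: "is_rect H N k l a b" using r rects_is_rect[of k l a b wt P] by (simp add: H_def N_def)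
  then have ir': "is_rect (\<lambda>i. - H i) N k l (- b) (- a)" by (rule is_rect_minus)
  have "a < b" using ir by (simp add: is_rect_def)
  then consider "0 < b" | "0 < - a" by linarith
  then show "r \<in> {up_rect H k l |k l. up_edge H N k l} \<union> {down_rect H k l |k l. up_edge (\<lambda>i. - H i) N k l}"
  proof cases
    case 1
    from is_rect_up[OF ir 1] show ?thesis using rkl by (auto simp: up_rect_def)
  next
    case 2
    from is_rect_up[OF ir' 2] have "up_edge (\<lambda>i. - H i) N k l" "r = down_rect H k l"
      using rkl by (auto simp: down_rect_def)
    then show ?thesis by blast
  qed
next
  have H0: "H 0 = 0" "- H 0 = 0" by (simp_all add: H_def height_def)
  fix r assume "r \<in> {up_rect H k l |k l. up_edge H N k l} \<union> {down_rect H k l |k l. up_edge (\<lambda>i. - H i) N k l}"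
  then consider k l where "r = up_rect H k l" "up_edge H N k l"
    | k l where "r = down_rect H k l" "up_edge (\<lambda>i. - H i) N k l" by blast
  then show "r \<in> rects wt P"
  proof cases
    case 1
    then show ?thesis
      using up_is_rect[OF 1(2) H0(1)] by (simp add: up_rect_def rects_is_rect H_def N_def)
  next
    case 2
    have "is_rect (\<lambda>i. - (- H i)) N k l (- high (\<lambda>i. - H i) k l) (- low (\<lambda>i. - H i) k l)"
      using up_is_rect[OF 2(2) H0(2)] by (rule is_rect_minus)
    then show ?thesis
      using 2 by (simp add: down_rect_def rects_is_rect H_def N_def)
  qed
qed

section \<open>Height functions of tree permutations\<close>

locale tree_heights =
  fixes H :: "nat \<Rightarrow> real" and N :: nat
  assumes H0: "H 0 = 0" and HN: "H N = 0"
    and nonzero: "\<lbrakk>1 \<le> i; i < N\<rbrakk> \<Longrightarrow> H i \<noteq> 0"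
    and step: "\<lbrakk>1 \<le> i; i \<le> N\<rbrakk> \<Longrightarrow> H (i - 1) \<noteq> H i"
    and sep_pos: "\<lbrakk>i < j; j \<le> N; H i = H j; 0 < H j\<rbrakk> \<Longrightarrow> \<exists>t. i < t \<and> t < j \<and> H t < H j"
    and sep_neg: "\<lbrakk>i < j; j \<le> N; H i = H j; H j < 0\<rbrakk> \<Longrightarrow> \<exists>t. i < t \<and> t < j \<and> H j < H t"
begin

lemma minus: "tree_heights (\<lambda>i. - H i) N"
  using H0 HN nonzero step sep_pos sep_neg by unfold_locales auto

text \<open>Extend the gap in both directions as long as the heights stay at least
  \<open>H i\<close>. The vertical lines that stop the extension bound the rectangle.\<close>

lemma gap_edge:
  assumes i: "1 \<le> i" "i < N" "0 < H i"
  shows "\<exists>k l. up_edge H N k l \<and> k \<le> i \<and> i < l \<and> high H k l = H i"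
proof -
  define m where "m = Max {j \<in> {0..i}. H j < H i}"
  have "0 \<in> {j \<in> {0..i}. H j < H i}" using i H0 by simp
  then have m: "m \<in> {j \<in> {0..i}. H j < H i}" unfolding m_def by (intro Max_in) auto
  have m_max: "j \<le> m" if "j \<le> i" "H j < H i" for j
    unfolding m_def using that by (intro Max_ge) auto
  define l where "l = (LEAST l. i < l \<and> H l < H i)"
  have "i < N \<and> H N < H i" using i HN by simp
  then have l: "i < l \<and> H l < H i" and lN: "l \<le> N"
    unfolding l_def by (rule LeastI, rule Least_le)
  have l_min: "\<not> H j < H i" if "i < j" "j < l" for j
    using not_less_Least that unfolding l_def by blast
  have "m \<noteq> i" using m by auto
  then have mi: "Suc m \<le> i" using m by auto
  have ge: "H i \<le> H j" if "Suc m \<le> j" "j < l" for j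
    using m_max[of j] l_min[of j] that by (cases "j \<le> i") force+
  have "high H (Suc m) l = H i"
    using high_le[OF mi, of l H] l high_greatest[of "Suc m" l "H i" H] ge mi by force
  moreover have "low H (Suc m) l < H i"
    using m l i by (simp add: low_def)
  ultimately have "up_edge H N (Suc m) l"
    using mi l lN by (simp add: up_edge_def)
  then show ?thesis using \<open>high H (Suc m) l = H i\<close> mi l by blast
qed

text \<open>Here the tree condition enters: two lowest gaps under one edge would be separated by a
  still lower gap.\<close>

lemma gap_unique:
  assumes up: "up_edge H N k l" and j: "k \<le> j" "j < l" "H j = high H k l"
    and j': "k \<le> j'" "j' < l" "H j' = high H k l"
  shows "j = j'"
proof -
  have False if ii: "i < i'" "k \<le> i" "i' < l" "H i = high H k l" "H i' = high H k l" for i i'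
  proof -
    have "0 < H i'" using up_edge_pos[OF up, of i'] that by simp
    moreover have "i' \<le> N" using up that by (simp add: up_edge_def)
    moreover have "H i = H i'" using that by simp
    ultimately obtain t where "i < t" "t < i'" "H t < H i'"
      using sep_pos[OF ii(1)] by blast
    then show False using high_le[of k t l H] that by simp
  qed
  then show ?thesis using j j' by (metis linorder_neqE_nat)
qed

text \<open>Induction from the highest gaps downwards. The edge over gap \<open>i\<close> joins
  \<open>k\<close> to \<open>l\<close>, and all other gaps under it are strictly higher, so
  \<open>k\<close> is joined to \<open>i\<close> and \<open>l\<close> to
  \<open>Suc i\<close>.\<close>

lemma gap_connected:
  assumes R: "sym R" "\<And>k l. up_edge H N k l \<Longrightarrow> (k, l) \<in> R"
    and i: "1 \<le> i" "i < N" "0 < H i"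
  shows "(i, Suc i) \<in> R\<^sup>*"
  using i
proof (induction "card {j \<in> {1..<N}. H i < H j}" arbitrary: i rule: less_induct)
  case (less i)
  obtain k l where kl: "up_edge H N k l" "k \<le> i" "i < l" "high H k l = H i"
    using gap_edge[OF less.prems] by blast
  have bounds: "1 \<le> k" "l \<le> N" using kl by (auto simp: up_edge_def)
  have gap: "(j, Suc j) \<in> R\<^sup>*" if j: "k \<le> j" "j < l" "j \<noteq> i" for j
  proof -
    have "H i \<le> H j" using high_le[OF j(1,2), of H] kl(4) by simp
    moreover have "H i \<noteq> H j" using gap_unique[OF kl(1-3) kl(4)[symmetric] j(1,2)] j(3) kl(4) by auto
    ultimately have ij: "H i < H j" by simp
    have "j \<in> {t \<in> {1..<N}. H i < H t}" "j \<notin> {t \<in> {1..<N}. H j < H t}"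
      using j bounds ij by simp_all
    moreover have "{t \<in> {1..<N}. H j < H t} \<subseteq> {t \<in> {1..<N}. H i < H t}"
      using ij by auto
    ultimately have "{t \<in> {1..<N}. H j < H t} \<subset> {t \<in> {1..<N}. H i < H t}" by blast
    then have "card {t \<in> {1..<N}. H j < H t} < card {t \<in> {1..<N}. H i < H t}"
      by (intro psubset_card_mono) auto
    then show ?thesis using less.hyps[of j] j bounds ij less.prems(3) by simp
  qed
  have chain: "(m, n) \<in> R\<^sup>*" if "m \<le> n" "\<And>j. m \<le> j \<Longrightarrow> j < n \<Longrightarrow> (j, Suc j) \<in> R\<^sup>*" for m n
    using that by (induction n rule: dec_induct) (auto intro: rtrancl_trans)
  have "(k, i) \<in> R\<^sup>*"
    by (rule chain[OF kl(2)], rule gap) (use kl(3) in simp_all)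
  then have "(i, k) \<in> R\<^sup>*" using R(1) by (rule sym_rtranclD[rotated])
  moreover have "(Suc i, l) \<in> R\<^sup>*"
    by (rule chain[OF Suc_leI[OF kl(3)]], rule gap) (use kl(2) in simp_all)
  then have "(l, Suc i) \<in> R\<^sup>*" using R(1) by (rule sym_rtranclD[rotated])
  moreover have "(k, l) \<in> R\<^sup>*" using R(2)[OF kl(1)] by simp
  ultimately show ?case by (meson rtrancl_trans)
qed

text \<open>The heights of the rectangles at a vertical line telescope.\<close>

lemma sum_right:
  assumes k: "1 \<le> k" "k \<le> N"
  shows "(\<Sum>l\<in>{Suc k..N}. max 0 (high H k l - low H k l)) =
    max (H k) (max 0 (H (k - 1))) - max 0 (H (k - 1))"
proof -
  let ?c = "max 0 (H (k - 1))"
  have "(\<Sum>l\<in>{Suc k..n}. max 0 (high H k l - low H k l)) = max (H k) ?c - max (high H k (Suc n)) ?c"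
    if "k \<le> n" for n
    using that
  proof (induction n rule: dec_induct)
    case base
    show ?case by (simp add: high_def)
  next
    case (step n)
    have "{k..<Suc (Suc n)} = insert (Suc n) {k..<Suc n}" using step by auto
    then have "high H k (Suc (Suc n)) = min (H (Suc n)) (high H k (Suc n))"
      using step unfolding high_def by simp
    then show ?case using step by (auto simp: low_def max_def min_def)
  qed
  \<comment> \<open>At the right end the running minimum includes \<open>H N = 0\<close>, so the
    telescoping sum goes all the way down to \<open>?c\<close>.\<close>
  moreover have "high H k (Suc N) \<le> 0"
    using high_le[of k N "Suc N" H] k HN by simp
  ultimately show ?thesis using k by auto
qed

lemma sum_left:
  assumes l: "1 \<le> l"
  shows "(\<Sum>k\<in>{1..<l}. max 0 (high H k l - low H k l)) = max (H (l - 1)) (max 0 (H l)) - max 0 (H l)"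
proof -
  let ?c = "max 0 (H l)"
  have "(\<Sum>k\<in>{Suc n..<l}. max 0 (high H k l - low H k l)) = max (H (l - 1)) ?c - max (high H n l) ?c"
    if "n \<le> l - 1" for n
    using that
  proof (induction n rule: inc_induct)
    case base
    have "{l - 1..<l} = {l - 1}" using l by auto
    then show ?case using l by (simp add: high_def)
  next
    case (step n)
    have "{n..<l} = insert n {Suc n..<l}" using step by auto
    then have "high H n l = min (H n) (high H (Suc n) l)"
      using step l unfolding high_def by simp
    moreover have "{Suc n..<l} = insert (Suc n) {Suc (Suc n)..<l}" using step by auto
    ultimately show ?case using step by (auto simp: low_def max_def min_def)
  qed
  from this[of 0] show ?thesis
    using high_le[of 0 0 l H] H0 l by (auto simp: max_def)
qed

end

section \<open>Relative position of two rectangles\<close>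

lemma high_le_pred: "k < m \<Longrightarrow> m \<le> l \<Longrightarrow> high H k l \<le> H (m - 1)"
  by (rule high_le) auto

text \<open>If one edge began later, the height just before it would be at least the common minimum,
  as a gap under the other edge, and less than it, as a gap just outside its own. The same happens
  at the right ends.\<close>

lemma up_edge_determined:
  assumes up: "up_edge H N k l" "up_edge H N k' l'"
    and j: "k \<le> j" "j < l" "H j = high H k l" "k' \<le> j" "j < l'" "H j = high H k' l'"
  shows "k = k' \<and> l = l'"
proof -
  have "\<not> k < k' \<and> \<not> l < l'" if up: "up_edge H N k l" "up_edge H N k' l'"
    and j: "k \<le> j" "j < l" "H j = high H k l" "k' \<le> j" "j < l'" "H j = high H k' l'" for k l k' l'
    using high_le_pred[of k k' l H] low_ge(2)[of H k' l'] high_le[of k' l l' H] low_ge(3)[of H l k] up j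
    by (auto simp: up_edge_def)
  from this[OF up j] this[OF up(2,1) j(4-6,1-3)] show ?thesis by simp
qed

lemma up_edge_ends:
  assumes "up_edge H N k l" shows "H (k - 1) < H k" "H l < H (l - 1)"
proof -
  have kl: "k < l" "low H k l < high H k l" using assms by (auto simp: up_edge_def)
  show "H (k - 1) < H k"
    using high_le[OF order_refl kl(1), of H] low_ge(2)[of H k l] kl(2) by linarith
  show "H l < H (l - 1)"
    using high_le_pred[OF kl(1) order_refl, of H] low_ge(3)[of H l k] kl(2) by linarith
qed

text \<open>Gap \<open>l\<close> is under the longer edge and just outside the shorter one, so
  \<open>H l\<close> separates the two rectangles.\<close>

lemma up_edge_right_mono:
  assumes "up_edge H N i l" "up_edge H N i l'" "l < l'"
  shows "high H i l' \<le> low H i l"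
  using high_le[of i l l' H] low_ge(3)[of H l i] assms by (auto simp: up_edge_def)

lemma up_edge_left_mono:
  assumes "up_edge H N k i" "up_edge H N k' i" "k < k'"
  shows "high H k i \<le> low H k' i"
  using high_le_pred[of k k' i H] low_ge(2)[of H k' i] assms by (auto simp: up_edge_def)

text \<open>Of \<open>H (k' - 1)\<close> and \<open>H l\<close>, each belongs to a gap under one
  edge and just outside the other, so each would be smaller than the other.\<close>

lemma up_edge_no_cross:
  assumes "up_edge H N k l" "up_edge H N k' l'" "k < k'" "k' < l" "l < l'"
  shows False
  using high_le[of k' l l' H] high_le_pred[of k k' l H] low_ge(3)[of H l k] low_ge(2)[of H k' l'] assms
  by (auto simp: up_edge_def)

lemma (in linorder) sorted_key_list_of_finite_set:
  fixes f :: "'b \<Rightarrow> 'a"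
  assumes "finite X" "inj_on f X"
  shows "set (sorted_key_list_of_set f X) = X" "sorted_wrt (\<lambda>x y. f x < f y) (sorted_key_list_of_set f X)"
    "distinct (sorted_key_list_of_set f X)"
proof -
  interpret folding_insort_key "(\<le>)" "(<)" X f
    using assms(2) by unfold_locales
  show "set (sorted_key_list_of_set f X) = X"
    using assms(1) by simp
  show "sorted_wrt (\<lambda>x y. f x < f y) (sorted_key_list_of_set f X)"
    using strict_sorted_key_list_of_set[OF subset_refl] by (simp add: sorted_wrt_map)
  show "distinct (sorted_key_list_of_set f X)"
    using distinct_sorted_key_list_of_set[OF subset_refl] by (simp add: distinct_map)
qed

section \<open>The combed graph is a tree\<close>

lemma height_Suc: "height wt P (Suc i) = height wt P i + wt (P ! i)"
  by (simp add: height_def)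

lemma tree_permutations_iff:
  assumes fp: "full_passport S wt" and P: "P \<in> permutations_of_set S"
  shows "P \<in> tree_permutations S wt \<longleftrightarrow> tree_heights (height wt P) (card S)"
proof -
  let ?H = "height wt P" and ?N = "card S"
  have set: "set P = S" "distinct P" using P by (auto simp: permutations_of_set_def)
  then have len: "length P = ?N" using distinct_card by fastforce
  have H0: "?H 0 = 0" by (simp add: height_def)
  have "?H ?N = (\<Sum>i<?N. wt (P ! i))"
    unfolding height_def by (simp add: sum.atLeast1_atMost_eq)
  also have "\<dots> = sum_list (map wt P)"
    by (simp add: sum_list_sum_nth len atLeast0LessThan)
  also have "\<dots> = 0"
    using fp set by (simp add: sum_list_distinct_conv_sum_set full_passport_def)
  finally have HN: "?H ?N = 0" .
  have step: "?H (i - 1) \<noteq> ?H i" if "1 \<le> i" "i \<le> ?N" for i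
  proof -
    have "P ! (i - 1) \<in> S" using that len set by auto
    then show ?thesis
      using fp height_Suc[of wt P "i - 1"] that by (simp add: full_passport_def)
  qed
  \<comment> \<open>Consecutive heights differ, so equal heights are at least two gaps apart and
    \<open>Min\<close> and \<open>Max\<close> are taken over nonempty sets.\<close>
  have range: "{i + 1..j - 1} = {i<..<j}" "{i + 1..j - 1} \<noteq> {}" if "i < j" "j \<le> ?N" "?H i = ?H j" for i j
  proof -
    show "{i + 1..j - 1} = {i<..<j}" using that by auto
    have "i + 1 \<noteq> j" using step[of j] that by auto
    then show "{i + 1..j - 1} \<noteq> {}" using that by auto
  qed
  have Min: "Min (?H ` {i + 1..j - 1}) < c \<longleftrightarrow> (\<exists>t. i < t \<and> t < j \<and> ?H t < c)"
    if "i < j" "j \<le> ?N" "?H i = ?H j" for i j c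
    using range[OF that] by (subst Min_less_iff) auto
  have Max: "Max (?H ` {i + 1..j - 1}) > c \<longleftrightarrow> (\<exists>t. i < t \<and> t < j \<and> ?H t > c)"
    if "i < j" "j \<le> ?N" "?H i = ?H j" for i j c
    using range[OF that] by (subst Max_gr_iff) auto
  show ?thesis
  proof
    assume "P \<in> tree_permutations S wt"
    then have nz: "\<And>i. 1 \<le> i \<Longrightarrow> i \<le> ?N - 1 \<Longrightarrow> ?H i \<noteq> 0"
      and pos: "\<And>k l. 1 \<le> k \<Longrightarrow> k < l \<Longrightarrow> l \<le> ?N \<Longrightarrow> ?H (k - 1) = ?H l \<Longrightarrow> ?H l > 0 \<Longrightarrow>
        Min (?H ` {k..l - 1}) < ?H (k - 1)"
      and neg: "\<And>k l. 1 \<le> k \<Longrightarrow> k < l \<Longrightarrow> l \<le> ?N \<Longrightarrow> ?H (k - 1) = ?H l \<Longrightarrow> ?H l < 0 \<Longrightarrow>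
        Max (?H ` {k..l - 1}) > ?H (k - 1)"
      by (auto simp: tree_permutations_def)
    have lt: "i + 1 < j" if "i < j" "j \<le> ?N" "?H i = ?H j" for i j
      using range(2)[OF that] by auto
    show "tree_heights ?H ?N"
    proof (unfold_locales)
      fix i j assume ij: "i < j" "j \<le> ?N" "?H i = ?H j"
      show "\<exists>t. i < t \<and> t < j \<and> ?H t < ?H j" if "0 < ?H j"
        using pos[of "i + 1" j] Min[OF ij] lt[OF ij] ij that by simp
      show "\<exists>t. i < t \<and> t < j \<and> ?H j < ?H t" if "?H j < 0"
        using neg[of "i + 1" j] Max[OF ij] lt[OF ij] ij that by simp
    qed (use H0 HN step nz in auto)
  next
    assume "tree_heights ?H ?N"
    then interpret tree_heights ?H ?N .
    have "Min (?H ` {k..l - 1}) < ?H (k - 1)"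
      if "1 \<le> k" "k < l" "l \<le> ?N" "?H (k - 1) = ?H l" "?H l > 0" for k l
      using Min[of "k - 1" l] sep_pos[of "k - 1" l] that by simp
    moreover have "Max (?H ` {k..l - 1}) > ?H (k - 1)"
      if "1 \<le> k" "k < l" "l \<le> ?N" "?H (k - 1) = ?H l" "?H l < 0" for k l
      using Max[of "k - 1" l] sep_neg[of "k - 1" l] that by simp
    ultimately show "P \<in> tree_permutations S wt"
      using P nonzero unfolding tree_permutations_def by auto
  qed
qed

text \<open>Rectangles at a vertical line are sorted by real heights, compatibility is stated with
  integer keys. Monotonicity translates one into the other.\<close>

lemma sorted_by_key:
  fixes f :: "'a \<Rightarrow> 'b::linorder" and \<kappa> :: "'a \<Rightarrow> int"
  assumes fin: "finite X" and inj: "inj_on \<kappa> X"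
    and mono: "\<And>r r'. \<lbrakk>r \<in> X; r' \<in> X; \<kappa> r < \<kappa> r'\<rbrakk> \<Longrightarrow> f r < f r'"
  shows "set (sorted_key_list_of_set f X) = X" "distinct (sorted_key_list_of_set f X)"
    "sorted_wrt (\<lambda>r r'. \<kappa> r < \<kappa> r') (sorted_key_list_of_set f X)"
proof -
  have inj_f: "inj_on f X"
  proof (rule inj_onI)
    fix r r' assume "r \<in> X" "r' \<in> X" "f r = f r'"
    then have "\<kappa> r = \<kappa> r'" using mono[of r r'] mono[of r' r] by force
    then show "r = r'" using inj \<open>r \<in> X\<close> \<open>r' \<in> X\<close> by (meson inj_onD)
  qed
  note srt = sorted_key_list_of_finite_set[OF fin inj_f]
  show "set (sorted_key_list_of_set f X) = X" "distinct (sorted_key_list_of_set f X)"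
    by (rule srt)+
  show "sorted_wrt (\<lambda>r r'. \<kappa> r < \<kappa> r') (sorted_key_list_of_set f X)"
  proof (rule sorted_wrt_mono_rel[OF _ srt(2)])
    fix r r' assume *: "r \<in> set (sorted_key_list_of_set f X)" "r' \<in> set (sorted_key_list_of_set f X)" "f r < f r'"
    then have "\<kappa> r \<noteq> \<kappa> r'" "\<not> \<kappa> r' < \<kappa> r"
      using inj mono[of r' r] unfolding srt(1) by (auto dest: inj_onD)
    then show "\<kappa> r < \<kappa> r'" by simp
  qed
qed

lemma sorted_by_key_rev:
  fixes f :: "'a \<Rightarrow> 'b::linorder" and \<kappa> :: "'a \<Rightarrow> int"
  assumes fin: "finite X" and inj: "inj_on \<kappa> X"
    and anti: "\<And>r r'. \<lbrakk>r \<in> X; r' \<in> X; \<kappa> r < \<kappa> r'\<rbrakk> \<Longrightarrow> f r' < f r"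
  shows "set (sorted_key_list_of_set f X) = X" "distinct (sorted_key_list_of_set f X)"
    "sorted_wrt (\<lambda>r r'. \<kappa> r < \<kappa> r') (rev (sorted_key_list_of_set f X))"
  using sorted_by_key[of X "\<lambda>r. - \<kappa> r" f] assms by (auto simp: inj_on_def sorted_wrt_rev)

section \<open>The graph of a tree permutation\<close>

locale combing =
  fixes S :: "'s set" and wt :: "'s \<Rightarrow> real" and P :: "'s list"
  assumes fp: "full_passport S wt" and card_S: "2 \<le> card S" and P: "P \<in> tree_permutations S wt"
begin

abbreviation "H \<equiv> height wt P"
abbreviation "N \<equiv> length P"
abbreviation "G \<equiv> comb_graph wt P"
abbreviation "black i \<equiv> wt (P ! (i - 1)) > 0"

lemma perm: "P \<in> permutations_of_set S"
  using P by (simp add: tree_permutations_def)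

lemma P_set: "set P = S" "distinct P"
  using perm by (auto simp: permutations_of_set_def)

lemma N_card: "N = card S"
  using distinct_card[OF P_set(2)] P_set(1) by simp

sublocale up: tree_heights H N
  using tree_permutations_iff[OF fp perm] P N_card by simp

sublocale down: tree_heights "\<lambda>i. - H i" N
  by (rule up.minus)

lemma height_step: "1 \<le> i \<Longrightarrow> H i = H (i - 1) + wt (P ! (i - 1))"
  using height_Suc[of wt P "i - 1"] by simp

lemma wt_nonzero: "1 \<le> i \<Longrightarrow> i \<le> N \<Longrightarrow> wt (P ! (i - 1)) \<noteq> 0"
  using height_step[of i] up.step[of i] by auto

lemma up_black: "up_edge H N k l \<Longrightarrow> black k \<and> wt (P ! (l - 1)) < 0"
  using up_edge_ends[of H N k l] height_step[of k] height_step[of l] by (auto simp: up_edge_def)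

lemma down_black: "up_edge (\<lambda>i. - H i) N k l \<Longrightarrow> wt (P ! (k - 1)) < 0 \<and> black l"
  using up_edge_ends[of "\<lambda>i. - H i" N k l] height_step[of k] height_step[of l] by (auto simp: up_edge_def)

lemma rect_cases:
  assumes "r \<in> rects wt P"
  obtains (up) k l where "r = up_rect H k l" "up_edge H N k l" "rect_left r = k" "rect_right r = l"
    "rect_bot r = low H k l" "rect_top r = high H k l"
  | (down) k l where "r = down_rect H k l" "up_edge (\<lambda>i. - H i) N k l" "rect_left r = k" "rect_right r = l"
    "rect_bot r = - high (\<lambda>i. - H i) k l" "rect_top r = - low (\<lambda>i. - H i) k l"
proof -
  have "r \<in> {up_rect H k l |k l. up_edge H N k l} \<union> {down_rect H k l |k l. up_edge (\<lambda>i. - H i) N k l}"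
    using assms by (simp add: rects_eq)
  then show thesis using that by (auto simp: up_rect_def down_rect_def)
qed

lemma up_rect_mem: "up_edge H N k l \<Longrightarrow> up_rect H k l \<in> rects wt P"
  by (auto simp: rects_eq)

lemma down_rect_mem: "up_edge (\<lambda>i. - H i) N k l \<Longrightarrow> down_rect H k l \<in> rects wt P"
  by (auto simp: rects_eq)

lemma rect_bounds:
  assumes "r \<in> rects wt P"
  shows "1 \<le> rect_left r" "rect_left r < rect_right r" "rect_right r \<le> N" "rect_bot r < rect_top r"
    "wt (P ! (rect_left r - 1)) * wt (P ! (rect_right r - 1)) < 0"
  using assms by (cases rule: rect_cases;
    use up_black down_black in \<open>force simp: up_edge_def mult_pos_neg mult_neg_pos\<close>)+

lemma rect_eqI:
  assumes "r \<in> rects wt P" "r' \<in> rects wt P" "rect_left r = rect_left r'" "rect_right r = rect_right r'"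
  shows "r = r'"
proof -
  have False if "up_edge H N k l" "up_edge (\<lambda>i. - H i) N k l" for k l
    using up_edge_pos[OF that(1), of k] up_edge_pos[OF that(2), of k] that(1) by (simp add: up_edge_def)
  then show ?thesis
    using assms by (elim rect_cases) auto
qed

lemma finite_rects: "finite (rects wt P)"
proof (rule finite_imageD)
  show "finite ((\<lambda>r. (rect_left r, rect_right r)) ` rects wt P)"
    by (rule finite_subset[of _ "{0..N} \<times> {0..N}"]) (use rect_bounds in force)+
  show "inj_on (\<lambda>r. (rect_left r, rect_right r)) (rects wt P)"
    by (rule inj_onI) (auto intro: rect_eqI)
qed

text \<open>Assign to each rectangle a gap under it whose height is closest to 0. By
  \<open>up_edge_determined\<close> no gap is assigned twice, and there are \<open>N - 1\<close>
  gaps.\<close>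

lemma card_rects: "card (rects wt P) + 1 \<le> N"
proof -
  define g where "g r j \<longleftrightarrow> rect_left r \<le> j \<and> j < rect_right r \<and>
      (0 < H j \<and> H j = rect_top r \<or> H j < 0 \<and> H j = rect_bot r)" for r j
  have "\<exists>j. g r j" if "r \<in> rects wt P" for r
    using that
  proof (cases rule: rect_cases)
    case (up k l)
    then obtain j where "k \<le> j" "j < l" "H j = high H k l"
      using high_attained[of k l H] by (auto simp: up_edge_def)
    then show ?thesis using up up_edge_pos[OF up(2), of j] unfolding g_def by auto
  next
    case (down k l)
    then obtain j where "k \<le> j" "j < l" "- H j = high (\<lambda>i. - H i) k l"
      using high_attained[of k l "\<lambda>i. - H i"] by (auto simp: up_edge_def)
    then show ?thesis using down up_edge_pos[OF down(2), of j] unfolding g_def by auto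
  qed
  then obtain f where f: "g r (f r)" if "r \<in> rects wt P" for r
    by metis
  have "inj_on f (rects wt P)"
  proof (rule inj_onI)
    fix r r' assume r: "r \<in> rects wt P" "r' \<in> rects wt P" "f r = f r'"
    have fr: "g r (f r)" "g r' (f r)" using f[OF r(1)] f[OF r(2)] r(3) by auto
    show "r = r'"
      using r(1,2) fr up_edge_determined[of H N _ _ _ _ "f r"]
        up_edge_determined[of "\<lambda>i. - H i" N _ _ _ _ "f r"]
        up_edge_pos[of H N _ _ "f r"] up_edge_pos[of "\<lambda>i. - H i" N _ _ "f r"]
      by (elim rect_cases) (fastforce simp: g_def)+
  qed
  moreover have "f ` rects wt P \<subseteq> {1..<N}"
    using f rect_bounds unfolding g_def by fastforce
  ultimately have "card (rects wt P) \<le> card {1..<N}"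
    by (rule card_inj_on_le) simp
  then show ?thesis using N_card card_S by simp
qed

lemma G_simps [simp]: "verts G = {1..N}" "lab G i = P ! (i - 1)" "edges G = rects wt P"
  "ends G r = {rect_left r, rect_right r}" "edge_wt G r = rect_top r - rect_bot r"
  "nxt G i = cycle_of_list (rects_around wt P i)"
  by (simp_all add: comb_graph_def)

lemma G_adj: "up_edge H N k l \<or> up_edge (\<lambda>i. - H i) N k l \<Longrightarrow> (k, l) \<in> adj G"
  using up_rect_mem down_rect_mem unfolding adj_def
  by (force simp: up_rect_def down_rect_def)

lemma adj_G_less:
  assumes "(k, l) \<in> adj G" "k < l"
  shows "(black k \<and> up_edge H N k l) \<or> (\<not> black k \<and> up_edge (\<lambda>i. - H i) N k l)"
proof -
  obtain r where r: "r \<in> rects wt P" "{rect_left r, rect_right r} = {k, l}"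
    using assms by (auto simp: adj_def)
  then have kl: "rect_left r = k" "rect_right r = l"
    using rect_bounds(2)[OF r(1)] assms(2) by (auto simp: doubleton_eq_iff)
  from r(1) show ?thesis
    using kl up_black down_black by (cases rule: rect_cases) (auto dest: less_not_sym)
qed

lemma G_connected: "connected_graph G"
proof -
  have sym: "sym (adj G)" by (auto intro: symI adj_sym)
  have gap: "(i, Suc i) \<in> (adj G)\<^sup>*" if i: "1 \<le> i" "i < N" for i
  proof (cases "0 < H i")
    case True
    then show ?thesis using up.gap_connected[OF sym _ i] G_adj by blast
  next
    case False
    then have "0 < - H i" using up.nonzero[OF i] by simp
    then show ?thesis using down.gap_connected[OF sym _ i] G_adj by blast
  qed
  have "(1, n) \<in> (adj G)\<^sup>*" if "1 \<le> n" "n \<le> N" for n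
    using that
  proof (induction n rule: dec_induct)
    case (step n)
    then show ?case using gap[of n] by (auto intro: rtrancl_trans)
  qed simp
  then have "(u, v) \<in> (adj G)\<^sup>*" if "u \<in> {1..N}" "v \<in> {1..N}" for u v
    using that by (meson atLeastAtMost_iff rtrancl_trans sym sym_rtranclD)
  then show ?thesis
    unfolding connected_graph_adj using N_card card_S by simp
qed

lemma incident_eq: "incident G v = {r \<in> rects wt P. rect_left r = v} \<union> {r \<in> rects wt P. rect_right r = v}"
  by (auto simp: incident_def)

lemma up_sum:
  assumes "tree_heights K N" "1 \<le> v" "v \<le> N"
  shows "(\<Sum>l | up_edge K N v l. high K v l - low K v l) + (\<Sum>k | up_edge K N k v. high K k v - low K k v) =
    \<bar>max 0 (K v) - max 0 (K (v - 1))\<bar>"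
proof -
  interpret tree_heights K N by fact
  have eq: "{l. up_edge K N v l} = {l \<in> {Suc v..N}. low K v l < high K v l}"
    using assms by (auto simp: up_edge_def)
  have "(\<Sum>l | up_edge K N v l. high K v l - low K v l) =
      (\<Sum>l\<in>{Suc v..N}. if low K v l < high K v l then high K v l - low K v l else 0)"
    unfolding eq by (rule sum.inter_filter) simp
  also have "\<dots> = (\<Sum>l\<in>{Suc v..N}. max 0 (high K v l - low K v l))"
    by (rule sum.cong) auto
  finally have r: "(\<Sum>l | up_edge K N v l. high K v l - low K v l) =
      max (K v) (max 0 (K (v - 1))) - max 0 (K (v - 1))"
    using sum_right[OF assms(2,3)] by simp
  have eq: "{k. up_edge K N k v} = {k \<in> {1..<v}. low K k v < high K k v}"
    using assms by (auto simp: up_edge_def)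
  have "(\<Sum>k | up_edge K N k v. high K k v - low K k v) =
      (\<Sum>k\<in>{1..<v}. if low K k v < high K k v then high K k v - low K k v else 0)"
    unfolding eq by (rule sum.inter_filter) simp
  also have "\<dots> = (\<Sum>k\<in>{1..<v}. max 0 (high K k v - low K k v))"
    by (rule sum.cong) auto
  finally have l: "(\<Sum>k | up_edge K N k v. high K k v - low K k v) =
      max (K (v - 1)) (max 0 (K v)) - max 0 (K v)"
    using sum_left[OF assms(2)] by simp
  show ?thesis unfolding r l by (auto simp: max_def)
qed

lemma finite_up_edges: "finite {l. up_edge K N v l}" "finite {k. up_edge K N k v}"
  by (rule finite_subset[of _ "{0..N}"]; force simp: up_edge_def)+

text \<open>The axis divides the vertical line from \<open>H (v - 1)\<close> to \<open>H v\<close>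
  into a part above and a part below. \<open>up_sum\<close> shows that the rectangles attached to
  each part have its length as total height.\<close>

lemma G_vertex_sum:
  assumes v: "1 \<le> v" "v \<le> N"
  shows "(\<Sum>r\<in>incident G v. rect_top r - rect_bot r) = \<bar>wt (P ! (v - 1))\<bar>"
proof -
  let ?K = "\<lambda>i. - H i" and ?h = "\<lambda>r. rect_top r - rect_bot r"
  define UR UL DR DL where "UR = up_rect H v ` {l. up_edge H N v l}"
    and "UL = (\<lambda>k. up_rect H k v) ` {k. up_edge H N k v}"
    and "DR = down_rect H v ` {l. up_edge ?K N v l}"
    and "DL = (\<lambda>k. down_rect H k v) ` {k. up_edge ?K N k v}"
  note defs = UR_def UL_def DR_def DL_def
  have "incident G v = (UR \<union> UL) \<union> (DR \<union> DL)"
  proof (intro set_eqI iffI)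
    fix r assume r: "r \<in> incident G v"
    then have "r \<in> rects wt P" "rect_left r = v \<or> rect_right r = v" by (auto simp: incident_eq)
    then show "r \<in> (UR \<union> UL) \<union> (DR \<union> DL)" unfolding defs by (elim rect_cases) auto
  next
    fix r assume "r \<in> (UR \<union> UL) \<union> (DR \<union> DL)"
    then show "r \<in> incident G v"
      unfolding defs incident_eq using up_rect_mem down_rect_mem
      by (auto simp: up_rect_def down_rect_def)
  qed
  moreover have fin: "finite UR" "finite UL" "finite DR" "finite DL"
    unfolding defs using finite_up_edges by auto
  moreover have "UR \<inter> UL = {}" "DR \<inter> DL = {}"
    unfolding defs by (auto simp: up_rect_def down_rect_def up_edge_def)
  moreover have "0 < rect_top r" if "r \<in> UR \<union> UL" for r
    using that unfolding defs
    by (auto simp: up_rect_def up_edge_def intro: le_less_trans[OF low_ge(1)])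
  moreover have "rect_top r \<le> 0" if "r \<in> DR \<union> DL" for r
    using that low_ge(1)[of ?K] unfolding defs by (auto simp: down_rect_def)
  moreover have "(UR \<union> UL) \<inter> (DR \<union> DL) = {}"
    using calculation(8,9) by (meson disjoint_iff not_less)
  ultimately have "sum ?h (incident G v) = (sum ?h UR + sum ?h UL) + (sum ?h DR + sum ?h DL)"
    by (simp add: sum.union_disjoint)
  also have "sum ?h UR = (\<Sum>l | up_edge H N v l. high H v l - low H v l)"
    unfolding UR_def by (subst sum.reindex) (auto simp: inj_on_def up_rect_def)
  also have "sum ?h UL = (\<Sum>k | up_edge H N k v. high H k v - low H k v)"
    unfolding UL_def by (subst sum.reindex) (auto simp: inj_on_def up_rect_def)
  also have "sum ?h DR = (\<Sum>l | up_edge ?K N v l. high ?K v l - low ?K v l)"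
    unfolding DR_def by (subst sum.reindex) (auto simp: inj_on_def down_rect_def)
  also have "sum ?h DL = (\<Sum>k | up_edge ?K N k v. high ?K k v - low ?K k v)"
    unfolding DL_def by (subst sum.reindex) (auto simp: inj_on_def down_rect_def)
  finally have "sum ?h (incident G v) = \<bar>max 0 (H v) - max 0 (H (v - 1))\<bar> + \<bar>max 0 (- H v) - max 0 (- H (v - 1))\<bar>"
    using up_sum[OF up.tree_heights_axioms v] up_sum[OF down.tree_heights_axioms v] by simp
  also have "\<dots> = \<bar>H v - H (v - 1)\<bar>" by (auto simp: max_def)
  also have "\<dots> = \<bar>wt (P ! (v - 1))\<bar>" using height_step[OF v(1)] by simp
  finally show ?thesis .
qed

abbreviation "right_rects v \<equiv> {r \<in> rects wt P. rect_left r = v}"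
abbreviation "left_rects v \<equiv> {r \<in> rects wt P. rect_right r = v}"

text \<open>The explicit form of \<open>edge_key\<close> for the identity order (see
  \<open>edge_key_G\<close>), available before the graph is known to be a tree.\<close>

definition key :: "nat \<Rightarrow> rect \<Rightarrow> int" where
  "key v r = (if rect_left r = v then (if black v then - int (rect_right r) else int (rect_right r))
     else (if black v then int (rect_left r) else - int (rect_left r)))"

text \<open>At a black vertex the right rectangles are above the axis and the longer ones lie lower;
  at a white vertex they are below the axis and the longer ones lie higher.\<close>

lemma right_order:
  assumes r: "r \<in> right_rects v" "r' \<in> right_rects v" and less: "key v r < key v r'"
  shows "rect_bot r < rect_bot r'"
proof (cases "black v")
  case True
  obtain l where l: "up_edge H N v l" "rect_right r = l" "rect_bot r = low H v l"
    using r(1) True down_black by (auto elim!: rect_cases dest: less_not_sym)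
  obtain l' where l': "up_edge H N v l'" "rect_right r' = l'" "rect_bot r' = low H v l'"
    using r(2) True down_black by (auto elim!: rect_cases dest: less_not_sym)
  have "l' < l" using less r True l l' by (simp add: key_def)
  from up_edge_right_mono[OF l'(1) l(1) this] show ?thesis
    using l l' by (simp add: up_edge_def)
next
  case False
  obtain l where l: "up_edge (\<lambda>i. - H i) N v l" "rect_right r = l" "rect_bot r = - high (\<lambda>i. - H i) v l"
    using r(1) False up_black by (auto elim!: rect_cases)
  obtain l' where l': "up_edge (\<lambda>i. - H i) N v l'" "rect_right r' = l'" "rect_bot r' = - high (\<lambda>i. - H i) v l'"
    using r(2) False up_black by (auto elim!: rect_cases)
  have "l < l'" using less r False l l' by (simp add: key_def)
  from up_edge_right_mono[OF l(1) l'(1) this] show ?thesis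
    using l l' by (simp add: up_edge_def)
qed

lemma left_order:
  assumes r: "r \<in> left_rects v" "r' \<in> left_rects v" and less: "key v r < key v r'"
  shows "rect_bot r' < rect_bot r"
proof -
  have ne: "rect_left r \<noteq> v" "rect_left r' \<noteq> v"
    using r rect_bounds(2)[of r] rect_bounds(2)[of r'] by auto
  show ?thesis
  proof (cases "black v")
    case True
    obtain k where k: "up_edge (\<lambda>i. - H i) N k v" "rect_left r = k" "rect_bot r = - high (\<lambda>i. - H i) k v"
      using r(1) True up_black by (auto elim!: rect_cases dest: less_not_sym)
    obtain k' where k': "up_edge (\<lambda>i. - H i) N k' v" "rect_left r' = k'" "rect_bot r' = - high (\<lambda>i. - H i) k' v"
      using r(2) True up_black by (auto elim!: rect_cases dest: less_not_sym)
    have "k < k'" using less ne True k k' by (simp add: key_def)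
    from up_edge_left_mono[OF k(1) k'(1) this] show ?thesis
      using k k' by (simp add: up_edge_def)
  next
    case False
    obtain k where k: "up_edge H N k v" "rect_left r = k" "rect_bot r = low H k v"
      using r(1) False down_black by (auto elim!: rect_cases)
    obtain k' where k': "up_edge H N k' v" "rect_left r' = k'" "rect_bot r' = low H k' v"
      using r(2) False down_black by (auto elim!: rect_cases)
    have "k' < k" using less ne False k k' by (simp add: key_def)
    from up_edge_left_mono[OF k'(1) k(1) this] show ?thesis
      using k k' by (simp add: up_edge_def)
  qed
qed

lemma rects_around_props:
  "set (rects_around wt P v) = incident G v" "distinct (rects_around wt P v)"
  "cyc_next (cycle_of_list (rects_around wt P v)) (incident G v) (key v)"
proof -
  let ?R = "sorted_key_list_of_set rect_bot (right_rects v)"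
    and ?L = "sorted_key_list_of_set rect_bot (left_rects v)"
  have ne: "rect_left r \<noteq> v" if "r \<in> left_rects v" for r
    using that rect_bounds(2)[of r] by auto
  have fin: "finite (right_rects v)" "finite (left_rects v)" using finite_rects by auto
  have inj_R: "inj_on (key v) (right_rects v)"
    by (rule inj_onI) (auto simp: key_def intro: rect_eqI split: if_splits)
  note R = sorted_by_key[where f = rect_bot, OF fin(1) inj_R right_order[of _ v]]
  have inj_L: "inj_on (key v) (left_rects v)"
  proof (rule inj_onI)
    fix r r' assume r: "r \<in> left_rects v" "r' \<in> left_rects v" "key v r = key v r'"
    then have "rect_left r = rect_left r'" using ne by (auto simp: key_def split: if_splits)
    then show "r = r'" using r by (intro rect_eqI) auto
  qed
  note L = sorted_by_key_rev[where f = rect_bot, OF fin(2) inj_L left_order[of _ v]]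
  have around: "rects_around wt P v = ?R @ rev ?L" by (simp add: rects_around_def)
  show set: "set (rects_around wt P v) = incident G v"
    unfolding around using R(1) L(1) by (simp add: incident_eq)
  show dist: "distinct (rects_around wt P v)"
    unfolding around using R(1,2) L(1,2) ne by auto
  show "cyc_next (cycle_of_list (rects_around wt P v)) (incident G v) (key v)"
  proof (cases "black v")
    case True
    have "key v r < key v r'" if "r \<in> right_rects v" "r' \<in> left_rects v" for r r'
      using True that ne[OF that(2)] rect_bounds(2)[of r] by (simp add: key_def)
    then have "sorted_wrt (\<lambda>r r'. key v r < key v r') (?R @ rev ?L)"
      unfolding sorted_wrt_append using R(1,3) L(1,3) by auto
    then show ?thesis
      using cyc_next_list[of "?R @ rev ?L" "key v"] dist set unfolding around by simp
  next
    case False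
    have "key v r' < key v r" if "r \<in> right_rects v" "r' \<in> left_rects v" for r r'
      using False that ne[OF that(2)] rect_bounds(2)[of r] by (simp add: key_def)
    \<comment> \<open>At a white vertex the keys of the left rectangles are negative, so the sorted
      list starts with them.\<close>
    then have "sorted_wrt (\<lambda>r r'. key v r < key v r') (rev ?L @ ?R)"
      unfolding sorted_wrt_append using R(1,3) L(1,3) by auto
    then show ?thesis
      using cyc_next_rotate[of ?R "rev ?L" "key v"] dist set unfolding around by simp
  qed
qed

theorem comb_graph_tree: "lwbp_tree S wt G"
  unfolding lwbp_tree_def
proof (intro conjI ballI)
  have "bij_betw (\<lambda>i. P ! (i - 1)) {1..N} S"
  proof (rule bij_betw_trans[where f = "\<lambda>i. i - 1" and g = "\<lambda>i. P ! i", unfolded comp_def])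
    show "bij_betw (\<lambda>i. i - 1) {1..N} {..<N}"
      by (rule bij_betwI[where g = Suc]) auto
    show "bij_betw ((!) P) {..<N} S"
      using bij_betw_nth[OF P_set(2) refl refl] P_set(1) by simp
  qed
  then show "bij_betw (lab G) (verts G) S"
    by (simp add: comb_graph_def)
  show "finite (edges G)" using finite_rects by simp
  show "connected_graph G" by (rule G_connected)
  show "\<nexists>vs es. graph_cycle G vs es"
    using connected_acyclic[OF G_connected] finite_rects card_rects by simp
next
  fix e assume e: "e \<in> edges G"
  then have r: "e \<in> rects wt P" by simp
  note bd = rect_bounds[OF r]
  show "\<exists>b\<in>verts G. \<exists>w\<in>verts G. ends G e = {b, w} \<and> wt (lab G b) > 0 \<and> wt (lab G w) < 0"
  proof (cases "black (rect_left e)")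
    case True
    then have "wt (P ! (rect_right e - 1)) < 0" using bd(5) by (simp add: mult_less_0_iff)
    then show ?thesis using True bd by (intro bexI[of _ "rect_left e"] bexI[of _ "rect_right e"]) auto
  next
    case False
    then have "black (rect_right e)" "wt (P ! (rect_left e - 1)) < 0" using bd(5) by (auto simp: mult_less_0_iff)
    then show ?thesis using bd by (intro bexI[of _ "rect_right e"] bexI[of _ "rect_left e"]) auto
  qed
  show "edge_wt G e > 0" using bd by simp
next
  fix v assume "v \<in> verts G"
  then have v: "1 \<le> v" "v \<le> N" by auto
  show sum: "(\<Sum>e\<in>incident G v. edge_wt G e) = \<bar>wt (lab G v)\<bar>"
    using G_vertex_sum[OF v] by simp
  have "incident G v \<noteq> {}"
    using sum wt_nonzero[OF v] by auto
  then show "cyclic_on (nxt G v) (incident G v)"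
    using cyclic_on_cycle_of_list[OF rects_around_props(2), of v] unfolding rects_around_props(1)[of v, symmetric]
    by simp
qed

sublocale lw: lwbp S wt G
  using comb_graph_tree fp by unfold_locales (simp_all add: full_passport_def)

lemma edge_key_G:
  assumes "r \<in> incident G v" shows "lw.edge_key id v r = key v r"
proof -
  have r: "r \<in> rects wt P" using assms by (auto simp: incident_eq)
  have "lw.other v r = (if rect_left r = v then rect_right r else rect_left r)"
    using assms r by (intro lw.other_eqI) (auto simp: incident_eq)
  then show ?thesis
    using assms rect_bounds(2)[OF r] by (auto simp: lw.edge_key_def key_def vkey_def incident_eq)
qed

theorem comb_graph_compat: "lw.tree_compat id"
  unfolding lw.tree_compat_def
proof (intro conjI ballI)
  show "inj_on id (verts G)" by simp
  show "arcs_compat (adj G) (\<lambda>v. wt (lab G v) > 0) id"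
    unfolding arcs_compat_def
  proof (intro allI impI)
    fix x y u v assume xy: "(x, y) \<in> adj G" "id x < id y" and uv: "(u, v) \<in> adj G" "id u < id v"
    have disj: "y \<le> u \<or> v \<le> x" if "up_edge H N x y" "up_edge (\<lambda>i. - H i) N u v" for x y u v
    proof (rule ccontr)
      assume "\<not> (y \<le> u \<or> v \<le> x)"
      \<comment> \<open>\<open>max x u\<close> is a gap under both arcs, where the height would have
        both signs.\<close>
      then show False
        using up_edge_pos[OF that(1), of "max x u"] up_edge_pos[OF that(2), of "max x u"] that
        by (auto simp: up_edge_def)
    qed
    have e: "(black x \<and> up_edge H N x y) \<or> (\<not> black x \<and> up_edge (\<lambda>i. - H i) N x y)"
      "(black u \<and> up_edge H N u v) \<or> (\<not> black u \<and> up_edge (\<lambda>i. - H i) N u v)"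
      using adj_G_less xy uv by auto
    show "if wt (lab G x) > 0 \<longleftrightarrow> wt (lab G u) > 0 then \<not> (id x < id u \<and> id u < id y \<and> id y < id v)
      else id y \<le> id u \<or> id v \<le> id x"
      using e disj[of x y u v] disj[of u v x y] up_edge_no_cross[of H N x y u v]
        up_edge_no_cross[of "\<lambda>i. - H i" N x y u v] by auto
  qed
  fix v assume "v \<in> verts G"
  have "inj_on (lw.edge_key id v) (incident G v)"
    by (rule lw.edge_key_inj) simp
  then show "cyc_next (nxt G v) (incident G v) (lw.edge_key id v)"
    using cyc_next_transfer[OF rects_around_props(3)] edge_key_G by simp
qed

end

section \<open>Compatible orders are tree permutations\<close>

text \<open>
  A tree with a compatible vertex order, reduced to its arcs: \<open>H i\<close> is the signed weight of the
  arcs over the gap between \<open>i\<close> and \<open>i + 1\<close>.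
\<close>

locale arc_diagram =
  fixes E :: "'e set" and lo hi :: "'e \<Rightarrow> nat" and up :: "'e \<Rightarrow> bool" and w :: "'e \<Rightarrow> real"
    and N :: nat and H :: "nat \<Rightarrow> real"
  assumes finite_E: "finite E" and w_pos: "e \<in> E \<Longrightarrow> 0 < w e"
    and bounds: "e \<in> E \<Longrightarrow> 1 \<le> lo e \<and> lo e < hi e \<and> hi e \<le> N"
    and no_cross: "\<lbrakk>e \<in> E; f \<in> E; up e = up f; lo e < lo f; lo f < hi e; hi e < hi f\<rbrakk> \<Longrightarrow> False"
    and no_overlap: "\<lbrakk>e \<in> E; f \<in> E; up e \<noteq> up f\<rbrakk> \<Longrightarrow> hi e \<le> lo f \<or> hi f \<le> lo e"
    and no_touch: "\<lbrakk>e \<in> E; f \<in> E; up e = up f\<rbrakk> \<Longrightarrow> hi e \<noteq> lo f"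
    and simple: "\<lbrakk>e \<in> E; f \<in> E; lo e = lo f; hi e = hi f\<rbrakk> \<Longrightarrow> e = f"
    and connected: "\<lbrakk>1 \<le> k; k \<le> l; l \<le> N; k \<noteq> 1 \<or> l \<noteq> N\<rbrakk> \<Longrightarrow>
      \<exists>e\<in>E. (lo e \<in> {k..l}) \<noteq> (hi e \<in> {k..l})"
    and H: "i \<le> N \<Longrightarrow> H i = (\<Sum>e | e \<in> E \<and> lo e \<le> i \<and> i < hi e. if up e then w e else - w e)"
begin

lemma minus: "arc_diagram E lo hi (\<lambda>e. \<not> up e) w N (\<lambda>i. - H i)"
proof
  show "- H i = (\<Sum>e | e \<in> E \<and> lo e \<le> i \<and> i < hi e. if \<not> up e then w e else - w e)" if "i \<le> N" for i
    unfolding H[OF that] sum_negf[symmetric] by (rule sum.cong) auto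
  show "\<exists>e\<in>E. (lo e \<in> {k..l}) \<noteq> (hi e \<in> {k..l})" if "1 \<le> k" "k \<le> l" "l \<le> N" "k \<noteq> 1 \<or> l \<noteq> N" for k l
    using connected[OF that] .
qed (use finite_E w_pos bounds no_cross no_overlap no_touch simple in auto)

definition over :: "nat \<Rightarrow> 'e set" where
  "over i = {e \<in> E. lo e \<le> i \<and> i < hi e}"

lemma finite_over: "finite (over i)"
  using finite_E by (simp add: over_def)

lemma over_side: "\<lbrakk>e \<in> over i; f \<in> over i\<rbrakk> \<Longrightarrow> up e = up f"
  using no_overlap[of e f] by (fastforce simp: over_def)

lemma over_pos: "e \<in> over i \<Longrightarrow> 0 < w e"
  using w_pos by (simp add: over_def)

lemma over_N: "e \<in> over i \<Longrightarrow> 1 \<le> i \<and> i < N"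
  using bounds[of e] by (auto simp: over_def)

lemma H_over: "i \<le> N \<Longrightarrow> H i = (\<Sum>e\<in>over i. if up e then w e else - w e)"
  using H by (simp add: over_def)

lemma H_up:
  assumes "e \<in> over i" "up e" shows "H i = sum w (over i)" "0 < H i"
proof -
  have "i \<le> N" using over_N[OF assms(1)] by simp
  then show *: "H i = sum w (over i)"
    using over_side[OF assms(1)] assms(2) by (simp add: H_over)
  show "0 < H i"
    unfolding * using assms(1) over_pos finite_over by (intro sum_pos) auto
qed

lemma H_down:
  assumes "e \<in> over i" "\<not> up e" shows "H i < 0"
proof -
  interpret m: arc_diagram E lo hi "\<lambda>e. \<not> up e" w N "\<lambda>i. - H i" by (rule minus)
  show ?thesis using m.H_up(2)[of e i] assms unfolding m.over_def over_def by simp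
qed

lemma over_nonempty:
  assumes "1 \<le> i" "i < N" shows "over i \<noteq> {}"
proof -
  obtain e where e: "e \<in> E" "(lo e \<in> {1..i}) \<noteq> (hi e \<in> {1..i})"
    using connected[of 1 i] assms by auto
  then have "e \<in> over i" using bounds[OF e(1)] by (auto simp: over_def)
  then show ?thesis by blast
qed

lemma H_pos_up: "\<lbrakk>0 < H i; e \<in> over i\<rbrakk> \<Longrightarrow> up e"
  using H_down by force

lemma H_le:
  assumes "i \<le> N" "{e \<in> over i. up e} \<subseteq> X" "finite X" "X \<subseteq> E"
  shows "H i \<le> sum w X"
proof -
  have "H i \<le> (\<Sum>e\<in>over i. if up e then w e else 0)"
    unfolding H_over[OF assms(1)] by (rule sum_mono) (use over_pos in \<open>auto intro: less_imp_le\<close>)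
  also have "\<dots> = sum w {e \<in> over i. up e}"
    using finite_over by (simp add: sum.inter_filter)
  also have "\<dots> \<le> sum w X"
    using assms(2-4) w_pos by (intro sum_mono2) (auto intro: less_imp_le)
  finally show ?thesis .
qed

lemma H_0: "H 0 = 0" and H_N: "H N = 0"
proof -
  have "over 0 = {}" "over N = {}" using over_N by fastforce+
  then show "H 0 = 0" "H N = 0" by (simp_all add: H_over)
qed

lemma H_nonzero: "\<lbrakk>1 \<le> i; i < N\<rbrakk> \<Longrightarrow> H i \<noteq> 0"
  using over_nonempty[of i] H_up(2)[of _ i] H_down[of _ i] by force

text \<open>Some arc over gap \<open>i\<close> ends at a vertex \<open>t\<close> not after
  \<open>j\<close>. Otherwise the arcs over \<open>i\<close> are also over \<open>j\<close>, by
  equality of weights they are all of them, and no edge leaves the vertices from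
  \<open>i + 1\<close> to \<open>j\<close>. At gap \<open>t\<close> either the height is negative or
  the arcs are among those over \<open>i\<close>, without the one that has ended.\<close>

lemma separate:
  assumes ij: "i < j" "j \<le> N" "H i = H j" "0 < H j"
  shows "\<exists>t. i < t \<and> t < j \<and> H t < H j"
proof -
  have "i \<noteq> 0" "j \<noteq> N" using ij(3,4) H_0 H_N by (metis less_irrefl)+
  then have i: "1 \<le> i" "i < N" "j < N" using ij by auto
  obtain ei where ei: "ei \<in> over i" using over_nonempty[OF i(1,2)] by blast
  have Hi: "H i = sum w (over i)" using H_up(1)[OF ei] H_pos_up[OF _ ei] ij by simp
  have "1 \<le> j" using ij by simp
  then obtain ej where ej: "ej \<in> over j" using over_nonempty[OF _ i(3)] by blast
  have Hj: "H j = sum w (over j)" using H_up(1)[OF ej] H_pos_up[OF _ ej] ij by simp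
  have "\<exists>e \<in> over i. hi e \<le> j"
  proof (rule ccontr)
    assume none: "\<not> ?thesis"
    then have sub: "over i \<subseteq> over j" using ij by (force simp: over_def)
    have eq: "over i = over j"
    proof (rule ccontr)
      assume "over i \<noteq> over j"
      then obtain f where "f \<in> over j - over i" using sub by blast
      then have "sum w (over i) < sum w (over j)"
        using sub finite_over over_pos by (intro sum_strict_mono2[where b = f]) (auto intro: less_imp_le)
      then show False using Hi Hj ij by simp
    qed
    obtain e where e: "e \<in> E" "(lo e \<in> {i + 1..j}) \<noteq> (hi e \<in> {i + 1..j})"
      using connected[of "i + 1" j] i ij by auto
    then have "(e \<in> over i) \<noteq> (e \<in> over j)"
      using bounds[OF e(1)] by (auto simp: over_def)
    then show False using eq by simp
  qed
  then obtain e where e: "e \<in> over i" "hi e \<le> j" by blast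
  let ?t = "hi e"
  have "up e" using H_pos_up[OF _ e(1)] ij by simp
  have it: "i < ?t" and eE: "e \<in> E" and le: "lo e \<le> i" using e(1) by (auto simp: over_def)
  have "H ?t < H j"
  proof (cases "\<exists>f\<in>over ?t. \<not> up f")
    case True
    then show ?thesis using H_down ij(4) by force
  next
    case False
    have "1 \<le> ?t" "?t < N" using it e(2) i by auto
    then obtain f where f: "f \<in> over ?t" using over_nonempty by blast
    have "over ?t \<subseteq> over i"
    proof
      fix f assume f: "f \<in> over ?t"
      then have fE: "f \<in> E" "lo f \<le> ?t" "?t < hi f" and "up f" using False by (auto simp: over_def)
      have "lo f \<noteq> ?t" using no_touch[OF eE fE(1)] \<open>up e\<close> \<open>up f\<close> by auto
      then have "\<not> i < lo f"
        using no_cross[OF eE fE(1)] \<open>up e\<close> \<open>up f\<close> fE le by auto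
      then show "f \<in> over i" using fE it by (simp add: over_def)
    qed
    moreover have "e \<notin> over ?t" by (simp add: over_def)
    ultimately have "sum w (over ?t) < sum w (over i)"
      using finite_over over_pos e(1) by (intro sum_strict_mono2[where b = e]) (auto intro: less_imp_le)
    then show ?thesis using H_up(1)[OF f] False f Hi ij by simp
  qed
  moreover have "?t \<noteq> j" using calculation by auto
  ultimately show ?thesis using it e(2) by (intro exI[of _ ?t]) auto
qed

text \<open>Arcs are stacked on the axis with the widest ones next to it. So the bottom of the
  rectangle of \<open>e\<close> is the total weight of the arcs that span \<open>e\<close>, and its
  top is this weight plus that of \<open>e\<close>.\<close>

lemma arc_heights:
  assumes e: "e \<in> E" "up e"
  shows "high H (lo e) (hi e) = low H (lo e) (hi e) + w e" "up_edge H N (lo e) (hi e)"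
proof -
  define X where "X = {f \<in> E. lo f \<le> lo e \<and> hi e \<le> hi f}"
  note be = bounds[OF e(1)]
  have X: "finite X" "X \<subseteq> E" "e \<in> X" using finite_E e by (auto simp: X_def)
  have e_over: "e \<in> over j" if "lo e \<le> j" "j < hi e" for j
    using that e by (simp add: over_def)
  have up_over: "up f" if "f \<in> over j" "lo e \<le> j" "j < hi e" for f j
    using over_side[OF that(1) e_over[OF that(2,3)]] e(2) by simp
  have X_up: "up f" if "f \<in> X" for f
    using up_over[of f "lo e"] that be by (auto simp: X_def over_def)
  have Hj: "H j = sum w (over j)" if "lo e \<le> j" "j < hi e" for j
    using H_up(1)[OF e_over[OF that] e(2)] .
  have ge: "sum w X \<le> H j" if "lo e \<le> j" "j < hi e" for j
    unfolding Hj[OF that] using that finite_over over_pos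
    by (intro sum_mono2) (auto simp: X_def over_def intro: less_imp_le)
  \<comment> \<open>A gap under \<open>e\<close> that no arc outside \<open>X\<close> covers: the
    first gap, unless a shorter arc starts there as well; then the gap after the longest such
    arc.\<close>
  have "\<exists>j. lo e \<le> j \<and> j < hi e \<and> over j \<subseteq> X"
  proof (cases "\<exists>f\<in>E. lo f = lo e \<and> hi f < hi e")
    case False
    have "over (lo e) \<subseteq> X"
    proof
      fix f assume f: "f \<in> over (lo e)"
      have "up f" using up_over[OF f] be by simp
      then show "f \<in> X"
        using f False no_cross[of f e] e by (force simp: over_def X_def)
    qed
    then show ?thesis using be by blast
  next
    case True
    define F where "F = {f \<in> E. lo f = lo e \<and> hi f < hi e}"
    have "finite (hi ` F)" "hi ` F \<noteq> {}" using True finite_E by (auto simp: F_def)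
    then have "Max (hi ` F) \<in> hi ` F" by (rule Max_in)
    then obtain g where g: "g \<in> F" "hi g = Max (hi ` F)" by auto
    have g_max: "hi f \<le> hi g" if "f \<in> F" for f
      using that \<open>finite (hi ` F)\<close> g(2) by simp
    have gE: "g \<in> E" "lo g = lo e" "hi g < hi e" using g by (auto simp: F_def)
    have "lo e < hi g" using bounds[OF gE(1)] gE by simp
    have "up g" using up_over[of g "lo e"] gE \<open>lo e < hi g\<close> be by (simp add: over_def)
    have "over (hi g) \<subseteq> X"
    proof
      fix f assume f: "f \<in> over (hi g)"
      then have fE: "f \<in> E" "lo f \<le> hi g" "hi g < hi f" by (auto simp: over_def)
      have "up f" using up_over[OF f] gE \<open>lo e < hi g\<close> by simp
      have "lo f \<noteq> hi g" using no_touch[OF gE(1) fE(1)] \<open>up f\<close> \<open>up g\<close> by auto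
      then have le: "lo f \<le> lo e"
        using no_cross[OF gE(1) fE(1)] \<open>up f\<close> \<open>up g\<close> gE fE by force
      have "hi e \<le> hi f"
      proof (rule ccontr)
        assume less: "\<not> hi e \<le> hi f"
        then have "lo f \<noteq> lo e" using g_max[of f] fE by (auto simp: F_def)
        then show False
          using no_cross[OF fE(1) e(1)] \<open>up f\<close> e(2) le less \<open>lo e < hi g\<close> fE(3) by simp
      qed
      then show "f \<in> X" using fE le by (simp add: X_def)
    qed
    then show ?thesis using gE \<open>lo e < hi g\<close> by (intro exI[of _ "hi g"]) auto
  qed
  then obtain j where j: "lo e \<le> j" "j < hi e" "over j \<subseteq> X" by blast
  have "H j \<le> sum w X"
    unfolding Hj[OF j(1,2)] using j(3) X w_pos by (intro sum_mono2) (auto intro: less_imp_le)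
  then have high: "high H (lo e) (hi e) = sum w X"
    using high_le[OF j(1,2), of H] high_greatest[of "lo e" "hi e" "sum w X" H] ge be by force
  have Y: "finite (X - {e})" "X - {e} \<subseteq> E" using X by auto
  have "H (lo e - 1) \<le> sum w (X - {e})"
  proof (rule H_le[OF _ _ Y])
    show "{f \<in> over (lo e - 1). up f} \<subseteq> X - {e}"
    proof
      fix f assume "f \<in> {f \<in> over (lo e - 1). up f}"
      then have f: "f \<in> E" "lo f < lo e" "lo e \<le> hi f" "up f" using be by (auto simp: over_def)
      have "hi f \<noteq> lo e" using no_touch[OF f(1) e(1)] f e by simp
      then have "hi e \<le> hi f" using no_cross[OF f(1) e(1)] f e by force
      then show "f \<in> X - {e}" using f by (auto simp: X_def)
    qed
  qed (use be in auto)
  moreover have "H (hi e) \<le> sum w (X - {e})"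
  proof (rule H_le[OF _ _ Y])
    show "{f \<in> over (hi e). up f} \<subseteq> X - {e}"
    proof
      fix f assume "f \<in> {f \<in> over (hi e). up f}"
      then have f: "f \<in> E" "lo f \<le> hi e" "hi e < hi f" "up f" by (auto simp: over_def)
      have "hi e \<noteq> lo f" using no_touch[OF e(1) f(1)] f e by simp
      then have "lo f \<le> lo e" using no_cross[OF e(1) f(1)] f e by force
      then show "f \<in> X - {e}" using f by (auto simp: X_def)
    qed
  qed (use be in auto)
  moreover have "0 \<le> sum w (X - {e})"
    using Y w_pos by (intro sum_nonneg) (auto intro: less_imp_le)
  ultimately have low_le: "low H (lo e) (hi e) \<le> sum w (X - {e})"
    by (simp add: low_def)
  have covered: "sum w (X - {e}) \<le> H i" if sub: "X - {e} \<subseteq> over i" and ne: "X - {e} \<noteq> {}" for i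
  proof -
    obtain f where f: "f \<in> X - {e}" using ne by blast
    then have "H i = sum w (over i)" using H_up(1)[of f i] sub X_up by blast
    moreover have "sum w (X - {e}) \<le> sum w (over i)"
      using sub finite_over over_pos by (intro sum_mono2) (auto intro: less_imp_le)
    ultimately show ?thesis by simp
  qed
  have "sum w (X - {e}) \<le> low H (lo e) (hi e)"
  proof -
    \<comment> \<open>The arcs of \<open>X - {e}\<close> all cover the gap before \<open>e\<close>
      or all cover the gap after it: if \<open>f\<close> shared the left end with \<open>e\<close>
      and \<open>g\<close> the right end, then \<open>g\<close> and \<open>f\<close> would
      cross.\<close>
    consider "X - {e} = {}" | "X - {e} \<noteq> {}" "\<forall>f\<in>X - {e}. lo f < lo e" | "X - {e} \<noteq> {}" "\<forall>f\<in>X - {e}. hi e < hi f"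
      | f g where "f \<in> X - {e}" "\<not> lo f < lo e" "g \<in> X - {e}" "\<not> hi e < hi g" by blast
    then show ?thesis
    proof cases
      case 1
      show ?thesis unfolding 1 by (simp add: low_ge(1))
    next
      case 2
      have "X - {e} \<subseteq> over (lo e - 1)"
      proof
        fix f assume "f \<in> X - {e}"
        then have "f \<in> E" "lo f < lo e" "hi e \<le> hi f" using 2(2) by (auto simp: X_def)
        then show "f \<in> over (lo e - 1)" using be by (auto simp: over_def)
      qed
      then show ?thesis using covered 2(1) low_ge(2)[of H "lo e" "hi e"] by (meson order_trans)
    next
      case 3
      have "X - {e} \<subseteq> over (hi e)"
      proof
        fix f assume "f \<in> X - {e}"
        then have "f \<in> E" "hi e < hi f" "lo f \<le> lo e" using 3(2) by (auto simp: X_def)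
        then show "f \<in> over (hi e)" using be by (auto simp: over_def)
      qed
      then show ?thesis using covered 3(1) low_ge(3)[of H "hi e" "lo e"] by (meson order_trans)
    next
      case 4
      then have f: "f \<in> E" "lo f = lo e" "hi e \<le> hi f" "f \<noteq> e" and g: "g \<in> E" "lo g \<le> lo e" "hi g = hi e" "g \<noteq> e"
        by (auto simp: X_def)
      have "hi f \<noteq> hi e" "lo g \<noteq> lo e" using simple f g e(1) by metis+
      then show ?thesis
        using no_cross[OF g(1) f(1)] X_up 4 f g be by force
    qed
  qed
  then have "low H (lo e) (hi e) = sum w (X - {e})" using low_le by simp
  moreover have "sum w X = sum w (X - {e}) + w e"
    using X by (simp add: sum.remove[of X e] add.commute)
  ultimately show "high H (lo e) (hi e) = low H (lo e) (hi e) + w e" using high by simp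
  then show "up_edge H N (lo e) (hi e)"
    using be w_pos[OF e(1)] by (simp add: up_edge_def)
qed

lemma heights:
  assumes "\<And>i. \<lbrakk>1 \<le> i; i \<le> N\<rbrakk> \<Longrightarrow> H (i - 1) \<noteq> H i"
  shows "tree_heights H N"
proof -
  interpret m: arc_diagram E lo hi "\<lambda>e. \<not> up e" w N "\<lambda>i. - H i" by (rule minus)
  show ?thesis
  proof
    show "\<exists>t. i < t \<and> t < j \<and> H j < H t" if "i < j" "j \<le> N" "H i = H j" "H j < 0" for i j
      using m.separate[of i j] that by simp
  qed (use H_0 H_N H_nonzero separate assms in auto)
qed

end

section \<open>Transport of cyclic successors along bijections\<close>

lemma cyc_next_map:
  assumes \<phi>: "cyc_next \<phi> X k" and \<psi>: "cyc_next \<psi> (F ` X) k'"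
    and F: "inj_on F X" and key: "\<And>x. x \<in> X \<Longrightarrow> k' (F x) = k x" and x: "x \<in> X"
  shows "\<psi> (F x) = F (\<phi> x)"
proof (rule ccontr)
  assume ne: "\<psi> (F x) \<noteq> F (\<phi> x)"
  have \<phi>x: "\<phi> x \<in> X" using \<phi> x by (simp add: cyc_next_def)
  obtain z where z: "z \<in> X" "\<psi> (F x) = F z" using \<psi> x by (auto simp: cyc_next_def)
  then have "z \<noteq> \<phi> x" using ne by auto
  then obtain y where "y \<in> X" "y \<noteq> x" using z \<phi>x by metis
  then have "\<phi> x \<noteq> x" using \<phi> x by (auto simp: cyc_next_def)
  have "F (\<phi> x) \<noteq> F x" using F \<phi>x x \<open>\<phi> x \<noteq> x\<close> by (meson inj_onD)
  then have "\<psi> (F x) \<noteq> F x" using \<psi> x \<phi>x unfolding cyc_next_def by blast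
  then have "z \<noteq> x" using z by auto
  have "cyc3 (k x) (k (\<phi> x)) (k z)"
    using cyc_next_cyc3[OF \<phi> x z(1) \<open>z \<noteq> x\<close> \<open>z \<noteq> \<phi> x\<close>] .
  moreover have "cyc3 (k' (F x)) (k' (\<psi> (F x))) (k' (F (\<phi> x)))"
    using cyc_next_cyc3[OF \<psi>, of "F x" "F (\<phi> x)"] x \<phi>x \<open>F (\<phi> x) \<noteq> F x\<close> ne by auto
  then have "cyc3 (k x) (k z) (k (\<phi> x))" using key x z \<phi>x by simp
  ultimately show False unfolding cyc3_def by auto
qed

lemma cyc_next_pull:
  assumes \<psi>: "cyc_next \<psi> (F ` X) k'" and F: "inj_on F X"
    and \<phi>: "\<And>x. x \<in> X \<Longrightarrow> \<phi> x \<in> X" "\<And>x. x \<in> X \<Longrightarrow> \<psi> (F x) = F (\<phi> x)"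
  shows "cyc_next \<phi> X (\<lambda>x. k' (F x))"
  unfolding cyc_next_def
proof (intro conjI ballI impI)
  show "inj_on (\<lambda>x. k' (F x)) X"
    using \<psi> comp_inj_on[OF F, of k'] by (simp add: cyc_next_def comp_def)
  show "\<phi> x \<in> X" if "x \<in> X" for x using \<phi>(1) that .
  fix x z assume xz: "x \<in> X" "z \<in> X" "z \<noteq> x"
  then have ne: "F z \<noteq> F x" using F by (meson inj_onD)
  then have "\<psi> (F x) \<noteq> F x" using \<psi> xz unfolding cyc_next_def by blast
  then show "\<phi> x \<noteq> x" using \<phi>(2)[OF xz(1)] by auto
  assume "z \<noteq> \<phi> x"
  then have "F z \<noteq> \<psi> (F x)" using F xz \<phi> by (metis inj_onD)
  then show "cyc3 (k' (F x)) (k' (F (\<phi> x))) (k' (F z))"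
    using cyc_next_cyc3[OF \<psi>, of "F x" "F z"] xz ne \<phi>(2)[OF xz(1)] by simp
qed

section \<open>Double counting of edge weights\<close>

lemma (in lwbp) swap_incident:
  fixes g :: "'v \<Rightarrow> real"
  assumes "A \<subseteq> verts T"
  shows "(\<Sum>v\<in>A. \<Sum>e\<in>incident T v. g v * edge_wt T e) =
    (\<Sum>e\<in>edges T. (\<Sum>v | v \<in> A \<and> v \<in> ends T e. g v) * edge_wt T e)"
proof -
  have "finite A" using assms finite_verts by (rule finite_subset)
  from sum.swap_restrict[OF this finite_edges, of "\<lambda>v e. g v * edge_wt T e" "\<lambda>v e. v \<in> ends T e"]
  show ?thesis by (simp add: incident_def sum_distrib_right)
qed

text \<open>Every edge has exactly one black end, so summing over the black vertices counts each
  edge once.\<close>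

lemma (in lwbp) total_weight:
  "(\<Sum>e\<in>edges T. edge_wt T e) = (\<Sum>s\<in>S. if 0 < wt s then wt s else 0)"
proof -
  have "(\<Sum>s\<in>S. if 0 < wt s then wt s else 0) = (\<Sum>v\<in>verts T. if black v then wt (lab T v) else 0)"
    using sum.reindex_bij_betw[OF lab_bij, of "\<lambda>s. if 0 < wt s then wt s else 0"] by simp
  also have "\<dots> = (\<Sum>v | v \<in> verts T \<and> black v. wt (lab T v))"
    using finite_verts by (simp add: sum.inter_filter)
  also have "\<dots> = (\<Sum>v | v \<in> verts T \<and> black v. \<Sum>e\<in>incident T v. 1 * edge_wt T e)"
    by (rule sum.cong) (simp_all add: vertex_sum)
  also have "\<dots> = (\<Sum>e\<in>edges T. (\<Sum>v | v \<in> {v. v \<in> verts T \<and> black v} \<and> v \<in> ends T e. 1) * edge_wt T e)"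
    by (rule swap_incident) auto
  also have "\<dots> = (\<Sum>e\<in>edges T. edge_wt T e)"
  proof (rule sum.cong)
    fix e assume "e \<in> edges T"
    then obtain b w where "b \<in> verts T" "w \<in> verts T" "ends T e = {b, w}" "black b" "\<not> black w" "b \<noteq> w"
      by (rule edgeE)
    then have "{v. v \<in> {v. v \<in> verts T \<and> black v} \<and> v \<in> ends T e} = {b}" by auto
    then show "(\<Sum>v | v \<in> {v. v \<in> verts T \<and> black v} \<and> v \<in> ends T e. 1) * edge_wt T e = edge_wt T e"
      by simp
  qed simp
  finally show ?thesis by simp
qed

section \<open>The permutation read off from a compatible order\<close>

locale compat_tree = lwbp S wt T
  for S :: "'s set" and wt and T :: "('v, 'e, 's) lw_plane_graph" +
  fixes pos :: "'v \<Rightarrow> nat"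
  assumes fp: "full_passport S wt" and card_S: "2 \<le> card S"
    and compat: "tree_compat pos" and pos_bij: "bij_betw pos (verts T) {1..card S}"
begin

definition order :: "'s list" where
  "order = map (\<lambda>i. lab T (inv_into (verts T) pos (Suc i))) [0..<card S]"

abbreviation "H \<equiv> height wt order"
abbreviation "N \<equiv> card S"

lemma pos_inj: "inj_on pos (verts T)"
  using pos_bij by (rule bij_betw_imp_inj_on)

lemma pos_eq_iff: "\<lbrakk>u \<in> verts T; v \<in> verts T\<rbrakk> \<Longrightarrow> pos u = pos v \<longleftrightarrow> u = v"
  using pos_inj by (meson inj_on_eq_iff)

lemma pos_range: "v \<in> verts T \<Longrightarrow> 1 \<le> pos v \<and> pos v \<le> N"
  using bij_betwE[OF pos_bij] by auto

lemma pos_surj: "\<lbrakk>1 \<le> i; i \<le> N\<rbrakk> \<Longrightarrow> \<exists>v\<in>verts T. pos v = i"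
  using bij_betw_imp_surj_on[OF pos_bij] by (metis atLeastAtMost_iff imageE)

lemma length_order: "length order = N"
  by (simp add: order_def)

lemma order_nth: "v \<in> verts T \<Longrightarrow> order ! (pos v - 1) = lab T v"
proof -
  assume v: "v \<in> verts T"
  then have "pos v - 1 < N" "Suc (pos v - 1) = pos v" using pos_range[of v] by auto
  then show ?thesis using inv_into_f_f[OF pos_inj v] by (simp add: order_def)
qed

lemma order_perm: "order \<in> permutations_of_set S"
proof -
  have "bij_betw (\<lambda>i. lab T (inv_into (verts T) pos (Suc i))) {0..<N} S"
  proof -
    have "bij_betw Suc {0..<N} {1..N}" by (rule bij_betwI[where g = "\<lambda>i. i - 1"]) auto
    from bij_betw_trans[OF bij_betw_trans[OF this bij_betw_inv_into[OF pos_bij]] lab_bij]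
    show ?thesis by (simp add: comp_def)
  qed
  then show ?thesis
    by (auto simp: order_def permutations_of_set_def bij_betw_def distinct_map)
qed

definition lo :: "'e \<Rightarrow> nat" where "lo e = Min (pos ` ends T e)"
definition hi :: "'e \<Rightarrow> nat" where "hi e = Max (pos ` ends T e)"
definition up :: "'e \<Rightarrow> bool" where
  "up e \<longleftrightarrow> (\<exists>v\<in>verts T. pos v = lo e \<and> black v)"

lemma arcE:
  assumes "e \<in> edges T"
  obtains u v where "u \<in> verts T" "v \<in> verts T" "ends T e = {u, v}" "(u, v) \<in> adj T" "pos u < pos v"
    "lo e = pos u" "hi e = pos v" "up e \<longleftrightarrow> black u" "black u \<noteq> black v"
proof -
  note arc = that
  obtain b w where bw: "b \<in> verts T" "w \<in> verts T" "ends T e = {b, w}" "black b \<noteq> black w" "b \<noteq> w"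
    using assms by (rule edgeE) auto
  have *: thesis if "u \<in> verts T" "v \<in> verts T" "ends T e = {u, v}" "black u \<noteq> black v" "pos u < pos v" for u v
  proof (rule arc[of u v])
    show "lo e = pos u" "hi e = pos v" using that by (simp_all add: lo_def hi_def)
    then show "up e \<longleftrightarrow> black u" using that pos_eq_iff unfolding up_def by metis
    show "(u, v) \<in> adj T" using assms that by (auto simp: adj_def)
  qed (use that in auto)
  have "pos b \<noteq> pos w" using pos_eq_iff bw by simp
  then show thesis
    using *[of b w] *[of w b] bw by (metis insert_commute linorder_neqE_nat)
qed

text \<open>Distribute the signed vertex weights up to position \<open>i\<close> over the edges. An
  edge with both ends among these vertices occurs with both signs and cancels; what remains are the
  arcs over gap \<open>i\<close>.\<close>

lemma height_arcs:
  assumes i: "i \<le> N"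
  shows "H i = (\<Sum>e | e \<in> edges T \<and> lo e \<le> i \<and> i < hi e. if up e then edge_wt T e else - edge_wt T e)"
proof -
  let ?s = "\<lambda>v. if black v then 1 else - 1 :: real"
  define A where "A = {v \<in> verts T. pos v \<le> i}"
  have "bij_betw pos A {1..i}"
  proof (rule bij_betw_subset[OF pos_bij])
    show "pos ` A = {1..i}"
      unfolding A_def using pos_range pos_surj i by (force simp: image_iff)
  qed (auto simp: A_def)
  then have "H i = (\<Sum>v\<in>A. wt (order ! (pos v - 1)))"
    unfolding height_def by (rule sum.reindex_bij_betw[symmetric])
  also have "\<dots> = (\<Sum>v\<in>A. \<Sum>e\<in>incident T v. ?s v * edge_wt T e)"
  proof (rule sum.cong)
    fix v assume v: "v \<in> A"
    then have vT: "v \<in> verts T" by (simp add: A_def)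
    have "(\<Sum>e\<in>incident T v. ?s v * edge_wt T e) = ?s v * \<bar>wt (lab T v)\<bar>"
      using vertex_sum[OF vT] by (simp add: sum_distrib_left[symmetric] sum_negf)
    then show "wt (order ! (pos v - 1)) = (\<Sum>e\<in>incident T v. ?s v * edge_wt T e)"
      using order_nth[OF vT] by auto
  qed simp
  also have "\<dots> = (\<Sum>e\<in>edges T. (\<Sum>v | v \<in> A \<and> v \<in> ends T e. ?s v) * edge_wt T e)"
    by (rule swap_incident) (auto simp: A_def)
  also have "\<dots> = (\<Sum>e\<in>edges T. if lo e \<le> i \<and> i < hi e then if up e then edge_wt T e else - edge_wt T e else 0)"
  proof (rule sum.cong)
    fix e assume "e \<in> edges T"
    then obtain u v where e: "u \<in> verts T" "v \<in> verts T" "ends T e = {u, v}" "pos u < pos v"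
      "lo e = pos u" "hi e = pos v" "up e \<longleftrightarrow> black u" "black u \<noteq> black v"
      by (rule arcE)
    then have "u \<noteq> v" by auto
    have "{x. x \<in> A \<and> x \<in> ends T e} = (if pos v \<le> i then {u, v} else if pos u \<le> i then {u} else {})"
      using e by (auto simp: A_def)
    then show "(\<Sum>v | v \<in> A \<and> v \<in> ends T e. ?s v) * edge_wt T e =
        (if lo e \<le> i \<and> i < hi e then if up e then edge_wt T e else - edge_wt T e else 0)"
      using e \<open>u \<noteq> v\<close> by auto
  qed simp
  also have "\<dots> = (\<Sum>e | e \<in> edges T \<and> lo e \<le> i \<and> i < hi e. if up e then edge_wt T e else - edge_wt T e)"
    using finite_edges by (simp add: sum.inter_filter)
  finally show ?thesis .
qed

lemma arcs:
  assumes "e \<in> edges T" "f \<in> edges T"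
  shows "if up e = up f then \<not> (lo e < lo f \<and> lo f < hi e \<and> hi e < hi f) else hi e \<le> lo f \<or> hi f \<le> lo e"
proof -
  obtain u v where e: "(u, v) \<in> adj T" "pos u < pos v" "lo e = pos u" "hi e = pos v" "up e \<longleftrightarrow> black u"
    using assms(1) by (rule arcE)
  obtain x y where f: "(x, y) \<in> adj T" "pos x < pos y" "lo f = pos x" "hi f = pos y" "up f \<longleftrightarrow> black x"
    using assms(2) by (rule arcE)
  have "arcs_compat (adj T) (\<lambda>v. black v) pos" using compat by (simp add: tree_compat_def)
  then have "if black u = black x then \<not> (pos u < pos x \<and> pos x < pos v \<and> pos v < pos y)
      else pos v \<le> pos x \<or> pos y \<le> pos u"
    using e(1,2) f(1,2) unfolding arcs_compat_def by blast
  then show ?thesis using e(3-5) f(3-5) by simp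
qed

sublocale arc_diagram "edges T" lo hi up "edge_wt T" N H
proof
  show "finite (edges T)" by (rule finite_edges)
  show "0 < edge_wt T e" if "e \<in> edges T" for e using edge_wt_pos[OF that] .
  show "1 \<le> lo e \<and> lo e < hi e \<and> hi e \<le> N" if "e \<in> edges T" for e
    using that by (rule arcE) (use pos_range in auto)
  fix e f assume ef: "e \<in> edges T" "f \<in> edges T"
  show False if "up e = up f" "lo e < lo f" "lo f < hi e" "hi e < hi f"
    using arcs[OF ef] that by simp
  show "hi e \<le> lo f \<or> hi f \<le> lo e" if "up e \<noteq> up f"
    using arcs[OF ef] that by simp
  obtain u v where e: "u \<in> verts T" "v \<in> verts T" "ends T e = {u, v}" "lo e = pos u" "hi e = pos v"
    "up e \<longleftrightarrow> black u" "black u \<noteq> black v"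
    using ef(1) by (rule arcE)
  obtain x y where f: "x \<in> verts T" "y \<in> verts T" "ends T f = {x, y}" "lo f = pos x" "hi f = pos y"
    "up f \<longleftrightarrow> black x" "black x \<noteq> black y"
    using ef(2) by (rule arcE)
  \<comment> \<open>The right end of \<open>e\<close> has the colour opposite to the left end of
    \<open>e\<close>, hence to that of \<open>f\<close>.\<close>
  show "hi e \<noteq> lo f" if "up e = up f"
    using that e f pos_eq_iff[of v x] by auto
  show "e = f" if "lo e = lo f" "hi e = hi f"
    using that e f pos_eq_iff[of u x] pos_eq_iff[of v y] ef by (intro ends_inj) auto
next
  fix k l assume kl: "1 \<le> k" "k \<le> l" "l \<le> N" "k \<noteq> 1 \<or> l \<noteq> N"
  obtain u where u: "u \<in> verts T" "pos u = k" using pos_surj[of k] kl by auto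
  have "\<exists>i. 1 \<le> i \<and> i \<le> N \<and> i \<notin> {k..l}"
  proof (cases "k = 1")
    case True
    then show ?thesis using kl by (intro exI[of _ N]) auto
  next
    case False
    then show ?thesis using kl by (intro exI[of _ 1]) auto
  qed
  then obtain v where v: "v \<in> verts T" "pos v \<notin> {k..l}" using pos_surj by blast
  have "(u, v) \<in> (adj T)\<^sup>*" using connected u(1) v(1) by (simp add: connected_graph_adj)
  then have "\<exists>c d. (u, c) \<in> (adj T)\<^sup>* \<and> (c, d) \<in> adj T \<and> c \<in> {x. pos x \<in> {k..l}} \<and> d \<notin> {x. pos x \<in> {k..l}}"
    using u v kl by (intro rtrancl_exit) auto
  then obtain c d e where cd: "e \<in> edges T" "ends T e = {c, d}" "pos c \<in> {k..l}" "pos d \<notin> {k..l}"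
    by (auto simp: adj_def)
  obtain x y where e: "ends T e = {x, y}" "lo e = pos x" "hi e = pos y"
    using cd(1) by (rule arcE)
  then have "(lo e \<in> {k..l}) \<noteq> (hi e \<in> {k..l})"
    using cd(2-4) by (auto simp: doubleton_eq_iff)
  then show "\<exists>e\<in>edges T. (lo e \<in> {k..l}) \<noteq> (hi e \<in> {k..l})" using cd(1) by blast
next
  show "H i = (\<Sum>e | e \<in> edges T \<and> lo e \<le> i \<and> i < hi e. if up e then edge_wt T e else - edge_wt T e)"
    if "i \<le> N" for i
    using height_arcs[OF that] .
qed

lemma order_tree_permutation: "order \<in> tree_permutations S wt"
proof -
  have "H (i - 1) \<noteq> H i" if "1 \<le> i" "i \<le> N" for i
  proof -
    have "order ! (i - 1) \<in> S"
      using that order_perm length_order by (metis One_nat_def Suc_le_lessD Suc_pred less_le_trans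
        nth_mem permutations_of_setD(1) Suc_le_eq)
    then show ?thesis
      using fp height_Suc[of wt order "i - 1"] that by (simp add: full_passport_def)
  qed
  then show ?thesis
    using tree_permutations_iff[OF fp order_perm] heights by blast
qed

sublocale comb: combing S wt order
  using fp card_S order_tree_permutation by unfold_locales

sublocale down: arc_diagram "edges T" lo hi "\<lambda>e. \<not> up e" "edge_wt T" N "\<lambda>i. - H i"
  by (rule minus)

definition rect_of :: "'e \<Rightarrow> rect" where
  "rect_of e = (if up e then up_rect H (lo e) (hi e) else down_rect H (lo e) (hi e))"

lemma rect_of_mem: "e \<in> edges T \<Longrightarrow> rect_of e \<in> rects wt order"
  using arc_heights(2)[of e] down.arc_heights(2)[of e] comb.up_rect_mem comb.down_rect_mem
  by (auto simp: rect_of_def length_order)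

lemma rect_of_sides: "rect_left (rect_of e) = lo e" "rect_right (rect_of e) = hi e"
  by (auto simp: rect_of_def up_rect_def down_rect_def)

lemma rect_of_height: "e \<in> edges T \<Longrightarrow> rect_top (rect_of e) - rect_bot (rect_of e) = edge_wt T e"
  using arc_heights(1)[of e] down.arc_heights(1)[of e]
  by (auto simp: rect_of_def up_rect_def down_rect_def)

lemma rect_of_ends: "e \<in> edges T \<Longrightarrow> {rect_left (rect_of e), rect_right (rect_of e)} = pos ` ends T e"
  unfolding rect_of_sides by (erule arcE) auto

lemma rect_of_inj: "inj_on rect_of (edges T)"
  by (rule inj_onI) (metis rect_of_sides simple)

text \<open>All rectangles arise, as the total weights of the edges of both trees agree.\<close>

lemma rect_of_bij: "bij_betw rect_of (edges T) (rects wt order)"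
proof -
  let ?h = "\<lambda>r. rect_top r - rect_bot r" and ?I = "rect_of ` edges T"
  have sub: "?I \<subseteq> rects wt order" using rect_of_mem by blast
  have fin: "finite (rects wt order)" by (rule comb.finite_rects)
  have "sum ?h ?I = (\<Sum>e\<in>edges T. edge_wt T e)"
    using rect_of_inj rect_of_height by (simp add: sum.reindex)
  also have "\<dots> = sum ?h (rects wt order)"
    using total_weight comb.lw.total_weight by simp
  finally have "sum ?h (rects wt order - ?I) = 0"
    using sum.subset_diff[OF sub fin, of ?h] by simp
  moreover have "0 < sum ?h (rects wt order - ?I)" if "rects wt order - ?I \<noteq> {}"
    using that fin comb.rect_bounds(4) by (intro sum_pos) auto
  ultimately have "rects wt order = ?I" using sub by fastforce
  then show ?thesis using rect_of_inj by (simp add: bij_betw_def)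
qed

lemma incident_image:
  assumes v: "v \<in> verts T"
  shows "rect_of ` incident T v = incident (comb_graph wt order) (pos v)"
proof -
  have "v \<in> ends T e \<longleftrightarrow> pos v \<in> {rect_left (rect_of e), rect_right (rect_of e)}" if "e \<in> edges T" for e
  proof -
    have "ends T e \<subseteq> verts T" using that by (rule arcE) auto
    then show ?thesis
      unfolding rect_of_ends[OF that] using pos_inj v by (metis inj_on_image_mem_iff)
  qed
  then show ?thesis
    using bij_betw_imp_surj_on[OF rect_of_bij, symmetric] unfolding incident_def by auto
qed

text \<open>The rotations of both graphs are successor maps for keys that \<open>rect_of\<close>
  preserves, so \<open>rect_of\<close> commutes with them.\<close>

theorem plane_iso_comb_graph: "plane_iso T (comb_graph wt order)"
  unfolding plane_iso_def
proof (intro exI[of _ pos] exI[of _ rect_of] conjI ballI)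
  show "bij_betw pos (verts T) (verts (comb_graph wt order))" using pos_bij length_order by simp
  show "bij_betw rect_of (edges T) (edges (comb_graph wt order))" using rect_of_bij by simp
  show "lab (comb_graph wt order) (pos v) = lab T v" if "v \<in> verts T" for v
    using order_nth[OF that] by simp
  show "ends (comb_graph wt order) (rect_of e) = pos ` ends T e" if "e \<in> edges T" for e
    using rect_of_ends[OF that] by simp
  show "edge_wt (comb_graph wt order) (rect_of e) = edge_wt T e" if "e \<in> edges T" for e
    using rect_of_height[OF that] by simp
  fix v e assume v: "v \<in> verts T" and e: "e \<in> incident T v"
  have key: "comb.lw.edge_key id (pos v) (rect_of e) = edge_key pos v e" if e: "e \<in> incident T v" for e
  proof -
    have eE: "e \<in> edges T" "ends T e = {v, other v e}" using ends_other[OF e] by auto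
    then have "comb.lw.other (pos v) (rect_of e) = pos (other v e)"
      using rect_of_mem[OF eE(1)] rect_of_ends[OF eE(1)] by (intro comb.lw.other_eqI) auto
    then show ?thesis
      using order_nth[OF v] by (simp add: comb.lw.edge_key_def edge_key_def vkey_def)
  qed
  show "nxt (comb_graph wt order) (pos v) (rect_of e) = rect_of (nxt T v e)"
  proof (rule cyc_next_map[where F = rect_of and X = "incident T v" and k = "edge_key pos v"
        and k' = "comb.lw.edge_key id (pos v)" and \<phi> = "nxt T v" and x = e
        and \<psi> = "nxt (comb_graph wt order) (pos v)"])
    show "cyc_next (nxt T v) (incident T v) (edge_key pos v)"
      using compat v by (simp add: tree_compat_def)
    show "cyc_next (nxt (comb_graph wt order) (pos v)) (rect_of ` incident T v) (comb.lw.edge_key id (pos v))"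
      using comb.comb_graph_compat pos_range[OF v] length_order
      unfolding incident_image[OF v] comb.lw.tree_compat_def by simp
    show "inj_on rect_of (incident T v)"
      using rect_of_inj by (rule inj_on_subset) (auto simp: incident_def)
  qed (use key e in auto)
qed

end

section \<open>Isomorphism classes\<close>

lemma plane_iso_refl: "plane_iso T T"
  unfolding plane_iso_def by (rule exI[of _ id], rule exI[of _ id]) (simp add: bij_betw_def)

definition plane_iso_by ::
  "('v, 'e, 's) lw_plane_graph \<Rightarrow> ('w, 'f, 's) lw_plane_graph \<Rightarrow> ('v \<Rightarrow> 'w) \<Rightarrow> ('e \<Rightarrow> 'f) \<Rightarrow> bool" where
  "plane_iso_by T T' g f \<longleftrightarrow> bij_betw g (verts T) (verts T') \<and> bij_betw f (edges T) (edges T') \<and>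
     (\<forall>v\<in>verts T. lab T' (g v) = lab T v) \<and>
     (\<forall>e\<in>edges T. ends T' (f e) = g ` ends T e) \<and>
     (\<forall>e\<in>edges T. edge_wt T' (f e) = edge_wt T e) \<and>
     (\<forall>v\<in>verts T. \<forall>e\<in>incident T v. nxt T' (g v) (f e) = f (nxt T v e))"

lemma plane_iso_iff: "plane_iso T T' \<longleftrightarrow> (\<exists>g f. plane_iso_by T T' g f)"
  by (simp add: plane_iso_def plane_iso_by_def)

lemma plane_iso_byD:
  assumes "plane_iso_by T T' g f"
  shows "bij_betw g (verts T) (verts T')" "bij_betw f (edges T) (edges T')"
     "\<And>v. v \<in> verts T \<Longrightarrow> lab T' (g v) = lab T v"
     "\<And>e. e \<in> edges T \<Longrightarrow> ends T' (f e) = g ` ends T e"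
     "\<And>e. e \<in> edges T \<Longrightarrow> edge_wt T' (f e) = edge_wt T e"
     "\<And>v e. v \<in> verts T \<Longrightarrow> e \<in> incident T v \<Longrightarrow> nxt T' (g v) (f e) = f (nxt T v e)"
  using assms unfolding plane_iso_by_def by (elim conjE; simp)+

lemma plane_iso_incident:
  assumes "bij_betw g (verts T) (verts T')" "bij_betw f (edges T) (edges T')"
    "\<And>e. e \<in> edges T \<Longrightarrow> ends T' (f e) = g ` ends T e" "e \<in> incident T v"
  shows "f e \<in> incident T' (g v)"
  using assms bij_betwE[OF assms(2)] by (auto simp: incident_def)

lemma plane_iso_trans:
  assumes "plane_iso T T'" "plane_iso T' T''" shows "plane_iso T T''"
proof -
  obtain g f where iso: "plane_iso_by T T' g f"
    using assms(1) plane_iso_iff by blast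
  note gf = plane_iso_byD[OF iso]
  obtain g' f' where iso': "plane_iso_by T' T'' g' f'"
    using assms(2) plane_iso_iff by blast
  note gf' = plane_iso_byD[OF iso']
  have v: "g v \<in> verts T'" if "v \<in> verts T" for v using bij_betwE[OF gf(1)] that by blast
  have e: "f e \<in> edges T'" if "e \<in> edges T" for e using bij_betwE[OF gf(2)] that by blast
  show ?thesis
    unfolding plane_iso_def
  proof (intro exI[of _ "g' \<circ> g"] exI[of _ "f' \<circ> f"] conjI ballI)
    show "bij_betw (g' \<circ> g) (verts T) (verts T'')" "bij_betw (f' \<circ> f) (edges T) (edges T'')"
      using gf(1,2) gf'(1,2) by (auto intro: bij_betw_trans)
    show "nxt T'' ((g' \<circ> g) u) ((f' \<circ> f) x) = (f' \<circ> f) (nxt T u x)"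
      if "u \<in> verts T" "x \<in> incident T u" for u x
      using gf(6)[OF that] gf'(6)[OF v[OF that(1)] plane_iso_incident[OF gf(1,2,4) that(2)]] by simp
  qed (use gf(3-5) gf'(3-5) v e in \<open>simp_all add: image_image\<close>)
qed

context lwbp
begin

text \<open>In an arbitrary record the ends of an edge may lie outside the vertex set and
  \<open>nxt\<close> may leave the edge set, where the inverse maps say nothing. Symmetry is
  therefore proved for trees.\<close>

lemma plane_iso_sym:
  assumes "plane_iso T T'" shows "plane_iso T' T"
proof -
  obtain g f where iso: "plane_iso_by T T' g f"
    using assms plane_iso_iff by blast
  note gf = plane_iso_byD[OF iso]
  define g' f' where "g' = inv_into (verts T) g" and "f' = inv_into (edges T) f"
  have bij: "bij_betw g' (verts T') (verts T)" "bij_betw f' (edges T') (edges T)"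
    unfolding g'_def f'_def using gf(1,2) by (auto intro: bij_betw_inv_into)
  have g: "g' (g v) = v" if "v \<in> verts T" for v
    unfolding g'_def using bij_betw_inv_into_left[OF gf(1) that] .
  have f: "f' (f e) = e" if "e \<in> edges T" for e
    unfolding f'_def using bij_betw_inv_into_left[OF gf(2) that] .
  have ends: "ends T e \<subseteq> verts T" if "e \<in> edges T" for e
    using that by (rule edgeE) auto
  have vE: "\<exists>v\<in>verts T. v' = g v" if "v' \<in> verts T'" for v'
    using that bij_betw_imp_surj_on[OF gf(1)] by blast
  have eE: "\<exists>e\<in>edges T. e' = f e" if "e' \<in> edges T'" for e'
    using that bij_betw_imp_surj_on[OF gf(2)] by blast
  show ?thesis
    unfolding plane_iso_def
  proof (intro exI[of _ g'] exI[of _ f'] conjI ballI bij)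
    show "lab T (g' v') = lab T' v'" if "v' \<in> verts T'" for v'
      using vE[OF that] g gf(3) by auto
    fix e' assume "e' \<in> edges T'"
    then obtain e where e: "e \<in> edges T" "e' = f e" using eE by blast
    have "g' ` g ` ends T e = ends T e"
      using ends[OF e(1)] g by (force simp: image_image)
    then show "ends T (f' e') = g' ` ends T' e'" using e f gf(4) by simp
    show "edge_wt T (f' e') = edge_wt T' e'" using e f gf(5) by simp
  next
    fix v' e' assume v': "v' \<in> verts T'" and e': "e' \<in> incident T' v'"
    obtain v where v: "v \<in> verts T" "v' = g v" using vE[OF v'] by blast
    obtain e where e: "e \<in> edges T" "e' = f e" using eE e' by (auto simp: incident_def)
    have "g v \<in> g ` ends T e" using e' v e gf(4) by (simp add: incident_def)
    then have "v \<in> ends T e"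
      using ends[OF e(1)] v(1) bij_betw_imp_inj_on[OF gf(1)] by (metis inj_on_image_mem_iff)
    then have inc: "e \<in> incident T v" using e by (simp add: incident_def)
    then have "nxt T v e \<in> edges T"
      using cyclic_on_inI[OF cyclic[OF v(1)] inc] by (simp add: incident_def)
    then show "nxt T (g' v') (f' e') = f' (nxt T' v' e')"
      using gf(6)[OF v(1) inc] v e g f by simp
  qed
qed

text \<open>Compatibility refers only to adjacency, colours and rotation, which an isomorphism
  preserves. Orders of isomorphic trees can thus be pulled back to one tree, where uniqueness
  applies.\<close>

lemma tree_compat_iso:
  fixes T' :: "('w, 'f, 's) lw_plane_graph"
  assumes T': "lwbp S wt T'"
    and gf: "bij_betw g (verts T) (verts T')" "bij_betw f (edges T) (edges T')"
     "\<And>v. v \<in> verts T \<Longrightarrow> lab T' (g v) = lab T v"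
     "\<And>e. e \<in> edges T \<Longrightarrow> ends T' (f e) = g ` ends T e"
     "\<And>v e. v \<in> verts T \<Longrightarrow> e \<in> incident T v \<Longrightarrow> nxt T' (g v) (f e) = f (nxt T v e)"
    and compat: "lwbp.tree_compat wt T' pos"
  shows "tree_compat (\<lambda>v. pos (g v))"
proof -
  interpret t: lwbp S wt T' by (rule T')
  have inj: "inj_on (\<lambda>v. pos (g v)) (verts T)"
    using compat comp_inj_on[of g "verts T" pos] gf(1)
    by (simp add: t.tree_compat_def bij_betw_def comp_def)
  have adj: "(g u, g v) \<in> adj T'" if "(u, v) \<in> adj T" for u v
    using that gf(4) bij_betwE[OF gf(2)] unfolding adj_def by force
  have black: "wt (lab T' (g u)) = wt (lab T u)" if "(u, v) \<in> adj T" for u v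
    using adj_verts[OF that] gf(3) by simp
  have "arcs_compat (adj T) (\<lambda>v. black v) (\<lambda>v. pos (g v))"
    unfolding arcs_compat_def
  proof (intro allI impI)
    fix x y u v assume *: "(x, y) \<in> adj T" "(u, v) \<in> adj T" "pos (g x) < pos (g y)" "pos (g u) < pos (g v)"
    have "arcs_compat (adj T') (\<lambda>v. t.black v) pos" using compat by (simp add: t.tree_compat_def)
    then have "if t.black (g x) = t.black (g u)
        then \<not> (pos (g x) < pos (g u) \<and> pos (g u) < pos (g y) \<and> pos (g y) < pos (g v))
        else pos (g y) \<le> pos (g u) \<or> pos (g v) \<le> pos (g x)"
      using adj[OF *(1)] adj[OF *(2)] *(3,4) unfolding arcs_compat_def by blast
    then show "if black x = black u
        then \<not> (pos (g x) < pos (g u) \<and> pos (g u) < pos (g y) \<and> pos (g y) < pos (g v))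
        else pos (g y) \<le> pos (g u) \<or> pos (g v) \<le> pos (g x)"
      using black[OF *(1)] black[OF *(2)] by simp
  qed
  moreover have "cyc_next (nxt T v) (incident T v) (edge_key (\<lambda>v. pos (g v)) v)" if v: "v \<in> verts T" for v
  proof -
    have ends: "ends T e \<subseteq> verts T" if "e \<in> edges T" for e
      using that by (rule edgeE) auto
    have img: "f ` incident T v = incident T' (g v)"
    proof -
      have "v \<in> ends T e \<longleftrightarrow> g v \<in> ends T' (f e)" if "e \<in> edges T" for e
        using gf(4)[OF that] ends[OF that] v bij_betw_imp_inj_on[OF gf(1)]
        by (metis inj_on_image_mem_iff)
      then show ?thesis
        using bij_betw_imp_surj_on[OF gf(2), symmetric] unfolding incident_def by auto
    qed
    have gv: "g v \<in> verts T'" using bij_betwE[OF gf(1)] v by blast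
    have pull: "cyc_next (nxt T v) (incident T v) (\<lambda>e. t.edge_key pos (g v) (f e))"
    proof (rule cyc_next_pull[where \<psi> = "nxt T' (g v)"])
      show "cyc_next (nxt T' (g v)) (f ` incident T v) (t.edge_key pos (g v))"
        using compat gv unfolding img t.tree_compat_def by blast
      show "inj_on f (incident T v)"
        using bij_betw_imp_inj_on[OF gf(2)] by (rule inj_on_subset) (auto simp: incident_def)
      show "nxt T v e \<in> incident T v" if "e \<in> incident T v" for e
        using cyclic_on_inI[OF cyclic[OF v] that] .
      show "nxt T' (g v) (f e) = f (nxt T v e)" if "e \<in> incident T v" for e
        using gf(5)[OF v that] .
    qed
    have "t.edge_key pos (g v) (f e) = edge_key (\<lambda>v. pos (g v)) v e" if e: "e \<in> incident T v" for e
    proof -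
      have eE: "e \<in> edges T" "ends T e = {v, other v e}" using ends_other[OF e] by auto
      then have "t.other (g v) (f e) = g (other v e)"
        using gf(4)[OF eE(1)] bij_betwE[OF gf(2)] by (intro t.other_eqI) auto
      then show ?thesis
        using gf(3)[OF v] by (simp add: t.edge_key_def edge_key_def vkey_def)
    qed
    then show ?thesis
      using cyc_next_transfer[OF pull edge_key_inj[OF inj]] by simp
  qed
  ultimately show ?thesis using inj by (simp add: tree_compat_def)
qed

end

section \<open>Injectivity and surjectivity of the combing map\<close>

theorem theorem2p11:
  fixes S :: "'s set" and wt :: "'s \<Rightarrow> real"
  assumes "full_passport S wt" and "card S \<ge> 2"
  shows "bij_betw (Comb wt) (tree_permutations S wt) (twice_marked_trees S wt)"
  unfolding bij_betw_def
proof (intro conjI inj_onI set_eqI iffI)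
  fix P Q assume P: "P \<in> tree_permutations S wt" and Q: "Q \<in> tree_permutations S wt"
    and eq: "Comb wt P = Comb wt Q"
  interpret p: combing S wt P using assms P by unfold_locales
  interpret q: combing S wt Q using assms Q by unfold_locales
  have "comb_graph wt Q \<in> iso_rel `` {comb_graph wt Q}"
    using plane_iso_refl by (auto simp: iso_rel_def)
  then have "plane_iso (comb_graph wt P) (comb_graph wt Q)"
    using eq by (auto simp: Comb_def iso_rel_def)
  then obtain g f where iso: "plane_iso_by p.G q.G g f"
    using plane_iso_iff by blast
  note gf = plane_iso_byD[OF iso]
  let ?N = "card S"
  have V: "verts p.G = {1..?N}" "verts q.G = {1..?N}" using p.N_card q.N_card by simp_all
  have len: "length P = ?N" "length Q = ?N" using p.N_card q.N_card by simp_all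
  have g_range: "1 \<le> g v \<and> g v \<le> ?N" if "1 \<le> v" "v \<le> ?N" for v
    using bij_betwE[OF gf(1)] V that by auto
  have lab: "Q ! (g v - 1) = P ! (v - 1)" if "1 \<le> v" "v \<le> ?N" for v
    using gf(3)[of v] V that by simp
  have fixed: "g v = v" if v: "1 \<le> v" "v \<le> ?N" and same: "P ! (v - 1) = Q ! (v - 1)" for v
  proof -
    have "Q ! (g v - 1) = Q ! (v - 1)" using lab[OF v] same by simp
    moreover have "g v - 1 < length Q" "v - 1 < length Q" using g_range[OF v] v len by linarith+
    ultimately have "g v - 1 = v - 1" using nth_eq_iff_index_eq[OF q.P_set(2)] by blast
    then show ?thesis using g_range[OF v] v by linarith
  qed
  have hd_last: "hd P = hd Q" "last P = last Q" using eq by (auto simp: Comb_def)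
  have ne: "P \<noteq> []" "Q \<noteq> []" using len assms(2) by auto
  have g1: "g 1 = 1" using fixed[of 1] hd_last(1) ne assms(2) by (simp add: hd_conv_nth)
  have gN: "g ?N = ?N" using fixed[of ?N] hd_last(2) ne assms(2) len by (simp add: last_conv_nth)
  \<comment> \<open>Now the identity and \<open>g\<close> are two compatible orders of the same
    tree, with the same first and last vertex.\<close>
  have compat_g: "p.lw.tree_compat (\<lambda>v. id (g v))"
    using p.lw.tree_compat_iso[OF q.lw.lwbp_axioms gf(1-4,6) q.comb_graph_compat] .
  have ends: "between_ends (verts p.G) 1 ?N id" "between_ends (verts p.G) 1 ?N (\<lambda>v. id (g v))"
    using V g_range g1 gN by (auto simp: between_ends_def)
  have mono: "u < v \<longleftrightarrow> g u < g v" if "u \<in> {1..?N}" "v \<in> {1..?N}" for u v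
    using p.lw.tree_compat_unique[OF _ _ _ p.comb_graph_compat ends(1) compat_g ends(2), of u v] that V assms(2)
    by auto
  have g_id: "g v = v" if v: "v \<in> {1..?N}" for v
  proof -
    \<comment> \<open>A monotone bijection preserves the number of smaller elements, so
      \<open>g\<close> is the identity on \<open>{1..?N}\<close>.\<close>
    have "{u \<in> {1..?N}. u < g v} = g ` {u \<in> {1..?N}. u < v}"
    proof (intro set_eqI iffI)
      fix u assume u: "u \<in> {u \<in> {1..?N}. u < g v}"
      then obtain u' where "u' \<in> {1..?N}" "u = g u'"
        using bij_betw_imp_surj_on[OF gf(1)] V by (metis (no_types, lifting) imageE mem_Collect_eq)
      then show "u \<in> g ` {u \<in> {1..?N}. u < v}" using u mono[OF _ v] by auto
    next
      fix u assume "u \<in> g ` {u \<in> {1..?N}. u < v}"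
      then show "u \<in> {u \<in> {1..?N}. u < g v}" using mono[OF _ v] g_range by auto
    qed
    moreover have "inj_on g {u \<in> {1..?N}. u < v}"
      by (rule inj_on_subset[OF bij_betw_imp_inj_on[OF gf(1)]]) (use V in auto)
    ultimately have card: "card {u \<in> {1..?N}. u < g v} = card {u \<in> {1..?N}. u < v}"
      by (simp add: card_image)
    have "card {u \<in> {1..?N}. u < k} = k - 1" if "k \<le> ?N" for k
    proof -
      have "{u \<in> {1..?N}. u < k} = {1..<k}" using that by auto
      then show ?thesis by simp
    qed
    then have "g v - 1 = v - 1" using card v g_range[of v] by simp
    then show ?thesis using v g_range[of v] by auto
  qed
  show "P = Q"
  proof (rule nth_equalityI)
    show "length P = length Q" using len by simp
    fix i assume "i < length P"
    then show "P ! i = Q ! i" using lab[of "Suc i"] g_id[of "Suc i"] len by simp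
  qed
next
  fix X assume "X \<in> Comb wt ` tree_permutations S wt"
  then obtain P where P: "P \<in> tree_permutations S wt" "X = Comb wt P" by blast
  interpret p: combing S wt P using assms P(1) by unfold_locales
  have ne: "P \<noteq> []" using p.N_card assms(2) by auto
  have "hd P \<noteq> last P"
    using ne p.P_set(2) p.N_card assms(2) nth_eq_iff_index_eq[OF p.P_set(2), of 0 "length P - 1"]
    by (simp add: hd_conv_nth last_conv_nth)
  moreover have "hd P \<in> S" "last P \<in> S" using ne p.P_set(1) by auto
  moreover have "iso_rel `` {p.G} \<in> Tree S wt"
    unfolding Tree_def using p.comb_graph_tree by (intro quotientI) simp
  ultimately show "X \<in> twice_marked_trees S wt"
    using P(2) by (simp add: twice_marked_trees_def Comb_def)
next
  fix X assume "X \<in> twice_marked_trees S wt"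
  then obtain T :: "(nat, rect, 's) lw_plane_graph" and a b
    where T: "lwbp_tree S wt T" and X: "X = (iso_rel `` {T}, a, b)" and ab: "a \<in> S" "b \<in> S" "a \<noteq> b"
    by (auto simp: twice_marked_trees_def Tree_def quotient_def)
  interpret t: lwbp S wt T
    using T assms(1) by unfold_locales (auto simp: full_passport_def)
  obtain u v where uv: "u \<in> verts T" "lab T u = a" "v \<in> verts T" "lab T v = b"
    using ab bij_betw_imp_surj_on[OF t.lab_bij] by (metis imageE)
  have card: "card (verts T) = card S" using bij_betw_same_card[OF t.lab_bij] .
  have "u \<noteq> v" using uv ab by auto
  then obtain pos where pos: "t.tree_compat pos" "between_ends (verts T) u v pos"
    "bij_betw pos (verts T) {1..card S}"
    using t.tree_compat_exists[of u v] uv card by metis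
  interpret c: compat_tree S wt T pos using assms pos by unfold_locales
  let ?P = c.order
  have ne: "?P \<noteq> []" using c.length_order assms(2) by auto
  have "pos u = 1"
    using pos(2) c.pos_range[OF uv(1)] c.pos_surj[of 1] assms(2) unfolding between_ends_def by force
  then have "hd ?P = a" using c.order_nth[OF uv(1)] uv(2) ne by (simp add: hd_conv_nth)
  have "pos v = card S"
    using pos(2) c.pos_range[OF uv(3)] c.pos_surj[of "card S"] assms(2) unfolding between_ends_def by force
  then have "last ?P = b" using c.order_nth[OF uv(3)] uv(4) ne by (simp add: last_conv_nth c.length_order)
  have iso: "plane_iso T (comb_graph wt ?P)" by (rule c.plane_iso_comb_graph)
  have "iso_rel `` {T} = iso_rel `` {comb_graph wt ?P}"
    using plane_iso_trans[OF iso] plane_iso_trans[OF t.plane_iso_sym[OF iso]] by (auto simp: iso_rel_def)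
  then have "X = Comb wt ?P"
    using X \<open>hd ?P = a\<close> \<open>last ?P = b\<close> by (simp add: Comb_def)
  then show "X \<in> Comb wt ` tree_permutations S wt"
    using c.order_tree_permutation by blast
qed

end
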